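(* Let $\xi$ be a positive integer-valued random variable with $1\le \xi\le \kappa$ almost surely for some constant $\kappa>1$, and assume $\mathbb{E}\,\xi>1$. For every $\varepsilon\in(0,1)$ there exists a constant $\gamma>0$ such that, whenever $r_n\ge \gamma\sqrt{\log n/n}$ for all $n$, $$\mathbb{P}\big(\mathscr C_1(\Gamma_n(r_n,\xi))\ge (1-\varepsilon)n\big)\longrightarrow 1 \quad (n\to\infty).$$
   Context: The unit square $[0,1]^2$ is viewed as a torus with distance $d(x,y)=\big(\sum_{i=1}^2\min(|x_i-y_i|,1-|x_i-y_i|)^2\big)^{1/2}$, and $B(x,r)=\{y: d(x,y)<r\}$. Let $\mathbf X=\{X_1,\dots,X_n\}$ be independent uniform points in $[0,1]^2$, and $r_n>0$. For $x\in[0,1]^2$ let $\rho(x)=|B(x,r_n)\cap\mathbf X|$. Each point $X_u$ is given an independent copy $\xi_u$ of $\xi$ (independent of $\mathbf X$); then, independently over $u$, a subset $\mathbf Y(X_u)$ of $\mathbf X\cap B(X_u,r_n)$ of size $\xi_u\wedge\rho(X_u)$ is chosen uniformly at random (without replacement). The digraph $\Gamma_n^+$ on vertex set $[n]=\{1,\dots,n\}$ has an oriented edge $(u,v)$, $u\neq v$, iff $X_v\in\mathbf Y(X_u)$ (a vertex selecting itself creates no edge). The random irrigation graph $\Gamma_n=\Gamma_n(r_n,\xi)$ is the undirected graph on $[n]$ in which $\{u,v\}$ is an edge iff $(u,v)$ or $(v,u)$ is an edge of $\Gamma_n^+$. For a graph $G$, $\mathscr C_1(G)$ denotes the number of vertices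 of its largest connected component. *)

theory Defs
  imports "HOL-Probability.Probability"
begin

definition tdist :: "real \<times> real \<Rightarrow> real \<times> real \<Rightarrow> real" where
  "tdist x y = sqrt ((min \<bar>fst x - fst y\<bar> (1 - \<bar>fst x - fst y\<bar>))\<^sup>2
                   + (min \<bar>snd x - snd y\<bar> (1 - \<bar>snd x - snd y\<bar>))\<^sup>2)"

definition unif_sq :: "(real \<times> real) measure" where
  "unif_sq = uniform_measure lborel ({0..1} \<times> {0..1})"

definition points_measure :: "nat \<Rightarrow> (nat \<Rightarrow> real \<times> real) measure" where
  "points_measure n = PiM {..<n} (\<lambda>_. unif_sq)"

definition nbhd :: "nat \<Rightarrow> real \<Rightarrow> (nat \<Rightarrow> real \<times> real) \<Rightarrow> nat \<Rightarrow> nat set" where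
  "nbhd n r x u = {v. v < n \<and> tdist (x u) (x v) < r}"

definition sel_pmf :: "nat pmf \<Rightarrow> nat \<Rightarrow> real \<Rightarrow> (nat \<Rightarrow> real \<times> real) \<Rightarrow> nat \<Rightarrow> nat set pmf" where
  "sel_pmf xi n r x u =
     bind_pmf xi (\<lambda>k. pmf_of_set {S. S \<subseteq> nbhd n r x u \<and> card S = min k (card (nbhd n r x u))})"

definition irrig_pmf :: "nat pmf \<Rightarrow> nat \<Rightarrow> real \<Rightarrow> (nat \<Rightarrow> real \<times> real) \<Rightarrow> (nat \<Rightarrow> nat set) pmf" where
  "irrig_pmf xi n r x = Pi_pmf {..<n} {} (\<lambda>u. sel_pmf xi n r x u)"

definition irrig_edges :: "nat \<Rightarrow> (nat \<Rightarrow> nat set) \<Rightarrow> (nat \<times> nat) set" where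
  "irrig_edges n Y = {(u, v). u < n \<and> v < n \<and> u \<noteq> v \<and> (v \<in> Y u \<or> u \<in> Y v)}"

definition largest_comp :: "nat \<Rightarrow> (nat \<times> nat) set \<Rightarrow> nat" where
  "largest_comp n E = Max (insert 0 ((\<lambda>u. card {v. v < n \<and> (u, v) \<in> E\<^sup>*}) ` {..<n}))"

text \<open>P(C_1(Gamma_n(r,xi)) >= (1-eps) n): integrate the conditional probability given X.\<close>
definition prob_giant :: "nat pmf \<Rightarrow> nat \<Rightarrow> real \<Rightarrow> real \<Rightarrow> ennreal" where
  "prob_giant xi n r eps =
     (\<integral>\<^sup>+ x. emeasure (measure_pmf (irrig_pmf xi n r x))
              {Y. real (largest_comp n (irrig_edges n Y)) \<ge> (1 - eps) * real n}
      \<partial>points_measure n)"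

end

theory Submission
  imports Defs "HOL-Real_Asymp.Real_Asymp"
begin

text \<open>Call a vertex set \<open>A\<close> closed if no edge joins \<open>A\<close> to its complement. A vertex with a
  fraction \<open>a\<close> of its neighbourhood in \<open>A\<close> respects the cut with probability at most \<open>E a ^ \<xi>\<close> if it lies
  in \<open>A\<close> and \<open>E (1 - a) ^ \<xi>\<close> if not. If \<open>a\<close> depended only on the densities of \<open>A\<close> in the cells
  of a fine grid, summing over all \<open>A\<close> with prescribed densities would give the product of the factors
  \<open>E (a ^ \<xi> + (1 - a) ^ \<xi>) \<le> 1 - 2 p a (1 - a)\<close> with \<open>p = P(\<xi> \<ge> 2) > 0\<close>. So a closed
  set that is locally mixed, with \<open>a\<close> away from 0 and 1, pays an exponential price per vertex.

  This is applied in a window of bounded size around the mixed place. Vertices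
  near the rim of the window are unconstrained and cost entropy, but the entropy of a rim cell is controlled by
  the number of minority points in it. If in every window of radius at most a constant the entropy exceeded the gain,
  the minority mass would grow geometrically with the radius, against the quadratic growth of
  the volume. Hence a set mixed at a given place is closed with probability at most \<open>n ^ O(1) exp (- c N)\<close>, where
  \<open>N \<ge> C \<gamma>\<^sup>2 ln n\<close> is the mean number of points in a cell, and a union bound excludes all places. A closed set
  that is mixed nowhere has density near 0 everywhere or near 1 everywhere, so all closed sets are
  tiny or almost everything, and some component is almost everything.\<close>

section \<open>Closed sets and the selection law\<close>

text \<open>Localisation is forced by two global costs. Replacing true neighbourhoods by unions of
  cells costs \<open>3 * \<eta>\<close> per vertex in the exponent, and the number of density
  profiles is exponential in the number of cells; over the whole square both could swamp the gain of
  a set that is mixed in one place only. A window of boundedly many cells has polynomially many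
  profiles, and its total error can be made a small multiple of the gain. For this the gain must be
  comparable with the whole window, not with one cell: densities vary slowly, so one mixed cell
  makes a fixed proportion of its neighbourhood mixed, and this starts the growth. The tension is in
  the weight \<open>t\<close> of a rim vertex. A free rim costs \<open>t\<close> per vertex and
  \<open>ln (1 / t)\<close> per minority vertex: \<open>t\<close> must be small against the
  quadratic volume, but a small \<open>t\<close> slows the growth. As the rate suffers only
  logarithmically, \<open>t = 1 / j ^ 3\<close> with a large radius parameter \<open>j\<close>
  satisfies both. The constants are fixed in the order radius and weight, fineness of the cells, and
  last \<open>\<gamma>\<close>.\<close>

definition cut_free :: "nat \<Rightarrow> (nat \<Rightarrow> nat set) \<Rightarrow> nat set \<Rightarrow> bool" where
  "cut_free n Y A \<longleftrightarrow> A \<subseteq> {..<n} \<and> (\<forall>u<n. Y u \<subseteq> (if u \<in> A then A else - A))"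

text \<open>Passes from edges to selections: \<open>cut_free\<close> is a conjunction of conditions
  on the single sets \<open>Y u\<close>, so for a fixed \<open>A\<close> its probability is a
  product over the vertices.\<close>

lemma cut_free_if_edge_closed:
  assumes Y: "\<And>u. u < n \<Longrightarrow> Y u \<subseteq> {..<n}" and A: "A \<subseteq> {..<n}"
    and closed: "\<And>u v. (u, v) \<in> irrig_edges n Y \<Longrightarrow> u \<in> A \<longleftrightarrow> v \<in> A"
  shows "cut_free n Y A"
  unfolding cut_free_def
proof (intro conjI allI impI A subsetI)
  fix u v assume "u < n" "v \<in> Y u"
  then have "u = v \<or> (u, v) \<in> irrig_edges n Y"
    using Y by (auto simp: irrig_edges_def)
  then show "v \<in> (if u \<in> A then A else - A)"
    using closed by auto
qed

text \<open>Unions of components are closed, hence tiny or almost everything. When the components of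
  the vertices \<open>0, 1, ...\<close> are added one at a time, the union jumps at some vertex from
  at most \<open>e * n\<close> to at least \<open>(1 - e) * n\<close>. The component added there
  exceeds \<open>e * n\<close>, since \<open>e < 1/3\<close>, and being closed itself it is almost
  everything.\<close>

lemma largest_comp_ge_if_no_balanced_cut:
  assumes Y: "\<And>u. u < n \<Longrightarrow> Y u \<subseteq> {..<n}" and n: "n > 0" and e: "0 < e" "e < 1/3"
    and cuts: "\<And>A. cut_free n Y A \<Longrightarrow> real (card A) \<le> e * n \<or> real (card A) \<ge> (1 - e) * n"
  shows "real (largest_comp n (irrig_edges n Y)) \<ge> (1 - e) * real n"
proof -
  define E where "E = irrig_edges n Y"
  have symE: "sym E" by (auto simp: E_def irrig_edges_def sym_def)
  define C where "C u = {v. v < n \<and> (u, v) \<in> E\<^sup>*}" for u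
  have C_closed: "v \<in> C u \<longleftrightarrow> w \<in> C u" if "(v, w) \<in> E" for u v w
  proof -
    have "(w, v) \<in> E" using symE that by (auto dest: symD)
    moreover have "v < n" "w < n" using that by (auto simp: E_def irrig_edges_def)
    ultimately show ?thesis using that
      by (auto simp: C_def intro: rtrancl_into_rtrancl)
  qed
  have cf: "cut_free n Y (\<Union>u\<in>I. C u)" for I
    by (rule cut_free_if_edge_closed[OF Y]) (use C_closed in \<open>auto simp: C_def E_def\<close>)
  define U where "U k = (\<Union>u<k. C u)" for k
  have Un: "U n = {..<n}" by (auto simp: U_def C_def)
  define k where "k = (LEAST k. real (card (U k)) \<ge> (1 - e) * n)"
  have "real (card (U n)) \<ge> (1 - e) * n" using e by (simp add: Un mult_left_le_one_le)
  then have k: "real (card (U k)) \<ge> (1 - e) * n" and kn: "k \<le> n"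
    unfolding k_def by (rule LeastI, rule Least_le)
  have "k \<noteq> 0"
  proof
    assume "k = 0"
    then have "(1 - e) * n \<le> 0" using k by (simp add: U_def)
    then show False using n e by (simp add: mult_le_0_iff)
  qed
  then obtain j where j: "k = Suc j" by (cases k) auto
  have "\<not> real (card (U j)) \<ge> (1 - e) * n"
    using not_less_Least[of j "\<lambda>k. real (card (U k)) \<ge> (1 - e) * n"] j k_def by auto
  moreover have "cut_free n Y (U j)" using cf unfolding U_def by blast
  ultimately have Uj: "real (card (U j)) \<le> e * n" using cuts by blast
  have "card (U k) \<le> card (U j) + card (C j)"
    using card_Un_le[of "U j" "C j"] by (simp add: U_def j lessThan_Suc Un_commute)
  then have "real (card (C j)) \<ge> (1 - e) * n - e * n" using k Uj by linarith
  moreover have "(1 - e) * n - e * n > e * n"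
  proof -
    have "(1 - 3 * e) * n > 0" using n e by simp
    then show ?thesis by (simp add: algebra_simps)
  qed
  moreover have "cut_free n Y (C j)" using cf[of "{j}"] by simp
  ultimately have "real (card (C j)) \<ge> (1 - e) * n" using cuts[of "C j"] by linarith
  moreover have "card (C j) \<le> largest_comp n E"
    unfolding largest_comp_def using j kn by (intro Max_ge) (auto simp: C_def)
  ultimately show ?thesis by (simp add: E_def)
qed

section \<open>Sampling without replacement: the chance that a selection stays on one side\<close>

lemma binomial_ratio_le_power:
  assumes "a \<le> N"
  shows "real (a choose j) * real N ^ j \<le> real (N choose j) * real a ^ j"
proof (induction j)
  case (Suc j)
  show ?case
  proof (cases "j < a")
    case True
    have *: "real (m choose Suc j) = real (m choose j) * (real m - j) / Suc j" if "j \<le> m" for m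
    proof -
      have "real (Suc j) * (m choose Suc j) = (real m - j) * (m choose j)"
        using that by (metis binomial_absorb_comp binomial_absorption of_nat_diff of_nat_mult)
      then show ?thesis by (simp add: field_simps)
    qed
    \<comment> \<open>The ratio of the two binomials gains the factor
      \<open>(a - j) / (N - j)\<close>, which is at most \<open>a / N\<close> because
      \<open>a \<le> N\<close>.\<close>
    have "(real a - j) * N \<le> (real N - j) * a"
      using assms by (simp add: algebra_simps mult_right_mono)
    moreover have "0 \<le> (real a - j) * N" using True by simp
    ultimately have "(real (a choose j) * real N ^ j) * ((real a - j) * N)
        \<le> (real (N choose j) * real a ^ j) * ((real N - j) * a)"
      by (intro mult_mono[OF Suc]) auto
    then show ?thesis using True assms by (simp add: * divide_right_mono mult_ac)
  qed (simp add: binomial_eq_0)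
qed auto

lemma finite_nbhd [simp]: "finite (nbhd n r x u)"
  by (simp add: nbhd_def)

lemma prob_uniform_subset_le:
  fixes a :: real
  assumes fin: "finite B" and j: "j \<le> card B" and a: "real (card (B \<inter> A)) \<le> a * card B"
  shows "measure (pmf_of_set {S. S \<subseteq> B \<and> card S = j}) {S. S \<subseteq> A} \<le> a ^ j"
proof -
  let ?F = "{S. S \<subseteq> B \<and> card S = j}"
  have finF: "finite ?F" using fin by auto
  have cF: "card ?F = card B choose j" using n_subsets[OF fin] by simp
  then have pos: "card B choose j > 0" using j by simp
  have ne: "?F \<noteq> {}" using cF j by (metis card.empty pos less_irrefl)
  have "?F \<inter> {S. S \<subseteq> A} = {S. S \<subseteq> B \<inter> A \<and> card S = j}" by auto
  then have m: "measure (pmf_of_set ?F) {S. S \<subseteq> A} = real (card (B \<inter> A) choose j) / real (card B choose j)"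
    using n_subsets[of "B \<inter> A" j] fin cF by (simp add: measure_pmf_of_set[OF ne finF])
  show ?thesis
  proof (cases "card B = 0")
    case True
    then show ?thesis using m j by simp
  next
    case False
    have "real (card (B \<inter> A) choose j) * real (card B) ^ j
        \<le> real (card B choose j) * real (card (B \<inter> A)) ^ j"
      by (rule binomial_ratio_le_power) (auto intro: card_mono fin)
    also have "\<dots> \<le> real (card B choose j) * (a * card B) ^ j"
      using a by (intro mult_left_mono power_mono) auto
    finally have "real (card (B \<inter> A) choose j) * real (card B) ^ j
        \<le> (real (card B choose j) * a ^ j) * real (card B) ^ j"
      by (simp add: power_mult_distrib mult_ac)
    then have "real (card (B \<inter> A) choose j) \<le> real (card B choose j) * a ^ j"
      using False by (simp add: mult_le_cancel_right)
    then show ?thesis using pos by (simp add: m divide_le_eq mult.commute)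
  qed
qed

text \<open>One selected point lies in \<open>A\<close> with probability at most \<open>a\<close>,
  two or more with probability at most \<open>a\<^sup>2\<close>, so the law of \<open>xi\<close>
  enters only through \<open>p\<close>. In the applications \<open>a\<close> is a cell density times
  \<open>1 + \<eta>\<close> and may exceed 1.\<close>

lemma prob_selection_subset_le:
  fixes a :: real
  assumes xi: "\<forall>k\<in>set_pmf xi. 1 \<le> k" and p: "p = measure_pmf.prob xi {2..}"
    and two: "2 \<le> card (nbhd n r x u)"
    and a: "real (card (nbhd n r x u \<inter> A)) \<le> a * card (nbhd n r x u)"
  shows "measure (sel_pmf xi n r x u) {S. S \<subseteq> A} \<le> (1 - p) * a + p * a\<^sup>2"
proof -
  define B where "B = nbhd n r x u"
  have fin: "finite B" by (simp add: B_def)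
  define f where "f k = measure (pmf_of_set {S. S \<subseteq> B \<and> card S = min k (card B)}) {S. S \<subseteq> A}" for k
  \<comment> \<open>The true proportion is at most 1, so its powers decrease with the number of
    selected points; the bound \<open>a\<close> comes in only after the exponent has been cut to at
    most 2.\<close>
  define al where "al = real (card (B \<inter> A)) / card B"
  have al: "0 \<le> al" "al \<le> 1" "al \<le> a" "real (card (B \<inter> A)) \<le> al * card B"
    using a two card_mono[OF fin, of "B \<inter> A"] by (auto simp: al_def B_def divide_le_eq)
  have f_le: "f k \<le> a * indicator {..<2} k + a\<^sup>2 * indicator {2..} k" if "k \<in> set_pmf xi" for k
  proof -
    have "f k \<le> al ^ min k (card B)"
      unfolding f_def by (rule prob_uniform_subset_le[OF fin _ al(4)]) auto
    also have "\<dots> \<le> al ^ (min k 2)"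
      using two al by (intro power_decreasing) (auto simp: B_def)
    also have "\<dots> \<le> a ^ (min k 2)" using al by (intro power_mono) auto
    also have "\<dots> = a * indicator {..<2} k + a\<^sup>2 * indicator {2..} k"
    proof (cases "k \<ge> 2")
      case False
      then have "k = 1" using xi that by (auto simp: le_Suc_eq dest!: bspec[OF _ that])
      then show ?thesis by (simp add: indicator_def)
    qed (simp add: min_def)
    finally show ?thesis .
  qed
  have "emeasure (sel_pmf xi n r x u) {S. S \<subseteq> A} = (\<integral>\<^sup>+k. ennreal (f k) \<partial>xi)"
    by (simp add: sel_pmf_def f_def B_def flip: measure_pmf.emeasure_eq_measure)
  also have "\<dots> = ennreal (measure_pmf.expectation xi f)"
    by (intro nn_integral_eq_integral measure_pmf.integrable_const_bound[where B = 1])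
       (auto simp: f_def)
  finally have "measure (sel_pmf xi n r x u) {S. S \<subseteq> A} = measure_pmf.expectation xi f"
    by (simp add: measure_def f_def integral_nonneg_AE)
  also have "\<dots> \<le> measure_pmf.expectation xi (\<lambda>k. a * indicator {..<2} k + a\<^sup>2 * indicator {2..} k)"
  proof (rule integral_mono_AE)
    show "integrable xi f"
      by (rule measure_pmf.integrable_const_bound[where B = 1]) (auto simp: f_def)
    show "integrable xi (\<lambda>k. a * indicator {..<2} k + a\<^sup>2 * indicator {2..} k)"
      by (intro Bochner_Integration.integrable_add integrable_mult_right
          measure_pmf.integrable_const_bound[where B = 1]) auto
    show "AE k in xi. f k \<le> a * indicator {..<2} k + a\<^sup>2 * indicator {2..} k"
      using f_le by (auto simp: AE_measure_pmf_iff)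
  qed
  also have "\<dots> = a * measure_pmf.prob xi {..<2} + a\<^sup>2 * p"
    by (subst Bochner_Integration.integral_add)
       (auto simp: p intro!: integrable_mult_right measure_pmf.integrable_const_bound[where B = 1])
  also have "{..<2} = UNIV - {2::nat..}" by auto
  also have "measure_pmf.prob xi (UNIV - {2..}) = 1 - p"
    using measure_pmf.prob_compl[of "{2..}" xi] by (simp add: p)
  finally show ?thesis by (simp add: mult.commute)
qed

lemma prob_ge_2_pos:
  fixes xi :: "nat pmf"
  assumes xi: "\<forall>k\<in>set_pmf xi. 1 \<le> k" and E: "measure_pmf.expectation xi real > 1"
  shows "measure_pmf.prob xi {2..} > 0"
proof (rule ccontr)
  assume "\<not> ?thesis"
  then have "measure_pmf.prob xi {2..} = 0" by (simp add: zero_less_measure_iff)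
  then have "set_pmf xi \<inter> {2..} = {}" by (simp add: measure_pmf_zero_iff)
  then have "\<And>k. k \<in> set_pmf xi \<Longrightarrow> k = 1" using xi by force
  then have "measure_pmf.expectation xi real = measure_pmf.expectation xi (\<lambda>_. 1)"
    by (intro integral_cong_AE) (auto simp: AE_measure_pmf_iff)
  then show False using E by simp
qed

section \<open>Windows in a system of cells\<close>

primrec window :: "('q \<Rightarrow> 'q set) \<Rightarrow> 'q \<Rightarrow> nat \<Rightarrow> 'q set" where
  "window S q 0 = {q}"
| "window S q (Suc k) = (\<Union>q'\<in>window S q k. S q')"

definition minority :: "('q \<Rightarrow> nat) \<Rightarrow> ('q \<Rightarrow> nat) \<Rightarrow> 'q \<Rightarrow> real" where
  "minority N m q = min (real (m q)) (real (N q) - real (m q))"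

definition share :: "('q \<Rightarrow> nat) \<Rightarrow> ('q \<Rightarrow> nat) \<Rightarrow> 'q set \<Rightarrow> real" where
  "share N m X = real (sum m X) / real (sum N X)"

text \<open>Logarithm of the bound for the expected number of closed sets with cell profile \<open>m\<close>: vertices in the
  interior cells \<open>I\<close> must respect the cut, vertices in the rim \<open>B\<close> are free.\<close>

definition cut_exponent ::
  "real \<Rightarrow> real \<Rightarrow> real \<Rightarrow> ('q \<Rightarrow> 'q set) \<Rightarrow> ('q \<Rightarrow> nat) \<Rightarrow> ('q \<Rightarrow> nat) \<Rightarrow> 'q set \<Rightarrow> 'q set \<Rightarrow> real" where
  "cut_exponent p \<eta> t S N m I B =
     (\<Sum>q\<in>I. N q * (3 * \<eta> - 2 * p * (share N m (S q) * (1 - share N m (S q)))))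
   + (\<Sum>q\<in>B. t * N q + ln (1 / t) * minority N m q)"

text \<open>Separates the growth argument from the geometry. \<open>\<omega>\<close> is the order of
  the number of cells in a neighbourhood, \<open>\<nu>\<close> the mean number of points in a cell,
  and \<open>K\<close> absorbs constants. Of the plane only the quadratic bound on windows
  remains.\<close>

locale cell_system =
  fixes Q :: "'q set" and S :: "'q \<Rightarrow> 'q set" and N :: "'q \<Rightarrow> nat" and \<omega> K \<nu> :: real
  assumes fin_Q: "finite Q"
    and S_sub: "q \<in> Q \<Longrightarrow> S q \<subseteq> Q"
    and S_refl: "q \<in> Q \<Longrightarrow> q \<in> S q"
    and S_sym: "q \<in> Q \<Longrightarrow> q' \<in> S q \<Longrightarrow> q \<in> S q'"
    and omega: "\<omega> \<ge> 1" and lam: "\<nu> > 0"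
    and card_S: "q \<in> Q \<Longrightarrow> \<omega> \<le> card (S q)" "q \<in> Q \<Longrightarrow> card (S q) \<le> K * \<omega>"
    and N_bounds: "q \<in> Q \<Longrightarrow> \<nu> / 2 \<le> N q" "q \<in> Q \<Longrightarrow> N q \<le> 2 * \<nu>"
    and card_window: "q \<in> Q \<Longrightarrow> card (window S q k) \<le> K * (real k + 1)\<^sup>2 * \<omega>"
begin

lemma K_ge_1: "q \<in> Q \<Longrightarrow> 1 \<le> K"
proof -
  assume "q \<in> Q"
  then have "\<omega> \<le> K * \<omega>" using card_S[of q] by linarith
  then show ?thesis using omega by simp
qed

lemma window_sub: "q \<in> Q \<Longrightarrow> window S q k \<subseteq> Q"
  by (induction k) (use S_sub in auto)

lemma finite_window: "q \<in> Q \<Longrightarrow> finite (window S q k)"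
  using window_sub fin_Q finite_subset by blast

lemma window_mono: "q \<in> Q \<Longrightarrow> window S q k \<subseteq> window S q (Suc k)"
  using window_sub[of q k] S_refl by force

lemma window_mono': "q \<in> Q \<Longrightarrow> i \<le> k \<Longrightarrow> window S q i \<subseteq> window S q k"
  by (rule lift_Suc_mono_le[of "window S q"]) (use window_mono in auto)

lemma finite_S: "q \<in> Q \<Longrightarrow> finite (S q)"
  using S_sub fin_Q finite_subset by blast

lemma sum_N_S_bounds:
  assumes "q \<in> Q"
  shows "\<nu> / 2 * \<omega> \<le> real (sum N (S q))" "real (sum N (S q)) \<le> 2 * \<nu> * K * \<omega>"
proof -
  have "\<nu> / 2 * \<omega> \<le> \<nu> / 2 * card (S q)" using lam card_S[OF assms] by simp
  also have "\<dots> = (\<Sum>q'\<in>S q. \<nu> / 2)" by simp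
  also have "\<dots> \<le> (\<Sum>q'\<in>S q. real (N q'))" using N_bounds S_sub[OF assms] by (intro sum_mono) auto
  finally show "\<nu> / 2 * \<omega> \<le> real (sum N (S q))" by simp
  have "(\<Sum>q'\<in>S q. real (N q')) \<le> (\<Sum>q'\<in>S q. 2 * \<nu>)"
    using N_bounds S_sub[OF assms] by (intro sum_mono) auto
  also have "\<dots> \<le> 2 * \<nu> * (K * \<omega>)" using card_S[OF assms] lam by simp
  finally show "real (sum N (S q)) \<le> 2 * \<nu> * K * \<omega>" by simp
qed

lemma sum_N_S_pos: "q \<in> Q \<Longrightarrow> 0 < real (sum N (S q))"
  using sum_N_S_bounds(1)[of q] lam omega by (smt (verit) divide_pos_pos mult_pos_pos)

lemma sum_N_window:
  assumes "q \<in> Q" "A \<subseteq> window S q k" "k \<le> k'"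
  shows "real (sum N A) \<le> 2 * K * (real k' + 1)\<^sup>2 * \<nu> * \<omega>"
proof -
  have A: "A \<subseteq> window S q k'" using assms window_mono' by blast
  have "real (sum N A) \<le> real (sum N (window S q k'))"
    using A finite_window[OF assms(1)] by (intro of_nat_mono sum_mono2) auto
  also have "\<dots> \<le> (\<Sum>q'\<in>window S q k'. 2 * \<nu>)"
    using N_bounds window_sub[OF assms(1)] unfolding of_nat_sum by (intro sum_mono) auto
  also have "\<dots> \<le> 2 * \<nu> * (K * (real k' + 1)\<^sup>2 * \<omega>)"
    using card_window[OF assms(1), of k'] lam by simp
  finally show ?thesis by (simp add: mult_ac)
qed

section \<open>Gain of a window against its minority mass\<close>

context
  fixes m :: "'q \<Rightarrow> nat"
  assumes m_le: "q \<in> Q \<Longrightarrow> m q \<le> N q"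
begin

lemma minority_nonneg: "q \<in> Q \<Longrightarrow> 0 \<le> minority N m q"
  using m_le[of q] by (auto simp: minority_def)

lemma share_bounds: "X \<subseteq> Q \<Longrightarrow> 0 \<le> share N m X" "X \<subseteq> Q \<Longrightarrow> share N m X \<le> 1"
  using sum_mono[of X m N] m_le by (auto simp: share_def divide_le_eq_1 subset_iff simp flip: of_nat_sum)

text \<open>The minority masses of the cells of \<open>S q\<close> add up to at most the smaller
  side of \<open>S q\<close>, and \<open>a * (1 - a)\<close> is at least half the smaller of
  \<open>a\<close> and \<open>1 - a\<close>. The constant 8 collects this 2, the 2 in
  \<open>N q \<ge> \<nu> / 2\<close> and the 2 in the upper bound for the points of
  \<open>S q\<close>.\<close>

lemma share_product_ge_minority:
  assumes q: "q \<in> Q"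
  shows "real (N q) * (share N m (S q) * (1 - share N m (S q))) \<ge> (\<Sum>q'\<in>S q. minority N m q') / (8 * K * \<omega>)"
proof -
  let ?M = "real (sum m (S q))" and ?T = "real (sum N (S q))" and ?s = "\<Sum>q'\<in>S q. minority N m q'"
  have T: "0 < ?T" by (rule sum_N_S_pos[OF q])
  have s1: "?s \<le> ?M" unfolding of_nat_sum by (rule sum_mono) (simp add: minority_def)
  have "?s \<le> (\<Sum>q'\<in>S q. real (N q') - real (m q'))" by (rule sum_mono) (simp add: minority_def)
  then have s2: "?s \<le> ?T - ?M" by (simp add: sum_subtractf)
  have s0: "0 \<le> ?s" using S_sub[OF q] minority_nonneg by (intro sum_nonneg) auto
  have "?s * ?T \<le> 2 * (?M * (?T - ?M))"
  proof (cases "?M \<le> ?T / 2")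
    case True
    then have "?s * (?T / 2) \<le> ?M * (?T - ?M)" using s1 s0 T by (intro mult_mono) auto
    then show ?thesis by simp
  next
    case False
    then have "(?T / 2) * ?s \<le> ?M * (?T - ?M)" using s2 s0 T by (intro mult_mono) auto
    then show ?thesis by (simp add: mult_ac)
  qed
  then have a: "?s / (2 * ?T) \<le> share N m (S q) * (1 - share N m (S q))"
    using T by (simp add: share_def field_simps del: of_nat_sum)
  have "?s / (8 * K * \<omega>) = (\<nu> / 2) * (?s / (2 * (2 * \<nu> * K * \<omega>)))"
    using lam K_ge_1[OF q] omega by (simp add: field_simps)
  also have "\<dots> \<le> (\<nu> / 2) * (?s / (2 * ?T))"
    using sum_N_S_bounds[OF q] T s0 lam omega K_ge_1[OF q]
    by (intro mult_left_mono divide_left_mono) (auto intro!: mult_pos_pos)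
  also have "\<dots> \<le> real (N q) * (share N m (S q) * (1 - share N m (S q)))"
    using a N_bounds(1)[OF q] s0 T lam by (intro mult_mono) auto
  finally show ?thesis .
qed

text \<open>Double counting: by symmetry of \<open>S\<close>, each cell of the window of radius
  \<open>k\<close> lies in \<open>S q\<close> for at least \<open>\<omega>\<close> cells
  \<open>q\<close> of the next window, which cancels the \<open>\<omega>\<close> in the denominator
  of the local bound.\<close>

lemma sum_share_product_ge_minority:
  assumes q0: "q0 \<in> Q"
  shows "(\<Sum>q\<in>window S q0 (Suc k). real (N q) * (share N m (S q) * (1 - share N m (S q))))
       \<ge> (\<Sum>q\<in>window S q0 k. minority N m q) / (8 * K)"
proof -
  let ?W = "window S q0 k" and ?W' = "window S q0 (Suc k)"
  note sub = window_sub[OF q0] and fin = finite_window[OF q0]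
  have "(\<Sum>q\<in>?W. minority N m q) / (8 * K) = (\<Sum>q\<in>?W. \<omega> * minority N m q) / (8 * K * \<omega>)"
    using omega by (simp flip: sum_distrib_left)
  also have "\<dots> \<le> (\<Sum>q\<in>?W. \<Sum>q'\<in>S q. minority N m q) / (8 * K * \<omega>)"
    using K_ge_1[OF q0] omega sub[of k] card_S minority_nonneg
    by (intro divide_right_mono sum_mono) (auto intro!: mult_right_mono)
  also have "(\<Sum>q\<in>?W. \<Sum>q'\<in>S q. minority N m q) = (\<Sum>(q,q')\<in>Sigma ?W S. minority N m q)"
    using fin sub[of k] finite_S by (subst sum.Sigma) auto
  also have "\<dots> = (\<Sum>(q',q)\<in>prod.swap ` Sigma ?W S. minority N m q)"
    by (subst sum.reindex) (auto simp: case_prod_unfold)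
  also have "\<dots> \<le> (\<Sum>(q',q)\<in>Sigma ?W' S. minority N m q)"
  proof (rule sum_mono2)
    show "finite (Sigma ?W' S)" using fin sub[of "Suc k"] finite_S by (intro finite_SigmaI) (auto simp del: window.simps)
    show "prod.swap ` Sigma ?W S \<subseteq> Sigma ?W' S" using sub[of k] S_sym by auto
    show "0 \<le> (case b of (q', q) \<Rightarrow> minority N m q)" if "b \<in> Sigma ?W' S - prod.swap ` Sigma ?W S" for b
      using that sub[of "Suc k"] S_sub minority_nonneg by (auto simp del: window.simps)
  qed
  also have "\<dots> = (\<Sum>q\<in>?W'. \<Sum>q'\<in>S q. minority N m q')"
    using fin sub[of "Suc k"] finite_S by (subst sum.Sigma) (auto simp del: window.simps)
  also have "(\<Sum>q\<in>?W'. \<Sum>q'\<in>S q. minority N m q') / (8 * K * \<omega>)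
      = (\<Sum>q\<in>?W'. (\<Sum>q'\<in>S q. minority N m q') / (8 * K * \<omega>))"
    by (simp add: sum_divide_distrib)
  also have "\<dots> \<le> (\<Sum>q\<in>?W'. real (N q) * (share N m (S q) * (1 - share N m (S q))))"
    using sub[of "Suc k"] by (intro sum_mono share_product_ge_minority) auto
  finally show ?thesis using omega K_ge_1[OF q0] by (simp add: divide_right_mono del: window.simps)
qed

text \<open>Failure in all windows gives \<open>F (k + 2) + G' \<ge> (1 + \<beta>) (F k + G')\<close> for the minority mass
  \<open>F k\<close> of the window of radius \<open>k\<close>, which outgrows its volume.\<close>

lemma exists_good_window:
  assumes q0: "q0 \<in> Q" and p: "0 < p" and t: "0 < t" "t < 1" and \<eta>: "0 \<le> \<eta>" and pos: "0 < \<kappa>" "0 < d"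
    and Z: "Z \<subseteq> S q0" "\<kappa> * \<omega> \<le> card Z" "\<And>q. q \<in> Z \<Longrightarrow> d \<le> share N m (S q) * (1 - share N m (S q))"
    and c: "0 < c" "c + (3 * \<eta> + t) * (2 * K * (2 * real j + 2)\<^sup>2) \<le> p * \<kappa> * d / 4"
    and growth: "(1 + p / (8 * K * ln (1 / t))) ^ j * (\<kappa> * d) > (2 * real j + 1)\<^sup>2 + \<kappa> * d"
  shows "\<exists>k\<in>{1..2*j}. cut_exponent p \<eta> t S N m (window S q0 k) (window S q0 (Suc k) - window S q0 k) \<le> - c * \<nu>"
proof (rule ccontr)
  assume fail: "\<not> ?thesis"
  note K1 = K_ge_1[OF q0]
  define l where "l = ln (1 / t)"
  have l: "l > 0" using t by (simp add: l_def)
  define \<beta> where "\<beta> = p / (8 * K * l)"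
  have \<beta>: "\<beta> > 0" using p l K1 by (simp add: \<beta>_def)
  define F where "F k = (\<Sum>q\<in>window S q0 k. minority N m q)" for k
  define G where "G k = (\<Sum>q\<in>window S q0 k. real (N q) * (share N m (S q) * (1 - share N m (S q))))" for k
  \<comment> \<open>The gain guaranteed by \<open>Z\<close> alone; every window of radius at least 1
    contains \<open>Z\<close>.\<close>
  define G0 where "G0 = \<kappa> * \<omega> * (\<nu> / 2 * d)"
  \<comment> \<open>Chosen so that \<open>\<beta> * G' = p * G0 / (2 * l)\<close>: the shift by
    \<open>G'\<close> makes the affine recursion purely geometric and gives a positive start even if
    \<open>F 0 = 0\<close>.\<close>
  define G' where "G' = 4 * K * G0"
  note sub = window_sub[OF q0] and fin = finite_window[OF q0]
  have G0: "G0 \<le> G k" if "k \<ge> 1" for k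
  proof -
    have "Z \<subseteq> window S q0 1" using Z by simp
    then have Zk: "Z \<subseteq> window S q0 k" using window_mono'[OF q0 that] by blast
    have "G0 \<le> real (card Z) * (\<nu> / 2 * d)"
      unfolding G0_def using Z lam pos by (intro mult_right_mono) auto
    also have "\<dots> = (\<Sum>q\<in>Z. \<nu> / 2 * d)" by simp
    also have "\<dots> \<le> (\<Sum>q\<in>Z. real (N q) * (share N m (S q) * (1 - share N m (S q))))"
      using Z Zk sub[of k] N_bounds lam pos by (intro sum_mono mult_mono) auto
    also have "\<dots> \<le> G k" unfolding G_def
      using fin Zk sub[of k] share_bounds S_sub by (intro sum_mono2) auto
    finally show ?thesis .
  qed
  have GF: "F k / (8 * K) \<le> G (Suc k)" for k
    unfolding F_def G_def by (rule sum_share_product_ge_minority[OF q0])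
  \<comment> \<open>The gain of the window of radius \<open>k + 1\<close> is bounded below by
    \<open>F k\<close>, and its failure forces minority mass into the rim reaching to radius
    \<open>k + 2\<close>. Hence a step of two radii, and \<open>2 * j\<close> windows for
    \<open>j\<close> steps.\<close>
  have step: "(1 + \<beta>) * (F k + G') \<le> F (Suc (Suc k)) + G'" if k: "Suc k \<le> 2 * j" for k
  proof -
    let ?I = "window S q0 (Suc k)" and ?B = "window S q0 (Suc (Suc k)) - window S q0 (Suc k)"
    have IB: "window S q0 (Suc (Suc k)) = ?I \<union> ?B" using window_mono[OF q0, of "Suc k"] by blast
    have "F (Suc (Suc k)) = F (Suc k) + (\<Sum>q\<in>?B. minority N m q)"
      unfolding F_def by (subst IB, subst sum.union_disjoint) (auto simp: fin simp del: window.simps)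
    moreover have "- c * \<nu> < cut_exponent p \<eta> t S N m ?I ?B" using fail k by force
    moreover have "cut_exponent p \<eta> t S N m ?I ?B = 3 * \<eta> * real (sum N ?I) - 2 * p * G (Suc k)
        + t * real (sum N ?B) + l * (\<Sum>q\<in>?B. minority N m q)"
      by (simp add: cut_exponent_def G_def l_def sum.distrib sum_subtractf right_diff_distrib
          sum_distrib_left mult_ac del: window.simps)
    ultimately have 1: "l * (F (Suc (Suc k)) - F (Suc k)) > 2 * p * G (Suc k) - c * \<nu>
        - 3 * \<eta> * real (sum N ?I) - t * real (sum N ?B)" by simp
    let ?V = "2 * K * (2 * real j + 2)\<^sup>2 * \<nu> * \<omega>"
    have V: "real (sum N ?I) \<le> ?V" "real (sum N ?B) \<le> ?V"
      using sum_N_window[OF q0 order_refl, of "Suc k" "2 * j + 1"]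
        sum_N_window[OF q0, of ?B "Suc (Suc k)" "2 * j + 1"] k
      by (auto simp: add_ac simp del: window.simps)
    have "3 * \<eta> * real (sum N ?I) + t * real (sum N ?B) \<le> 3 * \<eta> * ?V + t * ?V"
      using V \<eta> t by (intro add_mono mult_left_mono) auto
    moreover have "c * \<nu> \<le> c * \<nu> * \<omega>" using c lam omega by simp
    moreover have "(c + (3 * \<eta> + t) * (2 * K * (2 * real j + 2)\<^sup>2)) * (\<nu> * \<omega>) \<le> (p * \<kappa> * d / 4) * (\<nu> * \<omega>)"
      using c lam omega by (intro mult_right_mono) auto
    ultimately have 2: "c * \<nu> + 3 * \<eta> * real (sum N ?I) + t * real (sum N ?B) \<le> p * G0 / 2"
      by (simp add: G0_def algebra_simps)
    \<comment> \<open>One half of the gain is measured by the minority mass, the other by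
      \<open>G0\<close>; of the latter, half pays for all error terms.\<close>
    have "2 * p * G (Suc k) = p * G (Suc k) + p * G (Suc k)" by simp
    also have "\<dots> \<ge> p * (F k / (8 * K)) + p * G0"
      using GF[of k] G0[of "Suc k"] p by (intro add_mono mult_left_mono) auto
    finally have "l * (F (Suc (Suc k)) - F (Suc k)) \<ge> p * (F k / (8 * K)) + p * G0 / 2"
      using 1 2 by linarith
    also have "p * (F k / (8 * K)) + p * G0 / 2 = l * (\<beta> * (F k + G'))"
      using l K1 by (simp add: \<beta>_def G'_def field_simps)
    finally have "\<beta> * (F k + G') \<le> F (Suc (Suc k)) - F (Suc k)" using l by simp
    moreover have "F k \<le> F (Suc k)"
      unfolding F_def using fin sub[of "Suc k"] window_mono[OF q0] minority_nonneg
      by (intro sum_mono2) (auto simp del: window.simps)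
    ultimately show ?thesis by (simp add: algebra_simps)
  qed
  have G'0: "0 \<le> G'" using K1 pos lam omega by (simp add: G'_def G0_def)
  have iter: "(1 + \<beta>) ^ i * G' \<le> F (2 * i) + G'" if "i \<le> j" for i
    using that
  proof (induction i)
    case 0
    then show ?case using minority_nonneg[OF q0] by (simp add: F_def)
  next
    case (Suc i)
    have "(1 + \<beta>) ^ Suc i * G' \<le> (1 + \<beta>) * (F (2 * i) + G')"
      using Suc \<beta> by (simp add: mult.assoc mult_left_mono)
    also have "\<dots> \<le> F (Suc (Suc (2 * i))) + G'" using Suc by (intro step) auto
    finally show ?case by simp
  qed
  have "F (2 * j) \<le> (\<Sum>q\<in>window S q0 (2 * j). real (N q))"
    unfolding F_def by (rule sum_mono) (auto simp: minority_def)
  also have "\<dots> \<le> 2 * K * (2 * real j + 1)\<^sup>2 * \<nu> * \<omega>"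
    using sum_N_window[OF q0 order_refl order_refl, of "2 * j"] by simp
  finally have "(1 + \<beta>) ^ j * G' \<le> 2 * K * (2 * real j + 1)\<^sup>2 * \<nu> * \<omega> + G'" using iter[of j] by simp
  moreover have "G' = (2 * K * \<nu> * \<omega>) * (\<kappa> * d)" by (simp add: G'_def G0_def)
  ultimately have "(2 * K * \<nu> * \<omega>) * ((1 + \<beta>) ^ j * (\<kappa> * d)) \<le> (2 * K * \<nu> * \<omega>) * ((2 * real j + 1)\<^sup>2 + \<kappa> * d)"
    by (simp add: algebra_simps)
  moreover have "2 * K * \<nu> * \<omega> > 0" using K1 lam omega by simp
  ultimately have "(1 + \<beta>) ^ j * (\<kappa> * d) \<le> (2 * real j + 1)\<^sup>2 + \<kappa> * d"
    by (simp only: mult_le_cancel_left_pos)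
  then show False using growth by (simp add: \<beta>_def l_def)
qed

end

end

text \<open>With \<open>t = 1 / j ^ 3\<close> the rim cost \<open>t * j\<^sup>2\<close> tends to 0,
  while \<open>ln (1 / t) = 3 * ln j\<close> leaves the growth factor
  \<open>(1 + b / ln j) ^ j\<close>, roughly \<open>exp (b * j / ln j)\<close>, which beats every
  power of \<open>j\<close>. The 24 in \<open>b\<close> is 8 times this 3.\<close>

lemma growth_constants_exist:
  fixes p K d :: real
  assumes "0 < p" "0 < K" "0 < d"
  obtains t j \<eta> c where "0 < t" "t < 1" "0 < \<eta>" "0 < c"
    "c + (3 * \<eta> + t) * (2 * K * (2 * real j + 2)\<^sup>2) \<le> p * d / 4"
    "(1 + p / (8 * K * ln (1 / t))) ^ j * d > (2 * real j + 1)\<^sup>2 + d"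
proof -
  define b where "b = p / (24 * K)"
  have b: "b > 0" using assms by (simp add: b_def)
  have "((\<lambda>x::real. ((2 * x + 1)\<^sup>2 + d) / (1 + b / ln x) powr x) \<longlongrightarrow> 0) at_top"
    using b by real_asymp
  then have "eventually (\<lambda>x. ((2 * x + 1)\<^sup>2 + d) / (1 + b / ln x) powr x < d) at_top"
    using assms by (intro order_tendstoD) auto
  then have 1: "eventually (\<lambda>j. ((2 * real j + 1)\<^sup>2 + d) / (1 + b / ln (real j)) powr real j < d) sequentially"
    by (rule eventually_compose_filterlim) (rule filterlim_real_sequentially)
  have "((\<lambda>j. (1 / real j ^ 3) * (2 * K * (2 * real j + 2)\<^sup>2)) \<longlongrightarrow> 0) sequentially"
    by real_asymp
  then have 2: "eventually (\<lambda>j. (1 / real j ^ 3) * (2 * K * (2 * real j + 2)\<^sup>2) < p * d / 16) sequentially"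
    using assms by (intro order_tendstoD) auto
  from eventually_conj[OF eventually_conj[OF 1 2] eventually_gt_at_top[of 2]]
  obtain j where j: "((2 * real j + 1)\<^sup>2 + d) / (1 + b / ln (real j)) powr real j < d"
      "(1 / real j ^ 3) * (2 * K * (2 * real j + 2)\<^sup>2) < p * d / 16" "j > 2"
    by (auto dest!: eventually_happens)
  define t where "t = 1 / real j ^ 3"
  have t: "0 < t" "t < 1" using j(3) by (auto simp: t_def intro!: one_less_power)
  define W where "W = 2 * K * (2 * real j + 2)\<^sup>2"
  have W: "W > 0" using assms by (simp add: W_def add_pos_pos)
  \<comment> \<open>The three terms from \<open>c\<close>, \<open>\<eta>\<close> and
    \<open>t\<close> each get \<open>p * d / 16\<close>, together less than the allowed
    \<open>p * d / 4\<close>.\<close>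
  define \<eta> where "\<eta> = p * d / (48 * W)"
  have lnj: "ln (real j) > 0" using j(3) by simp
  have "ln (1 / t) = 3 * ln (real j)" using j(3) by (simp add: t_def ln_realpow)
  then have beq: "p / (8 * K * ln (1 / t)) = b / ln (real j)" by (simp add: b_def)
  have bpos: "1 + b / ln (real j) > 0" using b lnj by (simp add: add_pos_pos)
  show ?thesis
  proof (rule that[OF t])
    show "0 < \<eta>" "0 < p * d / 16" using assms W by (auto simp: \<eta>_def)
    show "p * d / 16 + (3 * \<eta> + t) * (2 * K * (2 * real j + 2)\<^sup>2) \<le> p * d / 4"
    proof -
      have "3 * \<eta> * W = p * d / 16" using W by (simp add: \<eta>_def)
      moreover have "t * W < p * d / 16" using j(2) by (simp add: t_def W_def)
      moreover have "0 < p * d" using assms by simp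
      ultimately show ?thesis by (simp only: W_def[symmetric] distrib_right)
    qed
    show "(2 * real j + 1)\<^sup>2 + d < (1 + p / (8 * K * ln (1 / t))) ^ j * d"
      unfolding beq using j(1) bpos by (simp add: powr_realpow divide_less_eq mult.commute)
  qed
qed

section \<open>Union bound over closed sets\<close>

lemma sum_symmetric_relation:
  assumes "finite Q" "\<And>q. q \<in> Q \<Longrightarrow> S q \<subseteq> Q" "\<And>q q'. q \<in> Q \<Longrightarrow> q' \<in> S q \<Longrightarrow> q \<in> S q'"
  shows "(\<Sum>q\<in>Q. \<Sum>q'\<in>S q. f q') = (\<Sum>q\<in>Q. of_nat (card (S q)) * (f q :: 'a :: comm_semiring_1))"
proof -
  have fin: "finite (S q)" if "q \<in> Q" for q using assms that finite_subset by blast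
  have "(\<Sum>q\<in>Q. \<Sum>q'\<in>S q. f q') = (\<Sum>(q,q')\<in>Sigma Q S. f q')"
    using assms fin by (subst sum.Sigma) auto
  also have "\<dots> = (\<Sum>(q,q')\<in>prod.swap ` Sigma Q S. f q')"
    using assms by (intro sum.cong) (fastforce simp: image_iff)+
  also have "\<dots> = (\<Sum>(q,q')\<in>Sigma Q S. f q)"
    by (subst sum.reindex) (auto simp: case_prod_unfold)
  also have "\<dots> = (\<Sum>q\<in>Q. \<Sum>q'\<in>S q. f q)"
    using assms fin by (subst sum.Sigma) auto
  finally show ?thesis by simp
qed

definition cell_count :: "(nat \<Rightarrow> 'q) \<Rightarrow> nat set \<Rightarrow> 'q \<Rightarrow> nat" where
  "cell_count cl A q = card {u \<in> A. cl u = q}"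

lemma card_cells_eq_sum:
  assumes "finite A" "finite X"
  shows "card {u \<in> A. cl u \<in> X} = sum (cell_count cl A) X"
proof -
  have "{u \<in> A. cl u \<in> X} = (\<Union>q\<in>X. {u \<in> A. cl u = q})" by auto
  then have "card {u \<in> A. cl u \<in> X} = (\<Sum>q\<in>X. card {u \<in> A. cl u = q})"
    using assms by (simp only:) (rule card_UN_disjoint, auto)
  then show ?thesis by (simp add: cell_count_def)
qed

lemma prod_over_cells:
  assumes "finite A" "finite X"
  shows "(\<Prod>u\<in>{u \<in> A. cl u \<in> X}. f (cl u)) = (\<Prod>q\<in>X. (f q :: 'a :: comm_monoid_mult) ^ cell_count cl A q)"
proof -
  have "{u \<in> A. cl u \<in> X} = (\<Union>q\<in>X. {u \<in> A. cl u = q})" by auto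
  then have "(\<Prod>u\<in>{u \<in> A. cl u \<in> X}. f (cl u)) = (\<Prod>q\<in>X. \<Prod>u\<in>{u \<in> A. cl u = q}. f (cl u))"
    using assms by (simp only:) (rule prod.UNION_disjoint, auto)
  also have "\<dots> = (\<Prod>q\<in>X. f q ^ cell_count cl A q)"
    by (intro prod.cong) (auto simp: cell_count_def)
  finally show ?thesis .
qed

text \<open>The factor of one vertex, summed over its two possible sides. For
  \<open>\<eta> = 0\<close> it equals \<open>1 - 2 * p * x * (1 - x)\<close>, because
  \<open>x\<^sup>2 + (1 - x)\<^sup>2 = 1 - 2 * x * (1 - x)\<close>; the distortion adds at most
  \<open>(1 + \<eta>)\<^sup>2 - 1 \<le> 3 * \<eta>\<close>.\<close>

lemma self_bound_le_exp:
  fixes p \<eta> x :: real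
  assumes "0 \<le> p" "p \<le> 1" "0 \<le> \<eta>" "\<eta> \<le> 1" "0 \<le> x" "x \<le> 1"
  defines "\<psi> \<equiv> \<lambda>a. (1 - p) * a + p * a\<^sup>2"
  shows "\<psi> ((1 + \<eta>) * x) + \<psi> ((1 + \<eta>) * (1 - x)) \<le> exp (3 * \<eta> - 2 * p * (x * (1 - x)))"
proof -
  let ?y = "2 * (x * (1 - x))"
  have y: "0 \<le> ?y" using assms by simp
  have "\<psi> ((1 + \<eta>) * x) + \<psi> ((1 + \<eta>) * (1 - x)) = (1 - p) * (1 + \<eta>) + p * ((1 + \<eta>)\<^sup>2 * (1 - ?y))"
    unfolding \<psi>_def by (simp add: algebra_simps power2_eq_square)
  also have "\<dots> = (1 - p) * (1 + \<eta>) + p * (1 + \<eta>)\<^sup>2 - (p * ?y) * (1 + \<eta>)\<^sup>2"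
    by (simp add: algebra_simps)
  also have "\<dots> \<le> (1 - p) * (1 + \<eta>)\<^sup>2 + p * (1 + \<eta>)\<^sup>2 - (p * ?y) * 1"
  proof -
    have e: "1 \<le> 1 + \<eta>" "1 + \<eta> \<le> (1 + \<eta>)\<^sup>2" "1 \<le> (1 + \<eta>)\<^sup>2"
      using assms by (auto simp: power2_eq_square algebra_simps)
    have "(1 - p) * (1 + \<eta>) \<le> (1 - p) * (1 + \<eta>)\<^sup>2" using e assms by (intro mult_left_mono) auto
    moreover have "(p * ?y) * 1 \<le> (p * ?y) * (1 + \<eta>)\<^sup>2"
      using e y assms by (intro mult_left_mono mult_nonneg_nonneg) auto
    ultimately show ?thesis by linarith
  qed
  also have "\<dots> \<le> 1 + (3 * \<eta> - 2 * p * (x * (1 - x)))"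
    using assms by (simp add: algebra_simps power2_eq_square mult_left_le_one_le)
  also have "\<dots> \<le> exp (3 * \<eta> - 2 * p * (x * (1 - x)))" by (rule exp_ge_add_one_self)
  finally show ?thesis .
qed

text \<open>The true neighbourhood \<open>nb u\<close> is compared with the union of cells
  \<open>S (cl u)\<close>, which depends on \<open>u\<close> only through its cell: it lies inside
  that union and misses only a small proportion of its points. The selection bound is assumed for
  all \<open>A\<close>, as it is applied to a set and to its complement.\<close>

locale irrigation_cells = cell_system Q S "cell_count cl {..<n}" \<omega> K \<nu>
  for Q :: "'q set" and S :: "'q \<Rightarrow> 'q set" and cl :: "nat \<Rightarrow> 'q" and n :: nat and \<omega> K \<nu> :: real +
  fixes nb :: "nat \<Rightarrow> nat set" and sel :: "nat \<Rightarrow> nat set pmf" and p \<eta> :: real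
  assumes cl_in: "u < n \<Longrightarrow> cl u \<in> Q"
    and p01: "0 < p" "p \<le> 1" and eta01: "0 \<le> \<eta>" "\<eta> \<le> 1"
    and sel: "u < n \<Longrightarrow> real (card (nb u \<inter> A)) \<le> (a :: real) * card (nb u) \<Longrightarrow>
           measure (sel u) {T. T \<subseteq> A} \<le> (1 - p) * a + p * a\<^sup>2"
    and nb_sub: "u < n \<Longrightarrow> nb u \<subseteq> {v. v < n \<and> cl v \<in> S (cl u)}"
    and nb_large: "u < n \<Longrightarrow> real (sum (cell_count cl {..<n}) (S (cl u))) \<le> (1 + \<eta>) * card (nb u)"
begin

section \<open>Per-vertex bounds in terms of cell densities\<close>

abbreviation N :: "'q \<Rightarrow> nat" where "N \<equiv> cell_count cl {..<n}"

lemma cell_count_le: "A \<subseteq> {..<n} \<Longrightarrow> cell_count cl A q \<le> N q"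
  unfolding cell_count_def by (intro card_mono) auto

lemma cell_count_compl:
  assumes "A \<subseteq> {..<n}"
  shows "cell_count cl ({..<n} - A) q = N q - cell_count cl A q"
proof -
  have "{u \<in> {..<n} - A. cl u = q} = {u \<in> {..<n}. cl u = q} - {u \<in> A. cl u = q}" by auto
  then show ?thesis unfolding cell_count_def using assms
    by (auto intro!: card_Diff_subset intro: finite_subset)
qed

lemma share_compl:
  assumes "A \<subseteq> {..<n}" "q \<in> Q"
  shows "share N (cell_count cl ({..<n} - A)) (S q) = 1 - share N (cell_count cl A) (S q)"
proof -
  have "real (sum (cell_count cl ({..<n} - A)) (S q)) = real (sum N (S q)) - real (sum (cell_count cl A) (S q))"
    using cell_count_le[OF assms(1)]
    by (simp add: cell_count_compl[OF assms(1)] of_nat_diff sum_subtractf)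
  then show ?thesis using sum_N_S_pos[OF assms(2)] by (simp add: share_def diff_divide_distrib)
qed

text \<open>Enlarging \<open>nb u\<close> to whole cells can only add points of \<open>A\<close>,
  and it increases the total by a factor of at most \<open>1 + \<eta>\<close>.\<close>

lemma card_nb_inter_le:
  assumes "A \<subseteq> {..<n}" "u < n"
  shows "real (card (nb u \<inter> A)) \<le> (1 + \<eta>) * share N (cell_count cl A) (S (cl u)) * card (nb u)"
proof -
  let ?q = "cl u"
  have q: "?q \<in> Q" using assms cl_in by auto
  have finA: "finite A" using assms finite_subset by blast
  have "nb u \<inter> A \<subseteq> {v \<in> A. cl v \<in> S ?q}" using nb_sub[OF assms(2)] by auto
  then have "card (nb u \<inter> A) \<le> sum (cell_count cl A) (S ?q)"
    using card_mono[of "{v \<in> A. cl v \<in> S ?q}"] finA by (simp add: card_cells_eq_sum finite_S[OF q])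
  then have "real (card (nb u \<inter> A)) \<le> share N (cell_count cl A) (S ?q) * real (sum N (S ?q))"
    using sum_N_S_pos[OF q] by (simp add: share_def flip: of_nat_sum)
  also have "\<dots> \<le> share N (cell_count cl A) (S ?q) * ((1 + \<eta>) * card (nb u))"
    by (intro mult_left_mono nb_large assms) (auto simp: share_def intro!: divide_nonneg_nonneg sum_nonneg)
  finally show ?thesis by (simp add: mult_ac)
qed

definition stay :: "real \<Rightarrow> real" where "stay a = (1 - p) * a + p * a\<^sup>2"

lemma stay_nonneg: "0 \<le> a \<Longrightarrow> 0 \<le> stay a"
  using p01 by (simp add: stay_def)

lemma prob_side_le:
  assumes "A \<subseteq> {..<n}" "u < n"
  defines "x \<equiv> share N (cell_count cl A) (S (cl u))"
  shows "measure (sel u) {T. T \<subseteq> (if u \<in> A then A else - A)}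
     \<le> (if u \<in> A then stay ((1 + \<eta>) * x) else stay ((1 + \<eta>) * (1 - x)))"
proof (cases "u \<in> A")
  case True
  then show ?thesis using sel[OF assms(2) card_nb_inter_le[OF assms(1,2)]] by (simp add: stay_def x_def)
next
  case False
  have "nb u \<inter> - A = nb u \<inter> ({..<n} - A)" using nb_sub[OF assms(2)] by auto
  then have "real (card (nb u \<inter> - A)) \<le> (1 + \<eta>) * (1 - x) * card (nb u)"
    using card_nb_inter_le[of "{..<n} - A" u] assms cl_in share_compl[OF assms(1), of "cl u"] by auto
  then show ?thesis using sel[OF assms(2)] False by (simp add: stay_def)
qed

text \<open>The factors \<open>t\<close> on the minority side of a boundary cell implement the bound
  \<open>(N choose m) \<le> (1 + t) ^ N / t ^ m\<close> inside a single product over vertices.\<close>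

lemma prob_fixed_profile_le:
  assumes I: "I \<subseteq> Q" and B: "B \<subseteq> Q" and disj: "I \<inter> B = {}" and SI: "\<And>q. q \<in> I \<Longrightarrow> S q \<subseteq> I \<union> B"
    and t: "0 < t" "t < 1" and m: "\<And>q. q \<in> Q \<Longrightarrow> m q \<le> N q"
  shows "measure (Pi_pmf {..<n} {} sel)
      {Y. \<exists>A. A \<subseteq> {..<n} \<and> (\<forall>u\<in>A. cl u \<in> I \<union> B) \<and> (\<forall>q\<in>I \<union> B. cell_count cl A q = m q) \<and>
        (\<forall>u<n. cl u \<in> I \<longrightarrow> Y u \<subseteq> (if u \<in> A then A else - A))}
    \<le> exp (cut_exponent p \<eta> t S N m I B)" (is "measure ?M ?E \<le> _")
proof -
  define P where "P X = {u \<in> {..<n}. cl u \<in> X}" for X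
  have finP: "finite (P X)" for X by (simp add: P_def)
  have finI: "finite I" "finite B" using I B fin_Q finite_subset by auto
  define \<A> where "\<A> = {A \<in> Pow (P (I \<union> B)). \<forall>q\<in>I \<union> B. cell_count cl A q = m q}"
  define F where "F A = {Y. \<forall>u<n. cl u \<in> I \<longrightarrow> Y u \<subseteq> (if u \<in> A then A else - A)}" for A
  define x where "x q = share N m (S q)" for q
  have x01: "0 \<le> x q" "x q \<le> 1" if "q \<in> I" for q
    using share_bounds[of m "S q"] m S_sub[of q] I that by (auto simp: x_def)
  define small where "small q \<longleftrightarrow> m q \<le> N q - m q" for q
  \<comment> \<open>The weights \<open>f\<close> and \<open>g\<close> depend on the profile
    \<open>m\<close> and not on \<open>A\<close>. This is why the profile is fixed first: the sum
    over \<open>A\<close> then factorises over the vertices.\<close>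
  define f where "f q = (if q \<in> I then stay ((1 + \<eta>) * x q) else if small q then t else 1)" for q
  define g where "g q = (if q \<in> I then stay ((1 + \<eta>) * (1 - x q)) else if small q then 1 else t)" for q
  have fg0: "0 \<le> f q" "0 \<le> g q" for q
    using x01[of q] t eta01 by (auto simp: f_def g_def intro!: stay_nonneg mult_nonneg_nonneg)
  define ef where "ef q = (if q \<in> I then 3 * \<eta> - 2 * p * (x q * (1 - x q)) else t)" for q
  define T where "T = (\<Prod>q\<in>B. (1 / t) ^ min (m q) (N q - m q))"
  have T0: "0 \<le> T" using t by (auto simp: T_def intro!: prod_nonneg)
  have prob_F: "measure ?M (F A) \<le> T * ((\<Prod>u\<in>A. f (cl u)) * (\<Prod>u\<in>P (I \<union> B) - A. g (cl u)))"
    if A: "A \<in> \<A>" for A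
  proof -
    have An: "A \<subseteq> {..<n}" and AP: "A \<subseteq> P (I \<union> B)" and Am: "\<And>q. q \<in> I \<union> B \<Longrightarrow> cell_count cl A q = m q"
      using A by (auto simp: \<A>_def P_def)
    have finA: "finite A" using An finite_subset by blast
    define h where "h u = (if u \<in> A then f (cl u) else g (cl u))" for u
    have h0: "0 \<le> h u" for u using fg0 by (simp add: h_def)
    have "F A = Pi {..<n} (\<lambda>u. if cl u \<in> I then {T. T \<subseteq> (if u \<in> A then A else - A)} else UNIV)"
      by (auto simp: F_def Pi_def)
    then have "measure ?M (F A) = (\<Prod>u<n. measure (sel u) (if cl u \<in> I then {T. T \<subseteq> (if u \<in> A then A else - A)} else UNIV))"
      by (simp add: measure_Pi_pmf_Pi)
    also have "\<dots> \<le> (\<Prod>u<n. if cl u \<in> I then h u else 1)"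
    proof (rule prod_mono, safe)
      fix u assume u: "u < n"
      show "measure (sel u) (if cl u \<in> I then {T. T \<subseteq> (if u \<in> A then A else - A)} else UNIV) \<le> (if cl u \<in> I then h u else 1)"
      proof (cases "cl u \<in> I")
        case True
        have "share N (cell_count cl A) (S (cl u)) = x (cl u)"
          using SI[OF True] Am by (auto simp: x_def share_def intro!: arg_cong2[where f = "(/)"] sum.cong)
        then show ?thesis using prob_side_le[OF An u] True by (auto simp: h_def f_def g_def)
      qed auto
    qed auto
    also have "\<dots> = (\<Prod>u\<in>P I. h u)"
      unfolding P_def by (subst prod.inter_filter) auto
    \<comment> \<open>Rim vertices are unconstrained, so their weights have to cancel: over a rim
      cell they multiply to \<open>t\<close> to the power of the minority size, the inverse of the
      factor of that cell in \<open>T\<close>.\<close>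
    also have "\<dots> = (\<Prod>u\<in>P I. h u) * (T * (\<Prod>u\<in>P B. h u))"
    proof -
      have "(\<Prod>u\<in>P B. h u) = (\<Prod>u\<in>{u\<in>A. cl u \<in> B}. f (cl u)) * (\<Prod>u\<in>{u\<in>{..<n} - A. cl u \<in> B}. g (cl u))"
      proof -
        have "P B = {u\<in>A. cl u \<in> B} \<union> {u\<in>{..<n} - A. cl u \<in> B}" using An by (auto simp: P_def)
        then have "(\<Prod>u\<in>P B. h u) = (\<Prod>u\<in>{u\<in>A. cl u \<in> B}. h u) * (\<Prod>u\<in>{u\<in>{..<n} - A. cl u \<in> B}. h u)"
          using finA by (simp add: prod.union_disjoint disjoint_iff)
        then show ?thesis by (simp add: h_def)
      qed
      also have "\<dots> = (\<Prod>q\<in>B. f q ^ cell_count cl A q) * (\<Prod>q\<in>B. g q ^ cell_count cl ({..<n} - A) q)"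
        using finA finI by (intro arg_cong2[where f = "(*)"] prod_over_cells) auto
      also have "\<dots> = (\<Prod>q\<in>B. f q ^ m q * g q ^ (N q - m q))"
        unfolding prod.distrib[symmetric] using Am by (intro prod.cong) (auto simp: cell_count_compl[OF An])
      also have "\<dots> = (\<Prod>q\<in>B. t ^ min (m q) (N q - m q))"
        using disj by (intro prod.cong) (auto simp: f_def g_def small_def min_def)
      finally have "T * (\<Prod>u\<in>P B. h u) = 1"
        using t by (simp add: T_def power_one_over flip: prod.distrib)
      then show ?thesis by simp
    qed
    also have "\<dots> = T * (\<Prod>u\<in>P (I \<union> B). h u)"
    proof -
      have "P (I \<union> B) = P I \<union> P B" "P I \<inter> P B = {}" using disj by (auto simp: P_def)
      then show ?thesis by (simp add: prod.union_disjoint finP)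
    qed
    also have "(\<Prod>u\<in>P (I \<union> B). h u) = (\<Prod>u\<in>A. f (cl u)) * (\<Prod>u\<in>P (I \<union> B) - A. g (cl u))"
      by (subst prod.subset_diff[OF AP finP]) (simp add: h_def mult.commute)
    finally show ?thesis .
  qed
  have "?E \<subseteq> (\<Union>A\<in>\<A>. F A)"
    by (auto simp: \<A>_def F_def P_def)
  then have "measure ?M ?E \<le> measure ?M (\<Union>A\<in>\<A>. F A)" by (intro measure_pmf.finite_measure_mono) auto
  also have "\<dots> \<le> (\<Sum>A\<in>\<A>. measure ?M (F A))"
    by (intro measure_pmf.finite_measure_subadditive_finite) (auto simp: \<A>_def finP)
  also have "\<dots> \<le> (\<Sum>A\<in>\<A>. T * ((\<Prod>u\<in>A. f (cl u)) * (\<Prod>u\<in>P (I \<union> B) - A. g (cl u))))"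
    by (intro sum_mono prob_F)
  \<comment> \<open>Dropping the profile condition adds only nonnegative terms and turns the sum
    into the expansion of a product of binomials \<open>f + g\<close>.\<close>
  also have "\<dots> \<le> (\<Sum>A\<in>Pow (P (I \<union> B)). T * ((\<Prod>u\<in>A. f (cl u)) * (\<Prod>u\<in>P (I \<union> B) - A. g (cl u))))"
    using T0 fg0 finP by (intro sum_mono2) (auto simp: \<A>_def intro!: mult_nonneg_nonneg prod_nonneg)
  also have "\<dots> = T * (\<Prod>u\<in>P (I \<union> B). f (cl u) + g (cl u))"
    by (simp add: prod_add finP sum_distrib_left)
  also have "\<dots> \<le> T * (\<Prod>u\<in>P (I \<union> B). exp (ef (cl u)))"
  proof (intro mult_left_mono prod_mono conjI T0)
    fix u
    show "f (cl u) + g (cl u) \<le> exp (ef (cl u))"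
    proof (cases "cl u \<in> I")
      case True
      then show ?thesis using self_bound_le_exp[of p \<eta> "x (cl u)"] x01[of "cl u"] p01 eta01
        by (simp add: f_def g_def stay_def ef_def)
    next
      case False
      then have "f (cl u) + g (cl u) = 1 + t" by (simp add: f_def g_def)
      then show ?thesis using exp_ge_add_one_self[of t] False by (simp add: ef_def)
    qed
  qed (use fg0 in auto)
  also have "(\<Prod>u\<in>P (I \<union> B). exp (ef (cl u)))
      = (\<Prod>q\<in>I \<union> B. exp (ef q) ^ N q)"
    unfolding P_def using finI by (intro prod_over_cells) auto
  also have "\<dots> = exp (\<Sum>q\<in>I \<union> B. N q * ef q)"
    using finI by (simp add: exp_sum flip: exp_of_nat_mult)
  also have "(\<Sum>q\<in>I \<union> B. N q * ef q)
      = (\<Sum>q\<in>I. N q * (3 * \<eta> - 2 * p * (x q * (1 - x q)))) + (\<Sum>q\<in>B. t * N q)"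
    using finI disj by (subst sum.union_disjoint) (auto simp: ef_def intro!: arg_cong2[where f = "(+)"] sum.cong)
  also have "T = exp (\<Sum>q\<in>B. ln (1 / t) * minority N m q)"
  proof -
    have "(1 / t) ^ min (m q) (N q - m q) = exp (ln (1 / t) * minority N m q)" if "q \<in> B" for q
    proof -
      have "minority N m q = real (min (m q) (N q - m q))"
        using m[of q] that B by (auto simp: minority_def of_nat_diff min_def)
      moreover have "(1 / t) ^ k = exp (ln (1 / t) * real k)" for k
        using t by (simp only: mult.commute[of "ln (1 / t)"] exp_of_nat_mult exp_ln zero_less_divide_1_iff)
      ultimately show ?thesis by simp
    qed
    then show ?thesis using finI by (simp add: T_def exp_sum)
  qed
  finally show ?thesis
    by (simp add: cut_exponent_def x_def sum.distrib add_ac flip: exp_add)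
qed

section \<open>Densities of nearby cells, and the union bound over windows and profiles\<close>

lemma abs_add_scaled_le:
  fixes a b s e :: real
  assumes "\<bar>a\<bar> \<le> e" "\<bar>b\<bar> \<le> e" "0 \<le> s" "s \<le> 1"
  shows "\<bar>a + s * b\<bar> \<le> e + e"
proof -
  have "\<bar>s * b\<bar> \<le> 1 * e" unfolding abs_mult using assms by (intro mult_mono) auto
  then show ?thesis using assms(1) by linarith
qed

text \<open>The \<open>d * \<omega>\<close> cells in either difference hold at most
  \<open>2 * \<nu> * d * \<omega>\<close> points. Numerator and denominator of the density each move
  by at most that, against at least \<open>\<nu> * \<omega> / 2\<close> points in total, whence the
  8.\<close>

lemma share_near:
  assumes A: "A \<subseteq> {..<n}" and q: "q \<in> Q" "q' \<in> Q"
    and d: "card (S q - S q') \<le> d * \<omega>" "card (S q' - S q) \<le> d * \<omega>"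
  shows "\<bar>share N (cell_count cl A) (S q) - share N (cell_count cl A) (S q')\<bar> \<le> 8 * d"
proof -
  let ?m = "cell_count cl A"
  have diff: "real (sum f (S a)) \<le> real (sum f (S b)) + 2 * \<nu> * d * \<omega>"
    if f: "\<And>q. f q \<le> N q" and ab: "a \<in> Q" "b \<in> Q" "card (S a - S b) \<le> d * \<omega>" for f :: "'q \<Rightarrow> nat" and a b
  proof -
    have "sum f (S a) \<le> sum f (S b \<union> (S a - S b))"
      using finite_S ab by (intro sum_mono2) auto
    also have "\<dots> = sum f (S b) + sum f (S a - S b)"
      using finite_S ab by (intro sum.union_disjoint) auto
    finally have "real (sum f (S a)) \<le> real (sum f (S b)) + real (sum f (S a - S b))"
      by (simp flip: of_nat_add of_nat_sum)
    also have "real (sum f (S a - S b)) \<le> (\<Sum>q\<in>S a - S b. 2 * \<nu>)"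
      unfolding of_nat_sum
    proof (rule sum_mono)
      fix q assume "q \<in> S a - S b"
      then have "q \<in> Q" using S_sub ab by auto
      then show "real (f q) \<le> 2 * \<nu>" using N_bounds(2) f[of q] by (meson of_nat_mono order_trans)
    qed
    also have "\<dots> \<le> 2 * \<nu> * (d * \<omega>)" using ab lam by simp
    finally show ?thesis by simp
  qed
  let ?e = "2 * \<nu> * d * \<omega>"
  let ?M = "real (sum ?m (S q))" and ?M' = "real (sum ?m (S q'))" and ?T = "real (sum N (S q))" and ?T' = "real (sum N (S q'))"
  have M: "\<bar>?M - ?M'\<bar> \<le> ?e" using diff[of ?m q q'] diff[of ?m q' q] cell_count_le[OF A] q d by (simp add: abs_le_iff)
  have T: "\<bar>?T - ?T'\<bar> \<le> ?e" using diff[of N q q'] diff[of N q' q] q d by (simp add: abs_le_iff)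
  have pos: "0 < ?T" "0 < ?T'" using sum_N_S_pos q by auto
  have x': "0 \<le> share N ?m (S q')" "share N ?m (S q') \<le> 1"
    using share_bounds[of ?m "S q'"] cell_count_le[OF A] S_sub[OF q(2)] by auto
  have e0: "0 \<le> ?e" using M by linarith
  have "share N ?m (S q) - share N ?m (S q') = ((?M - ?M') + share N ?m (S q') * (?T' - ?T)) / ?T"
    using pos by (simp add: share_def field_simps del: of_nat_sum)
  then have "\<bar>share N ?m (S q) - share N ?m (S q')\<bar> = \<bar>(?M - ?M') + share N ?m (S q') * (?T' - ?T)\<bar> / ?T"
    by (simp only: abs_divide abs_of_nat)
  also have "\<dots> \<le> (2 * ?e) / ?T"
  proof (rule divide_right_mono)
    have "\<bar>?T' - ?T\<bar> \<le> ?e" using T by (simp only: abs_minus_commute)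
    then show "\<bar>(?M - ?M') + share N ?m (S q') * (?T' - ?T)\<bar> \<le> 2 * ?e"
      using abs_add_scaled_le[OF M _ x'] by (simp only: mult_2)
  qed (use pos in auto)
  also have "\<dots> \<le> (2 * ?e) / (\<nu> / 2 * \<omega>)"
  proof -
    have "0 < \<nu> / 2 * \<omega>" using lam omega by simp
    then show ?thesis
      using sum_N_S_bounds(1)[OF q(1)] e0 pos lam omega by (intro divide_left_mono mult_pos_pos) linarith+
  qed
  also have "\<dots> = 8 * d" using lam omega by (simp add: field_simps)
  finally show ?thesis .
qed

text \<open>Polynomial in \<open>n\<close> as long as \<open>W\<close> has a bounded number of
  cells. Profiles are set to 0 outside \<open>W\<close> so that sets agreeing on \<open>W\<close>
  are counted once.\<close>

lemma card_profiles_le: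
  fixes W :: "'q set"
  assumes "finite W"
  shows "card ((\<lambda>A q. if q \<in> W then cell_count cl A q else 0) ` Pow {..<n}) \<le> (n + 1) ^ card W"
proof -
  let ?E = "W \<rightarrow>\<^sub>E {..n}"
  have "(\<lambda>A q. if q \<in> W then cell_count cl A q else 0) ` Pow {..<n} \<subseteq> (\<lambda>g q. if q \<in> W then g q else 0) ` ?E"
  proof safe
    fix A :: "nat set" assume "A \<subseteq> {..<n}"
    then have "cell_count cl A q \<le> n" for q
      using card_mono[of "{..<n}" "{u \<in> A. cl u = q}"] by (auto simp: cell_count_def)
    then have "restrict (cell_count cl A) W \<in> ?E" by auto
    then show "(\<lambda>q. if q \<in> W then cell_count cl A q else 0) \<in> (\<lambda>g q. if q \<in> W then g q else 0) ` ?E"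
      by (intro image_eqI[of _ _ "restrict (cell_count cl A) W"]) auto
  qed
  then have "card ((\<lambda>A q. if q \<in> W then cell_count cl A q else 0) ` Pow {..<n}) \<le> card ((\<lambda>g q. if q \<in> W then g q else 0) ` ?E)"
    using assms by (intro card_mono) (auto intro: finite_PiE)
  also have "\<dots> \<le> card ?E" using assms by (intro card_image_le finite_PiE) auto
  also have "\<dots> = (n + 1) ^ card W" using assms by (simp add: card_PiE)
  finally show ?thesis .
qed

text \<open>Every closed set mixed at \<open>q0\<close> has some good radius
  \<open>k \<le> 2 * j\<close>, depending on its profile. The union runs over all such
  \<open>k\<close> and all profiles on the window of radius \<open>k + 1\<close> whose exponent is
  at most \<open>- c * \<nu>\<close>; the power of \<open>real n + 1\<close> counts these
  profiles.\<close>

lemma prob_mixed_le: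
  assumes q0: "q0 \<in> Q" and t: "0 < t" "t < 1" and \<kappa>: "0 < \<kappa>" and \<delta>: "0 < \<delta>" "\<delta> \<le> 1/2"
    and Z: "Z \<subseteq> S q0" "\<kappa> * \<omega> \<le> real (card Z)"
      "\<And>q. q \<in> Z \<Longrightarrow> real (card (S q - S q0)) \<le> \<delta> / 16 * \<omega>" "\<And>q. q \<in> Z \<Longrightarrow> real (card (S q0 - S q)) \<le> \<delta> / 16 * \<omega>"
    and c: "0 < c" "c + (3 * \<eta> + t) * (2 * K * (2 * real j + 2)\<^sup>2) \<le> p * (\<kappa> * (\<delta> / 4)) / 4"
    and growth: "(1 + p / (8 * K * ln (1 / t))) ^ j * (\<kappa> * (\<delta> / 4)) > (2 * real j + 1)\<^sup>2 + \<kappa> * (\<delta> / 4)"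
  shows "measure (Pi_pmf {..<n} {} sel)
      {Y. (\<forall>u<n. Y u \<subseteq> nb u) \<and> (\<exists>A. cut_free n Y A \<and> \<delta> \<le> share N (cell_count cl A) (S q0) \<and>
          share N (cell_count cl A) (S q0) \<le> 1 - \<delta>)}
    \<le> 2 * real j * (real n + 1) powr (K * (2 * real j + 2)\<^sup>2 * \<omega>) * exp (- c * \<nu>)"
    (is "measure ?M ?E \<le> _")
proof -
  define W where "W k = window S q0 k" for k
  note sub = window_sub[OF q0, folded W_def] and fin = finite_window[OF q0, folded W_def]
    and mono = window_mono[OF q0, folded W_def]
  define ex where "ex k m = cut_exponent p \<eta> t S N m (W k) (W (Suc k) - W k)" for k m
  define tr where "tr k = (\<lambda>A q. if q \<in> W (Suc k) then cell_count cl A q else 0)" for k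
  define R where "R k = {m \<in> tr k ` Pow {..<n}. ex k m \<le> - c * \<nu>}" for k
  define F where "F k m = {Y. \<exists>A. A \<subseteq> {..<n} \<and> (\<forall>u\<in>A. cl u \<in> W k \<union> (W (Suc k) - W k)) \<and>
        (\<forall>q\<in>W k \<union> (W (Suc k) - W k). cell_count cl A q = m q) \<and>
        (\<forall>u<n. cl u \<in> W k \<longrightarrow> Y u \<subseteq> (if u \<in> A then A else - A))}" for k m
  have SW: "S q \<subseteq> W (Suc k)" if "q \<in> W k" for q k using that by (auto simp: W_def)
  have W_Un: "W k \<union> (W (Suc k) - W k) = W (Suc k)" for k using mono by blast
  have ex_tr: "ex k (tr k A) = ex k (cell_count cl A)" for k A
  proof -
    have "share N (tr k A) (S q) = share N (cell_count cl A) (S q)" if "q \<in> W k" for q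
      using SW[OF that] by (auto simp: share_def tr_def intro!: arg_cong2[where f = "(/)"] sum.cong)
    moreover have "minority N (tr k A) q = minority N (cell_count cl A) q" if "q \<in> W (Suc k)" for q
      using that by (simp add: minority_def tr_def)
    ultimately show ?thesis
      unfolding ex_def cut_exponent_def by (intro arg_cong2[where f = "(+)"] sum.cong) auto
  qed
  have finR: "finite (R k)" for k by (simp add: R_def)
  have F_le: "measure ?M (F k m) \<le> exp (- c * \<nu>)" if m: "m \<in> R k" for k m
  proof -
    have "measure ?M (F k m) \<le> exp (ex k m)"
      unfolding F_def ex_def
    proof (rule prob_fixed_profile_le)
      show "W k \<subseteq> Q" "W (Suc k) - W k \<subseteq> Q" using sub by auto
      show "S q \<subseteq> W k \<union> (W (Suc k) - W k)" if "q \<in> W k" for q unfolding W_Un by (rule SW[OF that])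
      show "m q \<le> N q" for q
        using m cell_count_le by (auto simp: R_def tr_def)
    qed (use t in auto)
    also have "\<dots> \<le> exp (- c * \<nu>)" using m by (simp add: R_def)
    finally show ?thesis .
  qed
  have cardR: "real (card (R k)) \<le> (real n + 1) powr (K * (2 * real j + 2)\<^sup>2 * \<omega>)" if "k \<le> 2 * j" for k
  proof -
    have "card (R k) \<le> card (tr k ` Pow {..<n})" unfolding R_def by (intro card_mono) auto
    also have "\<dots> \<le> (n + 1) ^ card (W (Suc k))" unfolding tr_def by (rule card_profiles_le[OF fin])
    finally have "real (card (R k)) \<le> real ((n + 1) ^ card (W (Suc k)))" by (rule of_nat_mono)
    also have "\<dots> = (real n + 1) powr (card (W (Suc k)))" by (simp add: powr_realpow add.commute)
    also have "\<dots> \<le> (real n + 1) powr (K * (2 * real j + 2)\<^sup>2 * \<omega>)"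
    proof (rule powr_mono)
      have "real (card (W (Suc k))) \<le> K * (real (Suc k) + 1)\<^sup>2 * \<omega>"
        unfolding W_def by (rule card_window[OF q0])
      also have "\<dots> \<le> K * (2 * real j + 2)\<^sup>2 * \<omega>"
        using that K_ge_1[OF q0] omega by (intro mult_right_mono mult_left_mono power_mono) auto
      finally show "real (card (W (Suc k))) \<le> K * (2 * real j + 2)\<^sup>2 * \<omega>" .
    qed simp
    finally show ?thesis .
  qed
  have "?E \<subseteq> (\<Union>k\<in>{1..2*j}. \<Union>m\<in>R k. F k m)"
  proof safe
    fix Y A assume Ynb: "\<forall>u<n. Y u \<subseteq> nb u" and cf: "cut_free n Y A"
      and mixed: "\<delta> \<le> share N (cell_count cl A) (S q0)" "share N (cell_count cl A) (S q0) \<le> 1 - \<delta>"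
    have A: "A \<subseteq> {..<n}" using cf by (simp add: cut_free_def)
    have "\<exists>k\<in>{1..2*j}. cut_exponent p \<eta> t S N (cell_count cl A) (window S q0 k) (window S q0 (Suc k) - window S q0 k) \<le> - c * \<nu>"
    proof (rule exists_good_window[OF _ q0 p01(1) t eta01(1) \<kappa> _ Z(1,2) _ c(1)])
      show "cell_count cl A q \<le> N q" for q by (rule cell_count_le[OF A])
      show "0 < \<delta> / 4" using \<delta> by simp
      show "\<delta> / 4 \<le> share N (cell_count cl A) (S q) * (1 - share N (cell_count cl A) (S q))" if q: "q \<in> Z" for q
      proof -
        let ?x = "share N (cell_count cl A) (S q)"
        have "q \<in> Q" using q Z(1) S_sub[OF q0] by blast
        \<comment> \<open>The tolerance \<open>\<delta> / 16\<close> moves the density by at most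
          \<open>\<delta> / 2\<close>, so all cells of \<open>Z\<close> are still mixed, with half
          the margin.\<close>
        then have "\<bar>?x - share N (cell_count cl A) (S q0)\<bar> \<le> 8 * (\<delta> / 16)"
          by (intro share_near[OF A] q0 Z(3,4) q)
        then have x: "\<delta> / 2 \<le> ?x" "?x \<le> 1 - \<delta> / 2" using mixed by linarith+
        have "\<delta> / 4 \<le> (\<delta> / 2) * (1 - \<delta> / 2)" using \<delta> by (simp add: field_simps)
        also have "\<dots> \<le> ?x * (1 - ?x)"
        proof -
          have "0 \<le> (?x - \<delta> / 2) * (1 - \<delta> / 2 - ?x)" using x by (intro mult_nonneg_nonneg) auto
          then show ?thesis by (simp add: algebra_simps)
        qed
        finally show ?thesis .
      qed
      show "c + (3 * \<eta> + t) * (2 * K * (2 * real j + 2)\<^sup>2) \<le> p * \<kappa> * (\<delta> / 4) / 4" using c(2) by (simp add: mult.assoc)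
    qed (use growth in \<open>simp_all add: mult.assoc\<close>)
    then obtain k where k: "k \<in> {1..2*j}" "ex k (cell_count cl A) \<le> - c * \<nu>" by (auto simp: ex_def W_def)
    \<comment> \<open>Only the trace of \<open>A\<close> on the outer window matters: vertices in
      cells of \<open>W k\<close> select points in cells of \<open>W (Suc k)\<close>, so they
      respect the trace whenever they respect \<open>A\<close>.\<close>
    define A' where "A' = {u \<in> A. cl u \<in> W (Suc k)}"
    have "tr k A \<in> R k" using A k by (simp add: R_def ex_tr)
    moreover have "Y \<in> F k (tr k A)"
      unfolding F_def W_Un
    proof (intro CollectI exI[of _ A'] conjI ballI allI impI)
      show "A' \<subseteq> {..<n}" using A by (auto simp: A'_def)
      show "cl u \<in> W (Suc k)" if "u \<in> A'" for u using that by (simp add: A'_def)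
      show "cell_count cl A' q = tr k A q" if "q \<in> W (Suc k)" for q
        using that by (auto simp: cell_count_def A'_def tr_def intro!: arg_cong[where f = card])
      show "Y u \<subseteq> (if u \<in> A' then A' else - A')" if u: "u < n" "cl u \<in> W k" for u
      proof -
        have "Y u \<subseteq> {v. cl v \<in> W (Suc k)}" using Ynb nb_sub[OF u(1)] SW[OF u(2)] u by blast
        moreover have "Y u \<subseteq> (if u \<in> A then A else - A)" using cf u by (simp add: cut_free_def)
        moreover have "u \<in> A' \<longleftrightarrow> u \<in> A" using u mono[of k] by (auto simp: A'_def)
        ultimately show ?thesis by (auto simp: A'_def split: if_splits)
      qed
    qed
    ultimately show "Y \<in> (\<Union>k\<in>{1..2*j}. \<Union>m\<in>R k. F k m)" using k by blast
  qed
  then have "measure ?M ?E \<le> measure ?M (\<Union>k\<in>{1..2*j}. \<Union>m\<in>R k. F k m)"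
    by (intro measure_pmf.finite_measure_mono) auto
  also have "\<dots> \<le> (\<Sum>k\<in>{1..2*j}. measure ?M (\<Union>m\<in>R k. F k m))"
    by (intro measure_pmf.finite_measure_subadditive_finite) auto
  also have "\<dots> \<le> (\<Sum>k\<in>{1..2*j}. \<Sum>m\<in>R k. measure ?M (F k m))"
    by (intro sum_mono measure_pmf.finite_measure_subadditive_finite finR) auto
  also have "\<dots> \<le> (\<Sum>k\<in>{1..2*j}. \<Sum>m\<in>R k. exp (- c * \<nu>))"
    by (intro sum_mono F_le)
  also have "\<dots> \<le> (\<Sum>k\<in>{1..2*j}. (real n + 1) powr (K * (2 * real j + 2)\<^sup>2 * \<omega>) * exp (- c * \<nu>))"
    using cardR by (intro sum_mono) (simp add: mult_right_mono)
  also have "\<dots> = 2 * real j * (real n + 1) powr (K * (2 * real j + 2)\<^sup>2 * \<omega>) * exp (- c * \<nu>)"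
    by simp
  finally show ?thesis .
qed

text \<open>Double counting over neighbourhoods: each vertex is counted at least
  \<open>\<omega>\<close> times on the left and at most \<open>K * \<omega>\<close> times on the
  right, which costs the factor \<open>K\<close>.\<close>

lemma card_le_if_share_small:
  assumes A: "A \<subseteq> {..<n}" and small: "\<And>q. q \<in> Q \<Longrightarrow> share N (cell_count cl A) (S q) \<le> \<delta>" and \<delta>: "0 \<le> \<delta>"
  shows "card A \<le> \<delta> * K * n"
proof (cases "Q = {}")
  case True
  then have "n = 0" using cl_in by auto
  then show ?thesis using A by simp
next
  case False
  have total: "real (card B) = (\<Sum>q\<in>Q. real (cell_count cl B q))" if "B \<subseteq> {..<n}" for B
  proof -
    have "B = {u \<in> B. cl u \<in> Q}" using that cl_in by auto
    then have "card B = sum (cell_count cl B) Q"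
      using card_cells_eq_sum[of B Q cl] that fin_Q finite_subset[of B "{..<n}"] by simp
    then show ?thesis by simp
  qed
  have swap: "(\<Sum>q\<in>Q. \<Sum>q'\<in>S q. f q') = (\<Sum>q\<in>Q. real (card (S q)) * f q)" for f
    by (rule sum_symmetric_relation) (use fin_Q S_sub S_sym in auto)
  have "\<omega> * card A = (\<Sum>q\<in>Q. \<omega> * real (cell_count cl A q))" by (simp add: total[OF A] sum_distrib_left)
  also have "\<dots> \<le> (\<Sum>q\<in>Q. real (card (S q)) * real (cell_count cl A q))"
    using card_S by (intro sum_mono mult_right_mono) auto
  also have "\<dots> = (\<Sum>q\<in>Q. \<Sum>q'\<in>S q. real (cell_count cl A q'))" by (rule swap[symmetric])
  also have "\<dots> \<le> (\<Sum>q\<in>Q. \<delta> * (\<Sum>q'\<in>S q. real (N q')))"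
  proof (rule sum_mono)
    fix q assume q: "q \<in> Q"
    show "(\<Sum>q'\<in>S q. real (cell_count cl A q')) \<le> \<delta> * (\<Sum>q'\<in>S q. real (N q'))"
      using small[OF q] sum_N_S_pos[OF q] by (simp add: share_def divide_le_eq)
  qed
  also have "\<dots> = \<delta> * (\<Sum>q\<in>Q. real (card (S q)) * real (N q))"
    by (simp add: swap flip: sum_distrib_left)
  also have "\<dots> \<le> \<delta> * (\<Sum>q\<in>Q. (K * \<omega>) * real (N q))"
    using card_S \<delta> by (intro mult_left_mono sum_mono mult_right_mono) auto
  also have "\<dots> = \<omega> * (\<delta> * K * n)" using total[of "{..<n}"] by (simp flip: sum_distrib_left)
  finally show ?thesis using omega by (simp add: mult_le_cancel_left_pos)
qed

text \<open>Between near cells the density moves by at most \<open>\<delta> / 2\<close>, too little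
  to jump over the forbidden interval from \<open>\<delta>\<close> to \<open>1 - \<delta>\<close>.
  Since nearness connects all cells, the density is low everywhere or high everywhere; in the second
  case the complement is counted.\<close>

lemma card_extreme_if_unmixed:
  assumes A: "A \<subseteq> {..<n}" and \<delta>: "0 < \<delta>" "\<delta> < 1/4"
    and unmixed: "\<And>q. q \<in> Q \<Longrightarrow> \<not> (\<delta> \<le> share N (cell_count cl A) (S q) \<and> share N (cell_count cl A) (S q) \<le> 1 - \<delta>)"
    and Z: "\<And>q q'. q \<in> Q \<Longrightarrow> q' \<in> Z q \<Longrightarrow> q' \<in> Q"
      "\<And>q q'. q \<in> Q \<Longrightarrow> q' \<in> Z q \<Longrightarrow> card (S q - S q') \<le> \<delta> / 16 * \<omega>"
      "\<And>q q'. q \<in> Q \<Longrightarrow> q' \<in> Z q \<Longrightarrow> card (S q' - S q) \<le> \<delta> / 16 * \<omega>"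
    and conn: "\<And>q q'. q \<in> Q \<Longrightarrow> q' \<in> Q \<Longrightarrow> (q, q') \<in> {(a, b). a \<in> Q \<and> b \<in> Z a}\<^sup>*"
  shows "card A \<le> \<delta> * K * n \<or> card A \<ge> (1 - \<delta> * K) * n"
proof -
  let ?s = "\<lambda>q. share N (cell_count cl A) (S q)"
  have step: "?s q < \<delta> \<longleftrightarrow> ?s q' < \<delta>" if "q \<in> Q" "q' \<in> Z q" for q q'
  proof -
    have "\<bar>?s q - ?s q'\<bar> \<le> 8 * (\<delta> / 16)" using that Z by (intro share_near[OF A]) auto
    then show ?thesis using unmixed[of q] unmixed[of q'] that Z(1) \<delta> by (auto simp: abs_le_iff)
  qed
  have same: "?s q < \<delta> \<longleftrightarrow> ?s q' < \<delta>" if "q \<in> Q" "q' \<in> Q" for q q'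
    using conn[OF that] by (induction rule: rtrancl_induct) (auto simp: step)
  show ?thesis
  proof (cases "\<forall>q\<in>Q. ?s q < \<delta>")
    case True
    then show ?thesis using card_le_if_share_small[OF A] \<delta> by (meson less_eq_real_def)
  next
    case False
    then have ge: "\<forall>q\<in>Q. ?s q > 1 - \<delta>" using same unmixed by (meson not_le)
    have "card ({..<n} - A) \<le> \<delta> * K * n"
    proof (rule card_le_if_share_small)
      show "share N (cell_count cl ({..<n} - A)) (S q) \<le> \<delta>" if "q \<in> Q" for q
        using ge that share_compl[OF A that] by force
    qed (use \<delta> in auto)
    moreover have "card ({..<n} - A) = n - card A" "card A \<le> n"
      using A card_mono[of "{..<n}" A] by (auto simp: card_Diff_subset finite_subset)
    ultimately have "n - real (card A) \<le> \<delta> * K * n" by (simp add: of_nat_diff)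
    then show ?thesis by (simp add: algebra_simps)
  qed
qed

end

section \<open>Grid geometry on the torus\<close>

definition cdist :: "nat \<Rightarrow> int \<Rightarrow> int \<Rightarrow> int" where
  "cdist g i j = min \<bar>i - j\<bar> (int g - \<bar>i - j\<bar>)"

definition grid :: "nat \<Rightarrow> (int \<times> int) set" where
  "grid g = {0..<int g} \<times> {0..<int g}"

text \<open>Lengths are in units of the cell side, so \<open>\<rho>\<close> is the radius times
  \<open>g\<close>. A coordinate distance of two points agrees with the cyclic distance of their
  cells up to 1. Hence the outer cells cover the ball around any point of \<open>q\<close>, and the
  inner cells lie in each such ball.\<close>

definition outer_cells :: "nat \<Rightarrow> real \<Rightarrow> int \<times> int \<Rightarrow> (int \<times> int) set" where
  "outer_cells g \<rho> q = {q' \<in> grid g.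
     (max 0 (real_of_int (cdist g (fst q) (fst q')) - 1))\<^sup>2 + (max 0 (real_of_int (cdist g (snd q) (snd q')) - 1))\<^sup>2 < \<rho>\<^sup>2}"

definition inner_cells :: "nat \<Rightarrow> real \<Rightarrow> int \<times> int \<Rightarrow> (int \<times> int) set" where
  "inner_cells g \<rho> q = {q' \<in> grid g.
     (real_of_int (cdist g (fst q) (fst q')) + 1)\<^sup>2 + (real_of_int (cdist g (snd q) (snd q')) + 1)\<^sup>2 < \<rho>\<^sup>2}"

definition near_cells :: "nat \<Rightarrow> nat \<Rightarrow> int \<times> int \<Rightarrow> (int \<times> int) set" where
  "near_cells g w q = {q' \<in> grid g. cdist g (fst q) (fst q') \<le> int w \<and> cdist g (snd q) (snd q') \<le> int w}"

text \<open>At most \<open>\<rho> + 2\<close> rows, the remaining bracket for the length of a row,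
  and 16 cells for each pair of cyclic distances: four per coordinate, from two directions and the
  two branches of the minimum.\<close>

definition annulus_bound :: "real \<Rightarrow> real \<Rightarrow> real" where
  "annulus_bound \<rho> w = 16 * (\<rho> + 2) * (w + 2 + sqrt ((w + 1) * (2 * \<rho> + w + 2)))"

section \<open>Cyclic distance and the counting of cells in boxes and annuli\<close>

lemma finite_grid [simp]: "finite (grid g)"
  by (simp add: grid_def)

lemma cdist_sym: "cdist g i j = cdist g j i"
  by (simp add: cdist_def abs_minus_commute)

lemma cdist_self [simp]: "cdist g i i = 0"
  by (simp add: cdist_def)

lemma cdist_nonneg: "0 \<le> i \<Longrightarrow> i < int g \<Longrightarrow> 0 \<le> j \<Longrightarrow> j < int g \<Longrightarrow> 0 \<le> cdist g i j"
  by (auto simp: cdist_def)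

lemma cdist_triangle:
  assumes "0 \<le> i" "i < int g" "0 \<le> j" "j < int g" "0 \<le> k" "k < int g"
  shows "cdist g i k \<le> cdist g i j + cdist g j k"
  using assms by (auto simp: cdist_def min_def abs_if split: if_splits)

lemma card_cdist_fibre_le: "card {j \<in> J. cdist g i j = k} \<le> 4"
proof -
  have "{j \<in> J. cdist g i j = k} \<subseteq> set [i + k, i - k, i + (int g - k), i - (int g - k)]"
    by (auto simp: cdist_def min_def abs_if split: if_splits)
  then have "card {j \<in> J. cdist g i j = k} \<le> card (set [i + k, i - k, i + (int g - k), i - (int g - k)])"
    by (intro card_mono) auto
  also have "\<dots> \<le> 4" using card_length[of "[i + k, i - k, i + (int g - k), i - (int g - k)]"] by simp
  finally show ?thesis .
qed

lemma card_grid_subset_le: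
  assumes X: "X \<subseteq> grid g" and fin: "finite P"
    and P: "\<And>q'. q' \<in> X \<Longrightarrow> (cdist g (fst q) (fst q'), cdist g (snd q) (snd q')) \<in> P"
  shows "card X \<le> 16 * card P"
proof -
  define F where "F k = {i \<in> {0..<int g}. cdist g (fst q) i = fst k} \<times> {j \<in> {0..<int g}. cdist g (snd q) j = snd k}" for k
  have finF: "finite (F k)" for k
    by (rule finite_subset[of _ "grid g"]) (auto simp: F_def grid_def)
  have "X \<subseteq> (\<Union>k\<in>P. F k)"
  proof
    fix q' assume q': "q' \<in> X"
    then show "q' \<in> (\<Union>k\<in>P. F k)"
      using X P[OF q'] by (intro UN_I[of "(cdist g (fst q) (fst q'), cdist g (snd q) (snd q'))"])
        (auto simp: F_def grid_def)
  qed
  then have "card X \<le> card (\<Union>k\<in>P. F k)" using fin by (intro card_mono finite_UN_I finF)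
  also have "\<dots> \<le> (\<Sum>k\<in>P. card (F k))" by (rule card_UN_le[OF fin])
  also have "\<dots> \<le> (\<Sum>k\<in>P. 4 * 4)"
    unfolding F_def card_cartesian_product by (intro sum_mono mult_mono card_cdist_fibre_le) auto
  finally show ?thesis by simp
qed

lemma card_int_atLeastAtMost_floor:
  fixes B :: real
  shows "0 \<le> B \<Longrightarrow> real (card {0..\<lfloor>B\<rfloor>}) \<le> B + 1"
  by simp

lemma card_box_le:
  fixes B :: real
  assumes "X \<subseteq> grid g" "q \<in> grid g" "0 \<le> B"
    and "\<And>q'. q' \<in> X \<Longrightarrow> cdist g (fst q) (fst q') \<le> B" "\<And>q'. q' \<in> X \<Longrightarrow> cdist g (snd q) (snd q') \<le> B"
  shows "card X \<le> 16 * (B + 1)\<^sup>2"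
proof -
  let ?P = "{0..\<lfloor>B\<rfloor>} \<times> {0..\<lfloor>B\<rfloor>}"
  have "card X \<le> 16 * card ?P"
  proof (rule card_grid_subset_le[OF assms(1), where q = q])
    fix q' assume q': "q' \<in> X"
    then show "(cdist g (fst q) (fst q'), cdist g (snd q) (snd q')) \<in> ?P"
      using assms(1,2) assms(4,5)[OF q'] by (auto simp: grid_def le_floor_iff intro!: cdist_nonneg)
  qed simp
  then have "real (card X) \<le> 16 * real (card ?P)" by linarith
  also have "real (card ?P) = real (card {0..\<lfloor>B\<rfloor>}) * real (card {0..\<lfloor>B\<rfloor>})"
    by (simp add: card_cartesian_product)
  also have "\<dots> \<le> (B + 1) * (B + 1)"
    using card_int_atLeastAtMost_floor[OF assms(3)] assms(3) by (intro mult_mono) auto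
  finally show ?thesis by (simp add: power2_eq_square)
qed

lemma card_int_set_le_diameter:
  fixes C :: "int set" and \<Delta> :: real
  assumes fin: "finite C" and \<Delta>: "0 \<le> \<Delta>" and diam: "\<And>a b. a \<in> C \<Longrightarrow> b \<in> C \<Longrightarrow> a \<le> b \<Longrightarrow> b - a \<le> \<Delta>"
  shows "card C \<le> \<Delta> + 1"
proof (cases "C = {}")
  case False
  define m where "m = Min C"
  have m: "m \<in> C" "\<And>b. b \<in> C \<Longrightarrow> m \<le> b" using fin False by (auto simp: m_def)
  have "C \<subseteq> {m..m + \<lfloor>\<Delta>\<rfloor>}"
  proof
    fix b assume b: "b \<in> C"
    have "real_of_int (b - m) \<le> \<Delta>" using diam[OF m(1) b m(2)[OF b]] by simp
    then have "b - m \<le> \<lfloor>\<Delta>\<rfloor>" by (simp only: le_floor_iff)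
    then show "b \<in> {m..m + \<lfloor>\<Delta>\<rfloor>}" using m(2)[OF b] by auto
  qed
  then have "card C \<le> card {m..m + \<lfloor>\<Delta>\<rfloor>}" by (intro card_mono) auto
  also have "\<dots> = nat (\<lfloor>\<Delta>\<rfloor> + 1)" by simp
  finally have "real (card C) \<le> real (nat (\<lfloor>\<Delta>\<rfloor> + 1))" by (rule of_nat_mono)
  also have "\<dots> \<le> \<Delta> + 1" using \<Delta> by (simp add: of_nat_nat)
  finally show ?thesis .
qed (use \<Delta> in simp)

text \<open>In every row the annulus meets an interval whose length is bounded through
  \<open>(b - a)\<^sup>2 \<le> b\<^sup>2 - a\<^sup>2\<close>; this loses a factor of order \<open>sqrt \<rho>\<close>, which is still
  negligible against the area \<open>\<rho>\<^sup>2\<close>.\<close>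

lemma annulus_row_diameter:
  fixes k a b w \<rho> :: real
  assumes k: "0 \<le> k" and a: "0 \<le> a" and w: "0 \<le> w" and \<rho>: "0 \<le> \<rho>"
    and out: "(max 0 (k - 1))\<^sup>2 + (max 0 (b - 1))\<^sup>2 < \<rho>\<^sup>2" and inn: "\<rho>\<^sup>2 \<le> (k + w)\<^sup>2 + (a + w)\<^sup>2"
  shows "b - a \<le> w + 1 + sqrt ((w + 1) * (2 * \<rho> + w + 2))"
proof (cases "b - 1 \<le> a + w")
  case True
  have "0 \<le> sqrt ((w + 1) * (2 * \<rho> + w + 2))" using w \<rho> by simp
  then show ?thesis using True by linarith
next
  case False
  have kr: "k \<le> \<rho> + 1"
  proof -
    have "(max 0 (k - 1))\<^sup>2 < \<rho>\<^sup>2" using out by (smt (verit) zero_le_power2)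
    then have "max 0 (k - 1) < \<rho>" using \<rho> by (rule power2_less_imp_less)
    then show ?thesis by simp
  qed
  have kk: "(k + w)\<^sup>2 - (max 0 (k - 1))\<^sup>2 \<le> (w + 1) * (2 * k + w)"
  proof (cases "k \<le> 1")
    case True
    have "k * k \<le> k * 2" using True k by (intro mult_left_mono) auto
    then show ?thesis using True w by (simp add: power2_eq_square algebra_simps)
  next
    case False
    then show ?thesis using w by (simp add: power2_eq_square algebra_simps)
  qed
  have "(w + 1) * (2 * k + w) \<le> (w + 1) * (2 * \<rho> + w + 2)" using kr w by (intro mult_left_mono) auto
  moreover have "(b - 1 - (a + w))\<^sup>2 \<le> (b - 1)\<^sup>2 - (a + w)\<^sup>2"
  proof -
    have "0 \<le> (a + w) * ((b - 1) - (a + w))" using False a w by (intro mult_nonneg_nonneg) auto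
    then show ?thesis by (simp add: power2_eq_square algebra_simps)
  qed
  moreover have "(max 0 (b - 1))\<^sup>2 = (b - 1)\<^sup>2" using False a w by simp
  ultimately have "(b - 1 - (a + w))\<^sup>2 \<le> (w + 1) * (2 * \<rho> + w + 2)" using out inn kk by linarith
  then have "b - 1 - (a + w) \<le> sqrt ((w + 1) * (2 * \<rho> + w + 2))" by (rule real_le_rsqrt)
  then show ?thesis by simp
qed

text \<open>Serves two purposes: with \<open>w = 1\<close> it bounds the cells between the inner and
  the outer neighbourhood, and for general \<open>w\<close> the change of the outer neighbourhood
  under a shift by at most \<open>w\<close> cells.\<close>

lemma card_annulus_le:
  fixes w \<rho> :: real
  assumes q: "q \<in> grid g" and w: "0 \<le> w" and \<rho>: "0 \<le> \<rho>" and X: "X \<subseteq> outer_cells g \<rho> q"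
    and inn: "\<And>q'. q' \<in> X \<Longrightarrow> \<rho>\<^sup>2 \<le> (cdist g (fst q) (fst q') + w)\<^sup>2 + (cdist g (snd q) (snd q') + w)\<^sup>2"
  shows "card X \<le> annulus_bound \<rho> w"
proof -
  define P where "P = (\<lambda>q'. (cdist g (fst q) (fst q'), cdist g (snd q) (snd q'))) ` X"
  have Xg: "X \<subseteq> grid g" using X by (auto simp: outer_cells_def)
  have finX: "finite X" using Xg finite_subset finite_grid by blast
  then have finP: "finite P" by (simp add: P_def)
  have P: "0 \<le> k1 \<and> 0 \<le> k2 \<and> (max 0 (real_of_int k1 - 1))\<^sup>2 + (max 0 (real_of_int k2 - 1))\<^sup>2 < \<rho>\<^sup>2
      \<and> \<rho>\<^sup>2 \<le> (k1 + w)\<^sup>2 + (k2 + w)\<^sup>2" if "(k1, k2) \<in> P" for k1 k2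
    using that X Xg q inn by (auto simp: P_def outer_cells_def grid_def intro!: cdist_nonneg)
  let ?L = "w + 2 + sqrt ((w + 1) * (2 * \<rho> + w + 2))"
  have L: "0 \<le> ?L - 1" using w \<rho> by (simp add: add_nonneg_nonneg)
  define C where "C k = {k2. (k, k2) \<in> P}" for k
  have finC: "finite (C k)" for k
    unfolding C_def by (rule finite_subset[OF _ finite_imageI[OF finP, of snd]]) force
  have cardC: "real (card (C k)) \<le> ?L" for k
  proof -
    have "real (card (C k)) \<le> (?L - 1) + 1"
    proof (rule card_int_set_le_diameter[OF finC L])
      fix a b assume ab: "a \<in> C k" "b \<in> C k" "a \<le> b"
      then have "real_of_int b - real_of_int a \<le> w + 1 + sqrt ((w + 1) * (2 * \<rho> + w + 2))"
        using P[of k a] P[of k b] w \<rho> by (intro annulus_row_diameter[where k = "real_of_int k"]) (auto simp: C_def)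
      then show "real_of_int b - real_of_int a \<le> ?L - 1" by simp
    qed
    then show ?thesis by simp
  qed
  have "P \<subseteq> Sigma {0..\<lfloor>\<rho> + 1\<rfloor>} C"
  proof safe
    fix k1 k2 assume k: "(k1, k2) \<in> P"
    have "(max 0 (real_of_int k1 - 1))\<^sup>2 < \<rho>\<^sup>2" using P[OF k] by (smt (verit) zero_le_power2)
    then have "max 0 (real_of_int k1 - 1) < \<rho>" using \<rho> by (rule power2_less_imp_less)
    then have "real_of_int k1 \<le> \<rho> + 1" by simp
    then have "k1 \<le> \<lfloor>\<rho> + 1\<rfloor>" by (simp only: le_floor_iff)
    then show "k1 \<in> {0..\<lfloor>\<rho> + 1\<rfloor>}" using P[OF k] by auto
    show "k2 \<in> C k1" using k by (simp add: C_def)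
  qed
  then have "card P \<le> card (Sigma {0..\<lfloor>\<rho> + 1\<rfloor>} C)" using finC by (intro card_mono) auto
  also have "\<dots> = (\<Sum>k\<in>{0..\<lfloor>\<rho> + 1\<rfloor>}. card (C k))" using finC by simp
  finally have "real (card P) \<le> (\<Sum>k\<in>{0..\<lfloor>\<rho> + 1\<rfloor>}. real (card (C k)))" by (simp flip: of_nat_sum)
  also have "\<dots> \<le> (\<Sum>k\<in>{0..\<lfloor>\<rho> + 1\<rfloor>}. ?L)" by (intro sum_mono cardC)
  also have "\<dots> = real (card {0..\<lfloor>\<rho> + 1\<rfloor>}) * ?L" by simp
  also have "\<dots> \<le> (\<rho> + 2) * ?L"
    using L \<rho> card_int_atLeastAtMost_floor[of "\<rho> + 1"] by (intro mult_right_mono) linarith+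
  finally have "16 * real (card P) \<le> 16 * ((\<rho> + 2) * ?L)" by simp
  moreover have "card X \<le> 16 * card P"
    by (rule card_grid_subset_le[OF Xg finP, of q]) (auto simp: P_def)
  ultimately show ?thesis unfolding annulus_bound_def mult.assoc by linarith
qed

lemma annulus_bound_mono: "0 \<le> \<rho> \<Longrightarrow> 0 \<le> w \<Longrightarrow> w \<le> w' \<Longrightarrow> annulus_bound \<rho> w \<le> annulus_bound \<rho> w'"
  unfolding annulus_bound_def
  by (intro mult_left_mono add_mono real_sqrt_le_mono mult_mono) auto

lemma card_outer_minus_inner_le:
  fixes \<rho> :: real
  assumes "q \<in> grid g" "0 \<le> \<rho>"
  shows "card (outer_cells g \<rho> q - inner_cells g \<rho> q) \<le> annulus_bound \<rho> 1"
  by (rule card_annulus_le[OF assms(1) _ assms(2)]) (auto simp: outer_cells_def inner_cells_def)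

lemma card_outer_diff_near_le:
  fixes \<rho> :: real
  assumes q: "q \<in> grid g" and q2: "q2 \<in> near_cells g w q" and \<rho>: "0 \<le> \<rho>"
  shows "card (outer_cells g \<rho> q - outer_cells g \<rho> q2) \<le> annulus_bound \<rho> w"
proof (rule card_annulus_le[OF q _ \<rho>])
  fix q' assume q': "q' \<in> outer_cells g \<rho> q - outer_cells g \<rho> q2"
  have 1: "max 0 (real_of_int (cdist g (fst q2) (fst q')) - 1) \<le> cdist g (fst q) (fst q') + real w"
  proof -
    have "cdist g (fst q2) (fst q') \<le> cdist g (fst q2) (fst q) + cdist g (fst q) (fst q')"
      using q q2 q' by (intro cdist_triangle) (auto simp: near_cells_def outer_cells_def grid_def)
    moreover have "0 \<le> cdist g (fst q) (fst q')" 
      using q q' by (intro cdist_nonneg) (auto simp: near_cells_def outer_cells_def grid_def)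
    ultimately show ?thesis using q2 by (simp add: near_cells_def cdist_sym[of g "fst q2" "fst q"])
  qed
  have 2: "max 0 (real_of_int (cdist g (snd q2) (snd q')) - 1) \<le> cdist g (snd q) (snd q') + real w"
  proof -
    have "cdist g (snd q2) (snd q') \<le> cdist g (snd q2) (snd q) + cdist g (snd q) (snd q')"
      using q q2 q' by (intro cdist_triangle) (auto simp: near_cells_def outer_cells_def grid_def)
    moreover have "0 \<le> cdist g (snd q) (snd q')" 
      using q q' by (intro cdist_nonneg) (auto simp: near_cells_def outer_cells_def grid_def)
    ultimately show ?thesis using q2 by (simp add: near_cells_def cdist_sym[of g "snd q2" "snd q"])
  qed
  have "\<rho>\<^sup>2 \<le> (max 0 (real_of_int (cdist g (fst q2) (fst q')) - 1))\<^sup>2 + (max 0 (real_of_int (cdist g (snd q2) (snd q')) - 1))\<^sup>2"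
    using q' by (auto simp: outer_cells_def)
  also have "\<dots> \<le> (cdist g (fst q) (fst q') + real w)\<^sup>2 + (cdist g (snd q) (snd q') + real w)\<^sup>2"
    using 1 2 by (intro add_mono power_mono) auto
  finally show "\<rho>\<^sup>2 \<le> (cdist g (fst q) (fst q') + real w)\<^sup>2 + (cdist g (snd q) (snd q') + real w)\<^sup>2" .
qed auto

lemma near_cells_sym: "q \<in> grid g \<Longrightarrow> q' \<in> near_cells g w q \<Longrightarrow> q \<in> near_cells g w q'"
  by (auto simp: near_cells_def cdist_sym)

text \<open>Cyclic shifts by \<open>0, ..., k - 1\<close> in each coordinate give distinct cells
  because \<open>k \<le> g\<close>. Using a single quadrant avoids any double counting around the
  torus.\<close>

lemma card_translates_ge:
  assumes q: "q \<in> grid g" and k: "k \<le> g" and fin: "finite X"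
    and X: "\<And>q'. q' \<in> grid g \<Longrightarrow> cdist g (fst q) (fst q') < int k \<Longrightarrow> cdist g (snd q) (snd q') < int k \<Longrightarrow> q' \<in> X"
  shows "k\<^sup>2 \<le> card X"
proof -
  define f where "f i a = (i + a) mod int g" for i a :: int
  have inj: "inj_on (f i) {0..<int k}" for i
  proof (rule inj_onI)
    fix a b assume ab: "a \<in> {0..<int k}" "b \<in> {0..<int k}" "f i a = f i b"
    then have "int g dvd (i + a) - (i + b)" unfolding f_def by (simp only: mod_eq_dvd_iff)
    then have "int g dvd a - b" by simp
    moreover have "\<bar>a - b\<bar> < int g" using ab k by auto
    ultimately show "a = b" using dvd_imp_le_int[of "a - b" "int g"] by (cases "a = b") auto
  qed
  have cd: "cdist g i (f i a) < int k" "0 \<le> f i a" "f i a < int g"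
    if "0 \<le> i" "i < int g" "a \<in> {0..<int k}" for i a
  proof -
    have "f i a = i + a \<or> f i a = i + a - int g"
    proof (cases "i + a < int g")
      case False
      have "(i + a) mod int g = (i + a - int g) mod int g" by simp
      also have "\<dots> = i + a - int g" using False that k by (intro mod_pos_pos_trivial) auto
      finally show ?thesis by (simp add: f_def)
    qed (use that in \<open>auto simp: f_def mod_pos_pos_trivial\<close>)
    then show "cdist g i (f i a) < int k" using that k by (auto simp: cdist_def)
    show "0 \<le> f i a" "f i a < int g" using that by (auto simp: f_def)
  qed
  have "k\<^sup>2 = card ((f (fst q) ` {0..<int k}) \<times> (f (snd q) ` {0..<int k}))"
    by (simp add: card_cartesian_product card_image[OF inj] power2_eq_square)
  also have "\<dots> \<le> card X"
  proof (rule card_mono[OF fin])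
    show "(f (fst q) ` {0..<int k}) \<times> (f (snd q) ` {0..<int k}) \<subseteq> X"
      using cd q by (auto simp: grid_def intro!: X)
  qed
  finally show ?thesis .
qed

text \<open>Origin of the value \<open>\<rho>\<^sup>2 / 16\<close> for \<open>\<omega>\<close>:
  cells within distance below \<open>\<rho> / 2\<close> in both coordinates are inner, and rounding
  down leaves a side of at least \<open>\<rho> / 4\<close> once
  \<open>\<rho> \<ge> 4\<close>.\<close>

lemma card_inner_ge:
  fixes \<rho> :: real
  assumes q: "q \<in> grid g" and \<rho>: "4 \<le> \<rho>" "\<rho> \<le> real g"
  shows "\<rho>\<^sup>2 / 16 \<le> card (inner_cells g \<rho> q)"
proof -
  define k where "k = nat \<lfloor>\<rho> / 2\<rfloor>"
  have k: "\<rho> / 4 \<le> real k" "real k \<le> \<rho> / 2" using \<rho> unfolding k_def by linarith+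
  have "k\<^sup>2 \<le> card (inner_cells g \<rho> q)"
  proof (rule card_translates_ge[OF q])
    show "k \<le> g" using k \<rho> by linarith
    show "finite (inner_cells g \<rho> q)" by (simp add: inner_cells_def)
    fix q' assume q': "q' \<in> grid g" "cdist g (fst q) (fst q') < int k" "cdist g (snd q) (snd q') < int k"
    have nn: "0 \<le> cdist g (fst q) (fst q')" "0 \<le> cdist g (snd q) (snd q')"
      using q q' by (auto simp: grid_def intro!: cdist_nonneg)
    have "(real_of_int (cdist g (fst q) (fst q')) + 1)\<^sup>2 + (real_of_int (cdist g (snd q) (snd q')) + 1)\<^sup>2
        \<le> (\<rho> / 2)\<^sup>2 + (\<rho> / 2)\<^sup>2"
      using nn q' k by (intro add_mono power_mono) linarith+
    also have "\<dots> < \<rho>\<^sup>2" using \<rho> by (simp add: power2_eq_square)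
    finally show "q' \<in> inner_cells g \<rho> q" using q' by (simp add: inner_cells_def)
  qed
  then have "real (k\<^sup>2) \<le> card (inner_cells g \<rho> q)" by (rule of_nat_mono)
  moreover have "(\<rho> / 4)\<^sup>2 \<le> (real k)\<^sup>2" using k \<rho> by (intro power_mono) auto
  ultimately show ?thesis by (simp add: power2_eq_square)
qed

lemma inner_sub_outer: "q \<in> grid g \<Longrightarrow> inner_cells g \<rho> q \<subseteq> outer_cells g \<rho> q"
proof
  fix q' assume q: "q \<in> grid g" and q': "q' \<in> inner_cells g \<rho> q"
  have nn: "0 \<le> cdist g (fst q) (fst q')" "0 \<le> cdist g (snd q) (snd q')"
    using q q' by (auto simp: grid_def inner_cells_def intro!: cdist_nonneg)
  have "(max 0 (real_of_int (cdist g (fst q) (fst q')) - 1))\<^sup>2 + (max 0 (real_of_int (cdist g (snd q) (snd q')) - 1))\<^sup>2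
     \<le> (real_of_int (cdist g (fst q) (fst q')) + 1)\<^sup>2 + (real_of_int (cdist g (snd q) (snd q')) + 1)\<^sup>2"
    using nn by (intro add_mono power_mono) auto
  then show "q' \<in> outer_cells g \<rho> q" using q' by (auto simp: inner_cells_def outer_cells_def)
qed

lemma outer_cells_cdist:
  fixes \<rho> :: real
  assumes "q' \<in> outer_cells g \<rho> q" "0 \<le> \<rho>"
  shows "cdist g (fst q) (fst q') \<le> \<rho> + 1" "cdist g (snd q) (snd q') \<le> \<rho> + 1"
proof -
  have "(max 0 (real_of_int (cdist g (fst q) (fst q')) - 1))\<^sup>2 < \<rho>\<^sup>2"
    "(max 0 (real_of_int (cdist g (snd q) (snd q')) - 1))\<^sup>2 < \<rho>\<^sup>2"
    using assms(1) by (auto simp: outer_cells_def) (smt (verit) zero_le_power2)+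
  from this[THEN power2_less_imp_less[OF _ assms(2)]]
  show "cdist g (fst q) (fst q') \<le> \<rho> + 1" "cdist g (snd q) (snd q') \<le> \<rho> + 1" by auto
qed

lemma window_cdist:
  fixes \<rho> :: real
  assumes "0 \<le> \<rho>" "q \<in> grid g" "q' \<in> window (outer_cells g \<rho>) q k"
  shows "q' \<in> grid g \<and> cdist g (fst q) (fst q') \<le> k * (\<rho> + 1) \<and> cdist g (snd q) (snd q') \<le> k * (\<rho> + 1)"
  using assms(3)
proof (induction k arbitrary: q')
  case (Suc k)
  then obtain q1 where q1: "q1 \<in> window (outer_cells g \<rho>) q k" "q' \<in> outer_cells g \<rho> q1" by auto
  note IH = Suc.IH[OF q1(1)]
  have q'g: "q' \<in> grid g" using q1 by (simp add: outer_cells_def)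
  have "cdist g (fst q) (fst q') \<le> cdist g (fst q) (fst q1) + cdist g (fst q1) (fst q')"
    "cdist g (snd q) (snd q') \<le> cdist g (snd q) (snd q1) + cdist g (snd q1) (snd q')"
    using IH q'g assms(2) by (auto simp: grid_def intro!: cdist_triangle)
  then have "real_of_int (cdist g (fst q) (fst q')) \<le> k * (\<rho> + 1) + (\<rho> + 1)"
    "real_of_int (cdist g (snd q) (snd q')) \<le> k * (\<rho> + 1) + (\<rho> + 1)"
    using IH outer_cells_cdist[OF q1(2) assms(1)] by linarith+
  then show ?case using q'g by (simp add: algebra_simps)
qed (use assms in auto)

lemma near_connected:
  assumes w: "1 \<le> w" and q: "q \<in> grid g" "q' \<in> grid g"
  shows "(q, q') \<in> {(a, b). a \<in> grid g \<and> b \<in> near_cells g w a}\<^sup>*"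
proof -
  let ?R = "{(a, b). a \<in> grid g \<and> b \<in> near_cells g w a}"
  have symR: "sym ?R" by (auto simp: sym_def intro: near_cells_sym) (auto simp: near_cells_def)
  have 1: "((0, 0), (int a, 0)) \<in> ?R\<^sup>*" if "a < g" for a
    using that
  proof (induction a)
    case (Suc a)
    have "((int a, 0), (int (Suc a), 0)) \<in> ?R" using Suc.prems w by (auto simp: near_cells_def grid_def cdist_def)
    then show ?case using Suc by (meson Suc_lessD rtrancl.rtrancl_into_rtrancl)
  qed simp
  have 2: "((int a, 0), (int a, int b)) \<in> ?R\<^sup>*" if "a < g" "b < g" for a b
    using that
  proof (induction b)
    case (Suc b)
    have "((int a, int b), (int a, int (Suc b))) \<in> ?R" using Suc.prems w by (auto simp: near_cells_def grid_def cdist_def)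
    then show ?case using Suc by (meson Suc_lessD rtrancl.rtrancl_into_rtrancl)
  qed simp
  have 3: "((0, 0), q) \<in> ?R\<^sup>*" if qg: "q \<in> grid g" for q
  proof -
    obtain a b where "q = (int a, int b)" "a < g" "b < g"
      using qg by (cases q) (auto simp: grid_def intro: that elim!: nonneg_int_cases)
    then show ?thesis using rtrancl_trans[OF 1[of a] 2[of a b]] by simp
  qed
  have "(q, (0, 0)) \<in> ?R\<^sup>*" using 3[OF q(1)] symR by (meson sym_rtrancl symD)
  then show ?thesis using 3[OF q(2)] by (rule rtrancl_trans)
qed

section \<open>From distances of points to distances of cells\<close>

lemma scaled_tdist_coordinate:
  fixes x y :: real
  assumes "0 \<le> x" "x < 1" "0 \<le> y" "y < 1" "0 < g"
  shows "\<bar>real g * min \<bar>x - y\<bar> (1 - \<bar>x - y\<bar>) - cdist g \<lfloor>real g * x\<rfloor> \<lfloor>real g * y\<rfloor>\<bar> \<le> 1"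
proof -
  define i j where "i = \<lfloor>real g * x\<rfloor>" and "j = \<lfloor>real g * y\<rfloor>"
  have ij: "real_of_int i \<le> g * x" "g * x < real_of_int i + 1" "real_of_int j \<le> g * y" "g * y < real_of_int j + 1"
    unfolding i_def j_def by linarith+
  have d: "\<bar>g * \<bar>x - y\<bar> - real_of_int \<bar>i - j\<bar>\<bar> \<le> 1"
  proof -
    have "g * \<bar>x - y\<bar> = \<bar>g * x - g * y\<bar>" by (simp add: abs_mult flip: right_diff_distrib)
    then show ?thesis using ij by linarith
  qed
  have "real g * min \<bar>x - y\<bar> (1 - \<bar>x - y\<bar>) = min (g * \<bar>x - y\<bar>) (g - g * \<bar>x - y\<bar>)"
    using assms by (simp add: min_mult_distrib_left right_diff_distrib)
  moreover have "real_of_int (cdist g i j) = min (real_of_int \<bar>i - j\<bar>) (g - real_of_int \<bar>i - j\<bar>)"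
    by (simp add: cdist_def of_int_min)
  ultimately show ?thesis unfolding i_def[symmetric] j_def[symmetric] using d by linarith
qed

definition cell_of :: "nat \<Rightarrow> real \<times> real \<Rightarrow> int \<times> int" where
  "cell_of g z = (\<lfloor>real g * fst z\<rfloor>, \<lfloor>real g * snd z\<rfloor>)"

lemma cell_of_in_grid:
  assumes "z \<in> {0..<1} \<times> {0..<1}" "0 < g"
  shows "cell_of g z \<in> grid g"
proof -
  have "real g * fst z < real g" "real g * snd z < real g" using assms by auto
  then have "real g * fst z < real_of_int (int g)" "real g * snd z < real_of_int (int g)" by auto
  then show ?thesis using assms by (auto simp: cell_of_def grid_def floor_less_iff)
qed

lemma
  assumes xy: "x \<in> {0..<1} \<times> {0..<1}" "y \<in> {0..<1} \<times> {0..<1}" and g: "0 < g" and r: "0 < r"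
  shows tdist_less_imp_outer: "tdist x y < r \<Longrightarrow> cell_of g y \<in> outer_cells g (r * g) (cell_of g x)"
    and inner_imp_tdist_less: "cell_of g y \<in> inner_cells g (r * g) (cell_of g x) \<Longrightarrow> tdist x y < r"
proof -
  define e1 e2 where "e1 = min \<bar>fst x - fst y\<bar> (1 - \<bar>fst x - fst y\<bar>)"
    and "e2 = min \<bar>snd x - snd y\<bar> (1 - \<bar>snd x - snd y\<bar>)"
  define k1 k2 where "k1 = real_of_int (cdist g (fst (cell_of g x)) (fst (cell_of g y)))"
    and "k2 = real_of_int (cdist g (snd (cell_of g x)) (snd (cell_of g y)))"
  have e0: "0 \<le> e1" "0 \<le> e2" using xy by (auto simp: e1_def e2_def)
  have d: "\<bar>g * e1 - k1\<bar> \<le> 1" "\<bar>g * e2 - k2\<bar> \<le> 1"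
    unfolding e1_def e2_def k1_def k2_def cell_of_def fst_conv snd_conv
    using xy g by (intro scaled_tdist_coordinate; auto)+
  have k0: "0 \<le> k1" "0 \<le> k2"
    using cell_of_in_grid[OF xy(1) g] cell_of_in_grid[OF xy(2) g]
    by (auto simp: k1_def k2_def grid_def intro!: cdist_nonneg)
  have "tdist x y < r \<longleftrightarrow> e1\<^sup>2 + e2\<^sup>2 < r\<^sup>2"
    using real_sqrt_less_iff[of "e1\<^sup>2 + e2\<^sup>2" "r\<^sup>2"] r by (simp add: tdist_def e1_def e2_def)
  also have "\<dots> \<longleftrightarrow> (real g)\<^sup>2 * (e1\<^sup>2 + e2\<^sup>2) < (real g)\<^sup>2 * r\<^sup>2"
    using g by simp
  also have "\<dots> \<longleftrightarrow> (g * e1)\<^sup>2 + (g * e2)\<^sup>2 < (r * g)\<^sup>2"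
    by (simp add: power_mult_distrib distrib_left mult.commute)
  finally have iff: "tdist x y < r \<longleftrightarrow> (g * e1)\<^sup>2 + (g * e2)\<^sup>2 < (r * g)\<^sup>2" .
  show "cell_of g y \<in> outer_cells g (r * g) (cell_of g x)" if "tdist x y < r"
  proof -
    have "(max 0 (k1 - 1))\<^sup>2 + (max 0 (k2 - 1))\<^sup>2 \<le> (g * e1)\<^sup>2 + (g * e2)\<^sup>2"
      using d e0 by (intro add_mono power_mono) auto
    then show ?thesis using that iff cell_of_in_grid[OF xy(2) g]
      by (simp add: outer_cells_def k1_def k2_def)
  qed
  show "tdist x y < r" if "cell_of g y \<in> inner_cells g (r * g) (cell_of g x)"
  proof -
    have "(g * e1)\<^sup>2 + (g * e2)\<^sup>2 \<le> (k1 + 1)\<^sup>2 + (k2 + 1)\<^sup>2"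
      using d e0 by (intro add_mono power_mono) auto
    then show ?thesis using that iff by (simp add: inner_cells_def k1_def k2_def)
  qed
qed

section \<open>Concentration of the cell counts\<close>

lemma prob_space_unif_sq: "prob_space unif_sq"
proof -
  have "emeasure (lborel :: (real \<times> real) measure) ({0..1} \<times> {0..1}) = 1"
    by (simp add: lborel_prod[symmetric] lborel.emeasure_pair_measure_Times)
  then show ?thesis unfolding unif_sq_def by (intro prob_space_uniform_measure) auto
qed

lemma sets_unif_sq [simp, measurable_cong]: "sets unif_sq = sets borel"
  by (simp add: unif_sq_def)

lemma space_unif_sq [simp]: "space unif_sq = UNIV"
  by (simp add: unif_sq_def)

lemma measure_unif_sq_box:
  assumes "0 \<le> a" "a \<le> b" "b \<le> 1" "0 \<le> c" "c \<le> d" "d \<le> (1::real)"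
  shows "measure unif_sq ({a..<b} \<times> {c..<d}) = (b - a) * (d - c)"
proof -
  have sq: "emeasure (lborel :: (real \<times> real) measure) ({0..1} \<times> {0..1}) = 1"
    by (simp add: lborel_prod[symmetric] lborel.emeasure_pair_measure_Times)
  have "{0..1} \<times> {0..1} \<inter> {a..<b} \<times> {c..<d} = {a..<b} \<times> {c..<d}" using assms by auto
  then have "emeasure unif_sq ({a..<b} \<times> {c..<d}) = emeasure lborel ({a..<b} \<times> {c..<d})"
    unfolding unif_sq_def by (subst emeasure_uniform_measure) (auto simp: sq borel_Times divide_ennreal_def)
  also have "\<dots> = ennreal ((b - a) * (d - c))"
    using assms by (simp add: lborel_prod[symmetric] lborel.emeasure_pair_measure_Times ennreal_mult)
  finally show ?thesis using assms by (simp add: measure_def)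
qed

lemma cell_of_vimage:
  assumes "0 < g" "(i, j) \<in> grid g"
  shows "{z. cell_of g z = (i, j)} = {i / g..<(i + 1) / g} \<times> {j / g..<(j + 1) / g}"
  using assms by (auto simp: cell_of_def floor_eq_iff field_simps)

lemma measure_cell:
  assumes "0 < g" "q \<in> grid g"
  shows "{z. cell_of g z = q} \<in> sets unif_sq" "measure unif_sq {z. cell_of g z = q} = 1 / (real g)\<^sup>2"
proof -
  obtain i j where q: "q = (i, j)" by (cases q)
  have ij: "0 \<le> i" "i < int g" "0 \<le> j" "j < int g" using assms q by (auto simp: grid_def)
  then have "real_of_int i + 1 \<le> g" "real_of_int j + 1 \<le> g" by linarith+
  note eq = cell_of_vimage[OF assms(1), of i j]
  show "{z. cell_of g z = q} \<in> sets unif_sq"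
    using assms q by (simp add: eq borel_Times)
  have "measure unif_sq {z. cell_of g z = q} = ((real_of_int i + 1) / g - i / g) * ((real_of_int j + 1) / g - j / g)"
    unfolding q eq[OF assms(2)[unfolded q]]
    using \<open>real_of_int i + 1 \<le> g\<close> \<open>real_of_int j + 1 \<le> g\<close> ij assms
    by (intro measure_unif_sq_box) (auto simp: divide_right_mono)
  also have "\<dots> = 1 / (real g)\<^sup>2" by (simp add: power2_eq_square flip: diff_divide_distrib)
  finally show "measure unif_sq {z. cell_of g z = q} = 1 / (real g)\<^sup>2" .
qed

section \<open>Chernoff bounds for the number of points in a set\<close>

lemma exp_le_quadratic:
  fixes s :: real
  assumes "\<bar>s\<bar> \<le> 1"
  shows "exp s \<le> 1 + s + s\<^sup>2"
proof (cases "0 \<le> s")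
  case True
  then show ?thesis using exp_bound[of s] assms by simp
next
  case False
  define v where "v = - s"
  have v: "0 < v" using False by (simp add: v_def)
  \<comment> \<open>The product equals \<open>1 + v ^ 3\<close>.\<close>
  have "1 \<le> (1 - v + v\<^sup>2) * (1 + v)" using v by (simp add: algebra_simps power2_eq_square)
  also have "\<dots> \<le> (1 - v + v\<^sup>2) * exp v"
  proof (intro mult_left_mono exp_ge_add_one_self)
    have "0 \<le> (1 - v)\<^sup>2 + v" using v by simp
    then show "0 \<le> 1 - v + v\<^sup>2" by (simp add: power2_eq_square algebra_simps)
  qed
  finally show ?thesis by (simp add: v_def exp_minus field_simps)
qed

context prob_space
begin

lemma hits_measurable:
  assumes "finite I" "C \<in> sets M"
  shows "(\<lambda>x. real (card {u \<in> I. x u \<in> C})) \<in> borel_measurable (PiM I (\<lambda>_. M))"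
proof -
  have "real (card {u \<in> I. x u \<in> C}) = (\<Sum>u\<in>I. indicator C (x u))" for x
    using assms(1) by (simp add: indicator_def sum.If_cases Int_def)
  then show ?thesis using assms by simp
qed

lemma hits_exponential_moment:
  fixes s :: real
  assumes fin: "finite I" and C: "C \<in> sets M"
  shows "(\<integral>\<^sup>+x. ennreal (exp (s * card {u \<in> I. x u \<in> C})) \<partial>PiM I (\<lambda>_. M))
    \<le> ennreal (exp (card I * prob C * (exp s - 1)))"
proof -
  interpret product_sigma_finite "\<lambda>_. M" by unfold_locales
  have eq: "ennreal (exp (s * card {u \<in> I. x u \<in> C})) = (\<Prod>u\<in>I. ennreal (exp (s * indicator C (x u))))" for x
  proof -
    have "real (card {u \<in> I. x u \<in> C}) = (\<Sum>u\<in>I. indicator C (x u))"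
      using fin by (simp add: indicator_def sum.If_cases Int_def)
    then show ?thesis using fin by (simp only: sum_distrib_left exp_sum prod_ennreal exp_ge_zero)
  qed
  have one: "(\<integral>\<^sup>+z. ennreal (exp (s * indicator C z)) \<partial>M) = ennreal (1 + prob C * (exp s - 1))"
  proof -
    have "exp (s * indicator C z) = 1 + (exp s - 1) * indicator C z" for z
      by (simp add: indicator_def)
    then have "(\<integral>\<^sup>+z. ennreal (exp (s * indicator C z)) \<partial>M) = (\<integral>\<^sup>+z. ennreal (1 + (exp s - 1) * indicator C z) \<partial>M)"
      by simp
    also have "\<dots> = ennreal (\<integral>z. 1 + (exp s - 1) * indicator C z \<partial>M)"
    proof (rule nn_integral_eq_integral)
      show "integrable M (\<lambda>z. 1 + (exp s - 1) * indicator C z)"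
        using C by (intro Bochner_Integration.integrable_add integrable_mult_right) (auto simp: emeasure_eq_measure)
      show "AE z in M. 0 \<le> 1 + (exp s - 1) * indicator C z" by (simp add: indicator_def)
    qed
    also have "(\<integral>z. 1 + (exp s - 1) * indicator C z \<partial>M) = 1 + prob C * (exp s - 1)"
      using C by (subst Bochner_Integration.integral_add)
        (auto simp: emeasure_eq_measure prob_space intro!: integrable_mult_right)
    finally show ?thesis .
  qed
  have nn: "0 \<le> 1 + prob C * (exp s - 1)"
  proof -
    have "0 \<le> (1 - prob C) + prob C * exp s" by (intro add_nonneg_nonneg mult_nonneg_nonneg) auto
    then show ?thesis by (simp add: algebra_simps)
  qed
  have "(\<integral>\<^sup>+x. ennreal (exp (s * card {u \<in> I. x u \<in> C})) \<partial>PiM I (\<lambda>_. M))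
      = (\<Prod>u\<in>I. \<integral>\<^sup>+z. ennreal (exp (s * indicator C z)) \<partial>M)"
    unfolding eq using C fin by (intro product_nn_integral_prod) auto
  also have "\<dots> = ennreal ((1 + prob C * (exp s - 1)) ^ card I)"
    using nn by (simp add: one ennreal_power)
  also have "\<dots> \<le> ennreal (exp (prob C * (exp s - 1)) ^ card I)"
    using nn by (intro ennreal_leI power_mono) (auto simp: add.commute intro: exp_ge_add_one_self)
  also have "exp (prob C * (exp s - 1)) ^ card I = exp (card I * prob C * (exp s - 1))"
    by (simp add: mult.assoc flip: exp_of_nat_mult)
  finally show ?thesis .
qed

text \<open>Exponential Markov inequality; a positive \<open>s\<close> gives the upper tail and a
  negative \<open>s\<close> the lower one.\<close>

lemma hits_tail:
  fixes s b :: real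
  assumes fin: "finite I" and C: "C \<in> sets M"
  shows "emeasure (PiM I (\<lambda>_. M)) {x \<in> space (PiM I (\<lambda>_. M)). b \<le> s * card {u \<in> I. x u \<in> C}}
    \<le> ennreal (exp (card I * prob C * (exp s - 1) - b))"
proof -
  let ?P = "PiM I (\<lambda>_. M)"
  note [measurable] = hits_measurable[OF assms]
  have "{x \<in> space ?P. b \<le> s * card {u \<in> I. x u \<in> C}}
      = {x \<in> space ?P. 1 \<le> ennreal (exp (- b)) * ennreal (exp (s * card {u \<in> I. x u \<in> C}))}"
    by (auto simp: ennreal_mult[symmetric] simp flip: exp_add)
  then have "emeasure ?P {x \<in> space ?P. b \<le> s * card {u \<in> I. x u \<in> C}}
      \<le> ennreal (exp (- b)) * (\<integral>\<^sup>+x. ennreal (exp (s * card {u \<in> I. x u \<in> C})) * indicator (space ?P) x \<partial>?P)"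
    by (simp only:) (intro nn_integral_Markov_inequality, auto)
  also have "(\<integral>\<^sup>+x. ennreal (exp (s * card {u \<in> I. x u \<in> C})) * indicator (space ?P) x \<partial>?P)
      = (\<integral>\<^sup>+x. ennreal (exp (s * card {u \<in> I. x u \<in> C})) \<partial>?P)"
    by (intro nn_integral_cong) auto
  also have "ennreal (exp (- b)) * \<dots> \<le> ennreal (exp (- b)) * ennreal (exp (card I * prob C * (exp s - 1)))"
    by (intro mult_left_mono hits_exponential_moment assms) auto
  also have "\<dots> = ennreal (exp (card I * prob C * (exp s - 1) - b))"
    by (simp add: ennreal_mult[symmetric] flip: exp_add)
  finally show ?thesis .
qed

lemma hits_deviation:
  fixes \<theta> :: real
  assumes fin: "finite I" and C: "C \<in> sets M" and \<theta>: "0 < \<theta>" "\<theta> \<le> 1"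
  defines "\<mu> \<equiv> real (card I) * prob C"
  shows "emeasure (PiM I (\<lambda>_. M)) {x \<in> space (PiM I (\<lambda>_. M)).
      \<not> ((1 - \<theta>) * \<mu> \<le> card {u \<in> I. x u \<in> C} \<and> card {u \<in> I. x u \<in> C} \<le> (1 + \<theta>) * \<mu>)}
    \<le> ennreal (2 * exp (- \<theta>\<^sup>2 * \<mu> / 4))"
proof -
  let ?P = "PiM I (\<lambda>_. M)"
  note [measurable] = hits_measurable[OF fin C]
  have \<mu>: "0 \<le> \<mu>" by (simp add: \<mu>_def)
  define U where "U s b = {x \<in> space ?P. b \<le> s * card {u \<in> I. x u \<in> C}}" for s b :: real
  have [measurable]: "U s b \<in> sets ?P" for s b by (simp add: U_def)
  \<comment> \<open>For \<open>s = \<theta> / 2\<close> and \<open>s = - \<theta> / 2\<close> the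
    threshold \<open>(1 + 2 * s) * \<mu>\<close> is \<open>(1 + \<theta>) * \<mu>\<close> and
    \<open>(1 - \<theta>) * \<mu>\<close>, and in both cases the exponent is at most
    \<open>- s\<^sup>2 * \<mu>\<close>.\<close>
  have bound: "emeasure ?P (U s (s * ((1 + 2 * s) * \<mu>))) \<le> ennreal (exp (- \<theta>\<^sup>2 * \<mu> / 4))"
    if s: "\<bar>s\<bar> = \<theta> / 2" for s
  proof -
    have "emeasure ?P (U s (s * ((1 + 2 * s) * \<mu>))) \<le> ennreal (exp (\<mu> * (exp s - 1) - s * ((1 + 2 * s) * \<mu>)))"
      unfolding U_def \<mu>_def by (rule hits_tail[OF fin C])
    also have "\<dots> \<le> ennreal (exp (\<mu> * (s + s\<^sup>2) - s * ((1 + 2 * s) * \<mu>)))"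
      using exp_le_quadratic[of s] s \<theta> \<mu> by (intro ennreal_leI) (auto intro!: mult_left_mono)
    also have "\<mu> * (s + s\<^sup>2) - s * ((1 + 2 * s) * \<mu>) = - (\<bar>s\<bar>\<^sup>2) * \<mu>"
      by (simp add: algebra_simps power2_eq_square)
    also have "\<dots> = - \<theta>\<^sup>2 * \<mu> / 4" by (simp add: s power_divide)
    finally show ?thesis .
  qed
  have "{x \<in> space ?P. \<not> ((1 - \<theta>) * \<mu> \<le> card {u \<in> I. x u \<in> C} \<and> card {u \<in> I. x u \<in> C} \<le> (1 + \<theta>) * \<mu>)}
      \<subseteq> U (\<theta> / 2) (\<theta> / 2 * ((1 + 2 * (\<theta> / 2)) * \<mu>)) \<union> U (- (\<theta> / 2)) (- (\<theta> / 2) * ((1 + 2 * - (\<theta> / 2)) * \<mu>))"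
    using \<theta> by (auto simp: U_def not_le)
  then have "emeasure ?P {x \<in> space ?P. \<not> ((1 - \<theta>) * \<mu> \<le> card {u \<in> I. x u \<in> C} \<and> card {u \<in> I. x u \<in> C} \<le> (1 + \<theta>) * \<mu>)}
      \<le> emeasure ?P (U (\<theta> / 2) (\<theta> / 2 * ((1 + 2 * (\<theta> / 2)) * \<mu>)) \<union> U (- (\<theta> / 2)) (- (\<theta> / 2) * ((1 + 2 * - (\<theta> / 2)) * \<mu>)))"
    by (intro emeasure_mono) auto
  also have "\<dots> \<le> emeasure ?P (U (\<theta> / 2) (\<theta> / 2 * ((1 + 2 * (\<theta> / 2)) * \<mu>)))
      + emeasure ?P (U (- (\<theta> / 2)) (- (\<theta> / 2) * ((1 + 2 * - (\<theta> / 2)) * \<mu>)))"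
    by (intro emeasure_subadditive) auto
  also have "\<dots> \<le> ennreal (exp (- \<theta>\<^sup>2 * \<mu> / 4)) + ennreal (exp (- \<theta>\<^sup>2 * \<mu> / 4))"
    using \<theta> by (intro add_mono bound) auto
  also have "\<dots> = ennreal (2 * exp (- \<theta>\<^sup>2 * \<mu> / 4))" by (simp flip: ennreal_plus)
  finally show ?thesis .
qed

end

section \<open>The conditional probability of a giant component\<close>

lemma prob_space_points: "prob_space (points_measure n)"
  unfolding points_measure_def by (intro prob_space_PiM prob_space_unif_sq)

text \<open>The half-open square excludes the null set of points with a coordinate 1, whose cell
  would fall outside the grid.\<close>

definition good_points :: "nat \<Rightarrow> nat \<Rightarrow> real \<Rightarrow> (nat \<Rightarrow> real \<times> real) set" where
  "good_points n g \<theta> = {x \<in> space (points_measure n). (\<forall>u<n. x u \<in> {0..<1} \<times> {0..<1}) \<and>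
     (\<forall>q\<in>grid g. (1 - \<theta>) * (n / (real g)\<^sup>2) \<le> cell_count (\<lambda>u. cell_of g (x u)) {..<n} q \<and>
        cell_count (\<lambda>u. cell_of g (x u)) {..<n} q \<le> (1 + \<theta>) * (n / (real g)\<^sup>2))}"

lemma
  assumes g: "0 < g" and \<theta>: "0 < \<theta>" "\<theta> \<le> 1"
  shows good_points_sets: "good_points n g \<theta> \<in> sets (points_measure n)"
    and emeasure_good_points: "ennreal (1 - (real g)\<^sup>2 * (2 * exp (- \<theta>\<^sup>2 * (n / (real g)\<^sup>2) / 4)))
      \<le> emeasure (points_measure n) (good_points n g \<theta>)"
proof -
  interpret U: prob_space unif_sq by (rule prob_space_unif_sq)
  interpret P: prob_space "points_measure n" by (rule prob_space_points)
  let ?M = "points_measure n" and ?\<nu> = "real n / (real g)\<^sup>2"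
  define SQ where "SQ = {0..<1::real} \<times> {0..<1::real}"
  define C where "C q = {z. cell_of g z = q}" for q
  define H where "H q = {x \<in> space ?M. (1 - \<theta>) * ?\<nu> \<le> card {u \<in> {..<n}. x u \<in> C q} \<and>
      card {u \<in> {..<n}. x u \<in> C q} \<le> (1 + \<theta>) * ?\<nu>}" for q
  define V where "V = {x \<in> space ?M. \<forall>u<n. x u \<in> SQ}"
  have sq: "SQ \<in> sets unif_sq" by (simp add: SQ_def borel_Times)
  have C: "C q \<in> sets unif_sq" "U.prob (C q) = 1 / (real g)\<^sup>2" if "q \<in> grid g" for q
    using measure_cell[OF g that] by (auto simp: C_def)
  have H_meas: "H q \<in> sets ?M" if "q \<in> grid g" for q
  proof -
    note [measurable] = U.hits_measurable[OF finite_lessThan C(1)[OF that], of n]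
    show ?thesis unfolding H_def points_measure_def by measurable
  qed
  have comp: "(\<lambda>x. x u) \<in> measurable ?M unif_sq" if "u < n" for u
    using that unfolding points_measure_def by (intro measurable_component_singleton) auto
  have V_meas: "V \<in> sets ?M"
  proof -
    have "{x \<in> space ?M. \<forall>u\<in>{..<n}. x u \<in> SQ} \<in> sets ?M"
    proof (rule sets.sets_Collect_finite_All)
      fix u assume "u \<in> {..<n}"
      then have "(\<lambda>x. x u) -` SQ \<inter> space ?M \<in> sets ?M"
        using measurable_sets[OF comp sq, of u] by simp
      then show "{x \<in> space ?M. x u \<in> SQ} \<in> sets ?M"
        by (simp add: vimage_def Int_def conj_commute)
    qed simp
    then show ?thesis by (simp only: V_def Ball_def lessThan_iff)
  qed
  have G_eq: "good_points n g \<theta> = V \<inter> {x \<in> space ?M. \<forall>q\<in>grid g. x \<in> H q}"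
    by (auto simp: good_points_def[folded SQ_def] V_def H_def C_def cell_count_def)
  have HH_meas: "{x \<in> space ?M. \<forall>q\<in>grid g. x \<in> H q} \<in> sets ?M"
  proof (rule sets.sets_Collect_finite_All)
    fix q assume q: "q \<in> grid g"
    have "{x \<in> space ?M. x \<in> H q} = H q" by (auto simp: H_def)
    then show "{x \<in> space ?M. x \<in> H q} \<in> sets ?M" using H_meas[OF q] by simp
  qed simp
  show G_meas: "good_points n g \<theta> \<in> sets ?M" unfolding G_eq by (intro sets.Int V_meas HH_meas)
  have "U.prob SQ = 1" using measure_unif_sq_box[of 0 1 0 1] by (simp add: SQ_def)
  then have "AE z in unif_sq. z \<in> SQ" using sq by (simp only: U.prob_eq_1)
  then have "AE x in ?M. x u \<in> SQ" if "u < n" for u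
    unfolding points_measure_def using that by (intro AE_PiM_component prob_space_unif_sq) auto
  then have "AE x in ?M. \<forall>u\<in>{..<n}. x u \<in> SQ"
    by (intro AE_finite_allI) auto
  then have "AE x in ?M. x \<in> V" by (auto simp: V_def)
  then have PV: "P.prob V = 1" using V_meas by (simp only: P.prob_eq_1)
  have PH: "P.prob (space ?M - H q) \<le> 2 * exp (- \<theta>\<^sup>2 * ?\<nu> / 4)" if q: "q \<in> grid g" for q
  proof -
    have "space ?M - H q = {x \<in> space ?M. \<not> ((1 - \<theta>) * (real (card {..<n}) * U.prob (C q)) \<le> card {u \<in> {..<n}. x u \<in> C q} \<and>
      card {u \<in> {..<n}. x u \<in> C q} \<le> (1 + \<theta>) * (real (card {..<n}) * U.prob (C q)))}"
      by (auto simp: H_def C(2)[OF q])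
    then have "emeasure ?M (space ?M - H q) \<le> ennreal (2 * exp (- \<theta>\<^sup>2 * (real (card {..<n}) * U.prob (C q)) / 4))"
      using U.hits_deviation[OF finite_lessThan C(1)[OF q] \<theta>, of n] by (simp only: points_measure_def)
    then show ?thesis by (simp add: P.emeasure_eq_measure C(2)[OF q])
  qed
  have "space ?M - good_points n g \<theta> \<subseteq> (space ?M - V) \<union> (\<Union>q\<in>grid g. space ?M - H q)"
    unfolding G_eq by auto
  then have "P.prob (space ?M - good_points n g \<theta>) \<le> P.prob ((space ?M - V) \<union> (\<Union>q\<in>grid g. space ?M - H q))"
    using H_meas V_meas by (intro P.finite_measure_mono sets.Un sets.Diff sets.finite_UN sets.top finite_grid)
  also have "\<dots> \<le> P.prob (space ?M - V) + P.prob (\<Union>q\<in>grid g. space ?M - H q)"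
    using H_meas V_meas by (intro measure_Un_le sets.Diff sets.finite_UN sets.top finite_grid)
  also have "P.prob (space ?M - V) = 0" using P.prob_compl[OF V_meas] PV by simp
  also have "P.prob (\<Union>q\<in>grid g. space ?M - H q) \<le> (\<Sum>q\<in>grid g. P.prob (space ?M - H q))"
    using H_meas by (intro P.finite_measure_subadditive_finite) (auto simp: sets.compl_sets)
  also have "\<dots> \<le> (\<Sum>q\<in>grid g. 2 * exp (- \<theta>\<^sup>2 * ?\<nu> / 4))" by (intro sum_mono PH)
  also have "\<dots> = (real g)\<^sup>2 * (2 * exp (- \<theta>\<^sup>2 * ?\<nu> / 4))"
    by (simp add: grid_def card_cartesian_product power2_eq_square)
  finally have "1 - (real g)\<^sup>2 * (2 * exp (- \<theta>\<^sup>2 * ?\<nu> / 4)) \<le> P.prob (good_points n g \<theta>)"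
    using P.prob_compl[OF G_meas] by simp
  then show "ennreal (1 - (real g)\<^sup>2 * (2 * exp (- \<theta>\<^sup>2 * (n / (real g)\<^sup>2) / 4)))
      \<le> emeasure ?M (good_points n g \<theta>)"
    by (simp add: P.emeasure_eq_measure ennreal_leI)
qed

section \<open>The cell system of a well-distributed point set\<close>

lemma set_sel_pmf_subset: "T \<in> set_pmf (sel_pmf xi n r x u) \<Longrightarrow> T \<subseteq> nbhd n r x u"
proof -
  assume "T \<in> set_pmf (sel_pmf xi n r x u)"
  then obtain k where k: "T \<in> set_pmf (pmf_of_set {S. S \<subseteq> nbhd n r x u \<and> card S = min k (card (nbhd n r x u))})"
    by (auto simp: sel_pmf_def)
  obtain S0 where "S0 \<subseteq> nbhd n r x u" "card S0 = min k (card (nbhd n r x u))"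
    using obtain_subset_with_card_n[of "min k (card (nbhd n r x u))" "nbhd n r x u"] by auto
  then have "{S. S \<subseteq> nbhd n r x u \<and> card S = min k (card (nbhd n r x u))} \<noteq> {}" by blast
  then show ?thesis using k by (subst (asm) set_pmf_of_set) auto
qed

lemma set_irrig_pmf_subset: "Y \<in> set_pmf (irrig_pmf xi n r x) \<Longrightarrow> u < n \<Longrightarrow> Y u \<subseteq> nbhd n r x u"
  by (rule set_sel_pmf_subset[where xi = xi]) (simp add: irrig_pmf_def set_Pi_pmf PiE_dflt_def)

lemma irrigation_cells_good_points:
  fixes \<rho> \<theta> r :: real
  assumes xi: "\<forall>k\<in>set_pmf xi. 1 \<le> k" and p: "p = measure_pmf.prob xi {2..}" "0 < p"
    and g: "0 < g" and r: "0 < r" "r \<le> 1" and \<rho>: "\<rho> = r * real g" "4 \<le> \<rho>"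
    and \<theta>: "0 < \<theta>" "\<theta> \<le> 1/6" and x: "x \<in> good_points n g \<theta>"
    and \<nu>: "\<nu> = real n / (real g)\<^sup>2" "4 \<le> \<nu>"
    and ann: "annulus_bound \<rho> 1 \<le> \<theta> * (\<rho>\<^sup>2 / 16)"
  shows "irrigation_cells (grid g) (outer_cells g \<rho>) (\<lambda>u. cell_of g (x u)) n (\<rho>\<^sup>2 / 16) 1024 \<nu>
     (nbhd n r x) (sel_pmf xi n r x) p (6 * \<theta>)"
proof -
  define cl where "cl = (\<lambda>u. cell_of g (x u))"
  let ?S = "outer_cells g \<rho>" and ?N = "cell_count cl {..<n}" and ?\<omega> = "\<rho>\<^sup>2 / 16"
  have xsq: "x u \<in> {0..<1} \<times> {0..<1}" if "u < n" for u using x that by (auto simp: good_points_def)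
  have N: "(1 - \<theta>) * \<nu> \<le> ?N q" "?N q \<le> (1 + \<theta>) * \<nu>" if "q \<in> grid g" for q
    using x that by (auto simp: good_points_def \<nu> cl_def)
  have \<rho>g: "\<rho> \<le> g" using \<rho>(1) r g by simp
  have \<omega>: "1 \<le> ?\<omega>" using power_mono[OF \<rho>(2), of 2] by simp
  have S_sub: "?S q \<subseteq> grid g" for q by (auto simp: outer_cells_def)
  have finS: "finite (?S q)" for q using S_sub finite_subset finite_grid by blast
  have inn: "?\<omega> \<le> card (inner_cells g \<rho> q)" if "q \<in> grid g" for q using card_inner_ge[OF that \<rho>(2) \<rho>g] .
  have io: "card (inner_cells g \<rho> q) \<le> card (?S q)" if "q \<in> grid g" for q
    using inner_sub_outer[OF that] finS by (intro card_mono)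
  have cl_in: "cl u \<in> grid g" if "u < n" for u unfolding cl_def using cell_of_in_grid[OF xsq[OF that] g] .
  have nb_sub: "nbhd n r x u \<subseteq> {v. v < n \<and> cl v \<in> ?S (cl u)}" if "u < n" for u
    using tdist_less_imp_outer[OF xsq[OF that] xsq g r(1)] by (auto simp: nbhd_def cl_def \<rho>(1))
  have nb_ge: "(1 - \<theta>) * \<nu> * card (inner_cells g \<rho> (cl u)) \<le> card (nbhd n r x u)" if u: "u < n" for u
  proof -
    let ?I = "inner_cells g \<rho> (cl u)"
    have Ig: "?I \<subseteq> grid g" by (auto simp: inner_cells_def)
    have "(1 - \<theta>) * \<nu> * card ?I = (\<Sum>q\<in>?I. (1 - \<theta>) * \<nu>)" by simp
    also have "\<dots> \<le> (\<Sum>q\<in>?I. real (?N q))" using N Ig by (intro sum_mono) auto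
    also have "\<dots> = real (card {v \<in> {..<n}. cl v \<in> ?I})"
      using finite_subset[OF Ig] by (subst card_cells_eq_sum) auto
    also have "\<dots> \<le> real (card (nbhd n r x u))"
      using inner_imp_tdist_less[OF xsq[OF u] xsq g r(1)]
      by (intro of_nat_mono card_mono) (auto simp: nbhd_def cl_def \<rho>(1))
    finally show ?thesis .
  qed
  have "irrigation_cells (grid g) ?S cl n ?\<omega> 1024 \<nu> (nbhd n r x) (sel_pmf xi n r x) p (6 * \<theta>)"
  proof (unfold_locales)
    show "finite (grid g)" by simp
    show "?S q \<subseteq> grid g" for q by (rule S_sub)
    show "q \<in> ?S q" if "q \<in> grid g" for q using that \<rho>(2) by (simp add: outer_cells_def)
    show "q \<in> ?S q'" if "q \<in> grid g" "q' \<in> ?S q" for q q'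
      using that by (simp add: outer_cells_def cdist_sym)
    show "1 \<le> ?\<omega>" by (rule \<omega>)
    show "0 < \<nu>" using \<nu>(2) by simp
    show "?\<omega> \<le> card (?S q)" if "q \<in> grid g" for q using inn[OF that] io[OF that] by linarith
    show "card (?S q) \<le> 1024 * ?\<omega>" if "q \<in> grid g" for q
    proof -
      have "card (?S q) \<le> 16 * (\<rho> + 1 + 1)\<^sup>2"
        using outer_cells_cdist \<rho> by (intro card_box_le[OF S_sub that]) auto
      \<comment> \<open>This is \<open>64 * \<rho>\<^sup>2 = 1024 * (\<rho>\<^sup>2 / 16)\<close>,
        the source of the constant 1024.\<close>
      also have "\<dots> \<le> 16 * (2 * \<rho>)\<^sup>2" using \<rho> by (intro mult_left_mono power_mono) auto
      finally show ?thesis by simp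
    qed
    show "\<nu> / 2 \<le> ?N q" if "q \<in> grid g" for q
    proof -
      have "1 / 2 * \<nu> \<le> (1 - \<theta>) * \<nu>" using \<theta> \<nu> by (intro mult_right_mono) auto
      then show ?thesis using N(1)[OF that] by simp
    qed
    show "?N q \<le> 2 * \<nu>" if "q \<in> grid g" for q
    proof -
      have "(1 + \<theta>) * \<nu> \<le> 2 * \<nu>" using \<theta> \<nu> by (intro mult_right_mono) auto
      then show ?thesis using N(2)[OF that] by simp
    qed
    show "card (window ?S q k) \<le> 1024 * (real k + 1)\<^sup>2 * ?\<omega>" if "q \<in> grid g" for q k
    proof -
      have "card (window ?S q k) \<le> 16 * (k * (\<rho> + 1) + 1)\<^sup>2"
        using window_cdist[OF _ that, of \<rho>] \<rho> by (intro card_box_le[OF _ that]) auto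
      also have "\<dots> \<le> 16 * ((real k + 1) * (2 * \<rho>))\<^sup>2"
      proof (intro mult_left_mono power_mono)
        have "k * (\<rho> + 1) + 1 \<le> (real k + 1) * (\<rho> + 1)" using \<rho> by (simp add: algebra_simps)
        also have "\<dots> \<le> (real k + 1) * (2 * \<rho>)" using \<rho> by (intro mult_left_mono) auto
        finally show "k * (\<rho> + 1) + 1 \<le> (real k + 1) * (2 * \<rho>)" .
      qed (use \<rho> in auto)
      finally show ?thesis by (simp add: power_mult_distrib mult.commute[of "(real k + 1)\<^sup>2"])
    qed
    show "cl u \<in> grid g" if "u < n" for u by (rule cl_in[OF that])
    show "0 < p" "p \<le> 1" using p by auto
    show "0 \<le> 6 * \<theta>" "6 * \<theta> \<le> 1" using \<theta> by auto
    show "nbhd n r x u \<subseteq> {v. v < n \<and> cl v \<in> ?S (cl u)}" if "u < n" for u by (rule nb_sub[OF that])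
    show "measure (sel_pmf xi n r x u) {T. T \<subseteq> A} \<le> (1 - p) * a + p * a\<^sup>2"
      if u: "u < n" and a: "real (card (nbhd n r x u \<inter> A)) \<le> a * card (nbhd n r x u)" for u A and a :: real
    proof (rule prob_selection_subset_le[OF xi p(1) _ a])
      have "1 / 2 * 4 * 1 \<le> (1 - \<theta>) * \<nu> * card (inner_cells g \<rho> (cl u))"
        using \<theta> \<nu> inn[OF cl_in[OF u]] \<omega> by (intro mult_mono) auto
      then have "2 \<le> real (card (nbhd n r x u))" using nb_ge[OF u] by linarith
      then show "2 \<le> card (nbhd n r x u)" by simp
    qed
    show "real (sum ?N (?S (cl u))) \<le> (1 + 6 * \<theta>) * card (nbhd n r x u)" if u: "u < n" for u
    proof -
      let ?q = "cl u" let ?I = "inner_cells g \<rho> ?q"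
      have q: "?q \<in> grid g" by (rule cl_in[OF u])
      have "card (?S ?q) = card ?I + card (?S ?q - ?I)"
        using inner_sub_outer[OF q, of \<rho>] finS[of ?q] io[OF q] by (simp add: card_Diff_subset finite_subset)
      then have "real (card (?S ?q)) = card ?I + card (?S ?q - ?I)" by linarith
      also have "\<dots> \<le> card ?I + \<theta> * ?\<omega>" using card_outer_minus_inner_le[OF q, of \<rho>] ann \<rho> by simp
      also have "\<dots> \<le> card ?I + \<theta> * card ?I" using inn[OF q] \<theta> by (intro add_left_mono mult_left_mono) auto
      finally have S_le: "real (card (?S ?q)) \<le> (1 + \<theta>) * card ?I" by (simp add: algebra_simps)
      have "real (sum ?N (?S ?q)) \<le> (\<Sum>q\<in>?S ?q. (1 + \<theta>) * \<nu>)"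
        unfolding of_nat_sum using N(2) S_sub[of ?q] by (intro sum_mono) blast
      also have "\<dots> = (1 + \<theta>) * \<nu> * card (?S ?q)" by simp
      also have "\<dots> \<le> (1 + \<theta>) * \<nu> * ((1 + \<theta>) * card ?I)"
        using S_le \<theta> \<nu> by (intro mult_left_mono) auto
      also have "\<dots> = ((1 + \<theta>) * (1 + \<theta>)) * (\<nu> * card ?I)" by simp
      \<comment> \<open>One factor \<open>1 + \<theta>\<close> comes from the cells between inner
        and outer, the other from the upper bound on the counts, and \<open>1 - \<theta>\<close>
        from the lower bound. This is why \<open>\<eta>\<close> is
        \<open>6 * \<theta>\<close>.\<close>
      also have "\<dots> \<le> ((1 + 6 * \<theta>) * (1 - \<theta>)) * (\<nu> * card ?I)"
      proof (rule mult_right_mono)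
        have "\<theta> * \<theta> \<le> \<theta> * (1/6)" using \<theta> by (intro mult_left_mono) auto
        then show "(1 + \<theta>) * (1 + \<theta>) \<le> (1 + 6 * \<theta>) * (1 - \<theta>)" using \<theta> by (simp add: algebra_simps)
      qed (use \<nu> in auto)
      also have "\<dots> = (1 + 6 * \<theta>) * ((1 - \<theta>) * \<nu> * card ?I)" by simp
      also have "\<dots> \<le> (1 + 6 * \<theta>) * card (nbhd n r x u)" using nb_ge[OF u] \<theta> by (intro mult_left_mono) auto
      finally show ?thesis .
    qed
  qed
  then show ?thesis by (simp add: cl_def)
qed

text \<open>The factor \<open>(real g)\<^sup>2\<close> counts the places where a closed set could be
  mixed. The near cells take the role of \<open>Z\<close>: close enough that the neighbourhood
  hardly changes, yet at least a proportion \<open>\<kappa>\<close> of \<open>\<omega>\<close>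
  many.\<close>

lemma prob_giant_given_good_points:
  fixes \<rho> \<theta> r :: real
  assumes xi: "\<forall>k\<in>set_pmf xi. 1 \<le> k" and p: "p = measure_pmf.prob xi {2..}" "0 < p"
    and g: "0 < g" and r: "0 < r" "r \<le> 1" and \<rho>: "\<rho> = r * real g" "4 \<le> \<rho>"
    and \<theta>: "0 < \<theta>" "\<theta> \<le> 1/6" and x: "x \<in> good_points n g \<theta>"
    and \<nu>: "\<nu> = real n / (real g)\<^sup>2" "4 \<le> \<nu>"
    and ann: "annulus_bound \<rho> 1 \<le> \<theta> * (\<rho>\<^sup>2 / 16)"
    and w: "1 \<le> w" "real w \<le> \<rho> / 2" "\<kappa> * (\<rho>\<^sup>2 / 16) \<le> (real w + 1)\<^sup>2" "0 < \<kappa>"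
      "annulus_bound \<rho> (real w) \<le> \<delta> / 16 * (\<rho>\<^sup>2 / 16)"
    and e: "0 < e" "e < 1/3" "\<delta> = e / 1024"
    and t: "0 < t" "t < 1" and c: "0 < c" "c + (3 * (6 * \<theta>) + t) * (2 * 1024 * (2 * real j + 2)\<^sup>2) \<le> p * (\<kappa> * (\<delta> / 4)) / 4"
    and growth: "(1 + p / (8 * 1024 * ln (1 / t))) ^ j * (\<kappa> * (\<delta> / 4)) > (2 * real j + 1)\<^sup>2 + \<kappa> * (\<delta> / 4)"
  shows "1 - (real g)\<^sup>2 * (2 * real j * (real n + 1) powr (1024 * (2 * real j + 2)\<^sup>2 * (\<rho>\<^sup>2 / 16)) * exp (- c * \<nu>))
    \<le> measure (irrig_pmf xi n r x) {Y. (1 - e) * real n \<le> real (largest_comp n (irrig_edges n Y))}"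
proof -
  define cl where "cl = (\<lambda>u. cell_of g (x u))"
  let ?M = "irrig_pmf xi n r x" and ?S = "outer_cells g \<rho>" and ?Z = "near_cells g w"
  interpret irrigation_cells "grid g" ?S cl n "\<rho>\<^sup>2 / 16" 1024 \<nu> "nbhd n r x" "sel_pmf xi n r x" p "6 * \<theta>"
    unfolding cl_def by (rule irrigation_cells_good_points) fact+
  have n: "0 < n" using \<nu> by (cases "n = 0") auto
  have \<delta>: "0 < \<delta>" "\<delta> < 1/4" using e by auto
  have Z_sub: "?Z q \<subseteq> ?S q" if q: "q \<in> grid g" for q
  proof
    fix q' assume q': "q' \<in> ?Z q"
    have "(max 0 (real_of_int (cdist g (fst q) (fst q')) - 1))\<^sup>2 + (max 0 (real_of_int (cdist g (snd q) (snd q')) - 1))\<^sup>2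
        \<le> (\<rho> / 2)\<^sup>2 + (\<rho> / 2)\<^sup>2"
    proof (intro add_mono power_mono)
      have "real_of_int (cdist g (fst q) (fst q')) \<le> real w" "real_of_int (cdist g (snd q) (snd q')) \<le> real w"
        using q' by (auto simp: near_cells_def)
      then show "max 0 (real_of_int (cdist g (fst q) (fst q')) - 1) \<le> \<rho> / 2"
        "max 0 (real_of_int (cdist g (snd q) (snd q')) - 1) \<le> \<rho> / 2" using w(2) \<rho>(2) by linarith+
    qed auto
    also have "\<dots> < \<rho>\<^sup>2" using \<rho>(2) by (simp add: power2_eq_square)
    finally show "q' \<in> ?S q" using q' by (simp add: near_cells_def outer_cells_def)
  qed
  have Z_card: "\<kappa> * (\<rho>\<^sup>2 / 16) \<le> real (card (?Z q))" if q: "q \<in> grid g" for q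
  proof -
    have "(w + 1)\<^sup>2 \<le> card (?Z q)"
    proof (rule card_translates_ge[OF q])
      have "\<rho> \<le> real g" using \<rho> r g by simp
      then show "w + 1 \<le> g" using w(2) \<rho>(2) by linarith
    qed (auto simp: near_cells_def)
    then have "real ((w + 1)\<^sup>2) \<le> real (card (?Z q))" by (rule of_nat_mono)
    then show ?thesis using w(3) by (simp add: add.commute)
  qed
  have Z_grid: "q' \<in> grid g" if "q' \<in> ?Z q" for q q' using that by (simp add: near_cells_def)
  have Z_near: "real (card (?S q - ?S q')) \<le> \<delta> / 16 * (\<rho>\<^sup>2 / 16)" "real (card (?S q' - ?S q)) \<le> \<delta> / 16 * (\<rho>\<^sup>2 / 16)"
    if "q \<in> grid g" "q' \<in> ?Z q" for q q'
    using card_outer_diff_near_le[OF that, of \<rho>] card_outer_diff_near_le[OF Z_grid[OF that(2)] near_cells_sym[OF that], of \<rho>]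
      w(5) \<rho> by linarith+
  define B where "B = 2 * real j * (real n + 1) powr (1024 * (2 * real j + 2)\<^sup>2 * (\<rho>\<^sup>2 / 16)) * exp (- c * \<nu>)"
  define mixed where "mixed q = {Y. (\<forall>u<n. Y u \<subseteq> nbhd n r x u) \<and> (\<exists>A. cut_free n Y A \<and> \<delta> \<le> share N (cell_count cl A) (?S q) \<and>
          share N (cell_count cl A) (?S q) \<le> 1 - \<delta>)}" for q
  have mixed_le: "measure ?M (mixed q) \<le> B" if q: "q \<in> grid g" for q
    unfolding mixed_def B_def irrig_pmf_def
    by (rule prob_mixed_le[OF q t w(4) \<delta>(1) _ Z_sub[OF q] Z_card[OF q] Z_near(2)[OF q] Z_near(1)[OF q] c growth])
      (use \<delta> in auto)
  let ?L = "{Y. (1 - e) * real n \<le> real (largest_comp n (irrig_edges n Y))}"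
  \<comment> \<open>Restricted to the support, where each selection lies in its neighbourhood, as
    \<open>mixed\<close> demands.\<close>
  have "- ?L \<inter> set_pmf ?M \<subseteq> (\<Union>q\<in>grid g. mixed q)"
  proof (rule ccontr)
    assume "\<not> ?thesis"
    then obtain Y where Y: "Y \<in> set_pmf ?M" "Y \<notin> ?L" "\<And>q. q \<in> grid g \<Longrightarrow> Y \<notin> mixed q" by auto
    have nb: "Y u \<subseteq> nbhd n r x u" if "u < n" for u using set_irrig_pmf_subset[OF Y(1) that] .
    have "(1 - e) * real n \<le> real (largest_comp n (irrig_edges n Y))"
    proof (rule largest_comp_ge_if_no_balanced_cut[OF _ n e(1,2)])
      show "Y u \<subseteq> {..<n}" if "u < n" for u using nb[OF that] by (auto simp: nbhd_def)
      fix A assume A: "cut_free n Y A"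
      have "real (card A) \<le> \<delta> * 1024 * real n \<or> (1 - \<delta> * 1024) * real n \<le> real (card A)"
      proof (rule card_extreme_if_unmixed[where Z = ?Z])
        show "A \<subseteq> {..<n}" using A by (simp add: cut_free_def)
        show "\<not> (\<delta> \<le> share N (cell_count cl A) (?S q) \<and> share N (cell_count cl A) (?S q) \<le> 1 - \<delta>)" if "q \<in> grid g" for q
          using Y(3)[OF that] nb A by (auto simp: mixed_def)
        show "(q, q') \<in> {(a, b). a \<in> grid g \<and> b \<in> ?Z a}\<^sup>*" if "q \<in> grid g" "q' \<in> grid g" for q q'
          by (rule near_connected[OF w(1) that])
      qed (use \<delta> Z_grid Z_near in auto)
      then show "real (card A) \<le> e * real n \<or> (1 - e) * real n \<le> real (card A)" by (simp add: e(3))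
    qed
    then show False using Y(2) by simp
  qed
  then have "measure ?M (- ?L \<inter> set_pmf ?M) \<le> measure ?M (\<Union>q\<in>grid g. mixed q)"
    by (intro measure_pmf.finite_measure_mono) auto
  also have "\<dots> \<le> (\<Sum>q\<in>grid g. measure ?M (mixed q))"
    by (intro measure_pmf.finite_measure_subadditive_finite) auto
  also have "\<dots> \<le> (\<Sum>q\<in>grid g. B)" by (intro sum_mono mixed_le)
  also have "\<dots> = (real g)\<^sup>2 * B" by (simp add: grid_def card_cartesian_product power2_eq_square)
  finally have "measure ?M (- ?L) \<le> (real g)\<^sup>2 * B" by (simp add: measure_Int_set_pmf)
  moreover have "measure ?M (- ?L) = 1 - measure ?M ?L"
    using measure_pmf.prob_compl[of ?L ?M] by (simp add: Compl_eq_Diff_UNIV)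
  ultimately show ?thesis by (simp add: B_def)
qed

section \<open>Choice of the constants\<close>

text \<open>The square root in \<open>annulus_bound\<close> is of order
  \<open>sqrt (w * \<rho>)\<close>, so a shift of \<open>v\<^sup>2 * \<rho>\<close> yields a
  relative change linear in \<open>v\<close>.\<close>

lemma annulus_bound_le:
  fixes v \<rho> :: real
  assumes v: "0 < v" "v \<le> 1" and \<rho>: "2 \<le> \<rho>" "1 \<le> v\<^sup>2 * \<rho>"
  shows "annulus_bound \<rho> (v\<^sup>2 * \<rho>) \<le> 192 * v * \<rho>\<^sup>2"
proof -
  define w where "w = v\<^sup>2 * \<rho>"
  have v2: "v\<^sup>2 \<le> v" "v\<^sup>2 \<le> 1" using v by (auto simp: power2_eq_square mult_left_le mult_le_one)
  have w: "1 \<le> w" "w \<le> \<rho>" "w \<le> v * \<rho>" using \<rho> v2 by (auto simp: w_def mult_left_le_one_le intro!: mult_right_mono)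
  have "sqrt ((w + 1) * (2 * \<rho> + w + 2)) \<le> 3 * v * \<rho>"
  proof (rule real_le_lsqrt)
    have "(w + 1) * (2 * \<rho> + w + 2) \<le> (2 * w) * (4 * \<rho>)" using w \<rho> by (intro mult_mono) auto
    also have "\<dots> \<le> (3 * v * \<rho>)\<^sup>2" using v \<rho> by (simp add: w_def power2_eq_square)
    finally show "(w + 1) * (2 * \<rho> + w + 2) \<le> (3 * v * \<rho>)\<^sup>2" .
  qed (use w v \<rho> in auto)
  then have "w + 2 + sqrt ((w + 1) * (2 * \<rho> + w + 2)) \<le> 3 * v * \<rho> + 3 * v * \<rho>" using w by linarith
  then have "annulus_bound \<rho> w \<le> (32 * \<rho>) * (3 * v * \<rho> + 3 * v * \<rho>)"
    unfolding annulus_bound_def using w v \<rho> by - (rule mult_mono, auto)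
  then show ?thesis by (simp add: w_def power2_eq_square mult_ac)
qed

lemma annulus_bound_1_negligible:
  fixes c :: real
  assumes "0 < c"
  shows "eventually (\<lambda>\<rho>. annulus_bound \<rho> 1 \<le> c * \<rho>\<^sup>2) at_top"
proof -
  have "((\<lambda>\<rho>. annulus_bound \<rho> 1 / \<rho>\<^sup>2) \<longlongrightarrow> 0) at_top"
    unfolding annulus_bound_def by real_asymp
  then have "eventually (\<lambda>\<rho>. annulus_bound \<rho> 1 / \<rho>\<^sup>2 < c) at_top"
    using assms by (intro order_tendstoD) auto
  then show ?thesis using eventually_gt_at_top[of 0]
    by eventually_elim (simp add: divide_less_eq less_imp_le)
qed

lemma prob_giant_ge:
  assumes "G \<in> sets (points_measure n)" "ennreal a \<le> emeasure (points_measure n) G" "0 \<le> b"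
    and "\<And>x. x \<in> G \<Longrightarrow> b \<le> measure (irrig_pmf xi n r x) {Y. (1 - eps) * real n \<le> real (largest_comp n (irrig_edges n Y))}"
  shows "ennreal (b * a) \<le> prob_giant xi n r eps"
proof -
  have "ennreal (b * a) = ennreal b * ennreal a" using assms(3) by (rule ennreal_mult')
  also have "\<dots> \<le> ennreal b * emeasure (points_measure n) G" using assms(2) by (rule mult_left_mono) simp
  also have "\<dots> = (\<integral>\<^sup>+x. ennreal b * indicator G x \<partial>points_measure n)"
    using assms(1) by (simp add: nn_integral_cmult_indicator)
  also have "\<dots> \<le> prob_giant xi n r eps"
    unfolding prob_giant_def
    by (intro nn_integral_mono)
      (auto simp: indicator_def measure_pmf.emeasure_eq_measure intro!: ennreal_leI assms(4))
  finally show ?thesis .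
qed

lemma prob_giant_le_1: "prob_giant xi n r eps \<le> 1"
proof -
  interpret prob_space "points_measure n" by (rule prob_space_points)
  have "prob_giant xi n r eps \<le> (\<integral>\<^sup>+x. 1 \<partial>points_measure n)"
    unfolding prob_giant_def by (intro nn_integral_mono) (auto intro: measure_pmf.emeasure_le_1)
  then show ?thesis by (simp add: emeasure_space_1)
qed

text \<open>The torus has diameter \<open>sqrt (1/2)\<close>, so radii above 1 can be cut to 1. This
  provides \<open>\<rho> \<le> g\<close> although \<open>r\<close> has no upper bound.\<close>

lemma nbhd_min_1:
  assumes "\<And>u. u < n \<Longrightarrow> x u \<in> {0..<1} \<times> {0..<1}" "u < n"
  shows "nbhd n r x u = nbhd n (min r 1) x u"
proof -
  have "tdist (x u) (x v) < 1" if "v < n" for v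
  proof -
    define e1 e2 where "e1 = min \<bar>fst (x u) - fst (x v)\<bar> (1 - \<bar>fst (x u) - fst (x v)\<bar>)"
      and "e2 = min \<bar>snd (x u) - snd (x v)\<bar> (1 - \<bar>snd (x u) - snd (x v)\<bar>)"
    have "0 \<le> e1" "e1 \<le> 1/2" "0 \<le> e2" "e2 \<le> 1/2"
      using assms(1)[OF assms(2)] assms(1)[OF that] by (auto simp: e1_def e2_def mem_Times_iff min_def)
    then have "e1\<^sup>2 + e2\<^sup>2 \<le> (1/2)\<^sup>2 + (1/2)\<^sup>2" by (intro add_mono power_mono)
    then have "e1\<^sup>2 + e2\<^sup>2 < 1" by (simp add: power2_eq_square)
    then show ?thesis unfolding tdist_def e1_def[symmetric] e2_def[symmetric] by simp
  qed
  then show ?thesis by (auto simp: nbhd_def)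
qed

lemma irrig_pmf_min_1:
  assumes "\<And>u. u < n \<Longrightarrow> x u \<in> {0..<1} \<times> {0..<1}"
  shows "irrig_pmf xi n r x = irrig_pmf xi n (min r 1) x"
  unfolding irrig_pmf_def sel_pmf_def
proof (intro Pi_pmf_cong refl)
  fix u assume "u \<in> {..<n}"
  then have "nbhd n (min r 1) x u = nbhd n r x u" by (intro nbhd_min_1[symmetric] assms) auto
  then show "xi \<bind> (\<lambda>k. pmf_of_set {S. S \<subseteq> nbhd n r x u \<and> card S = min k (card (nbhd n r x u))}) =
      xi \<bind> (\<lambda>k. pmf_of_set {S. S \<subseteq> nbhd n (min r 1) x u \<and> card S = min k (card (nbhd n (min r 1) x u))})"
    by (simp only:)
qed

theorem theorem1:
  fixes xi :: "nat pmf" and \<kappa> :: real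
  assumes "\<kappa> > 1"
    and "\<forall>k\<in>set_pmf xi. 1 \<le> k \<and> real k \<le> \<kappa>"
    and "measure_pmf.expectation xi real > 1"
  shows "\<forall>eps. 0 < eps \<and> eps < 1 \<longrightarrow>
           (\<exists>\<gamma>>0. \<forall>r :: nat \<Rightarrow> real.
              (\<forall>n. r n > 0 \<and> r n \<ge> \<gamma> * sqrt (ln (real n) / real n)) \<longrightarrow>
              (\<lambda>n. prob_giant xi n (r n) eps) \<longlonglongrightarrow> 1)"
proof (intro allI impI)
  fix eps :: real assume eps: "0 < eps \<and> eps < 1"
  have xi: "\<forall>k\<in>set_pmf xi. 1 \<le> k" using assms(2) by blast
  define p where "p = measure_pmf.prob xi {2..}"
  have p: "0 < p" unfolding p_def by (rule prob_ge_2_pos[OF xi assms(3)])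
  \<comment> \<open>The cap keeps \<open>e\<close> below \<open>1/3\<close>, as needed to single out
    one component.\<close>
  define e where "e = min eps (1/4)"
  have e: "0 < e" "e < 1/3" "e \<le> eps" using eps by (auto simp: e_def)
  \<comment> \<open>Density at most \<open>\<delta>\<close> everywhere means at most
    \<open>\<delta> * K * n\<close> vertices, which is \<open>e * n\<close> for
    \<open>K = 1024\<close>.\<close>
  define \<delta> where "\<delta> = e / 1024"
  have \<delta>: "0 < \<delta>" "\<delta> < 1" using e by (auto simp: \<delta>_def)
  \<comment> \<open>Solves \<open>192 * v = \<delta> / 256\<close>, so that a shift by
    \<open>v\<^sup>2 * \<rho>\<close> cells changes at most \<open>\<delta> / 16\<close> times
    \<open>\<rho>\<^sup>2 / 16\<close> cells.\<close>
  define v where "v = \<delta> / 49152"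
  have v: "0 < v" "v \<le> 1" "v \<le> 1/2" using \<delta> by (auto simp: v_def)
  \<comment> \<open>Makes \<open>ka * (\<rho>\<^sup>2 / 16)\<close> the square of the shift
    \<open>v\<^sup>2 * \<rho>\<close>.\<close>
  define ka where "ka = 16 * v ^ 4"
  have ka: "0 < ka" using v by (simp add: ka_def)
  then have kd: "0 < ka * (\<delta> / 4)" using \<delta> by simp
  obtain t j \<eta> c where t: "0 < t" "t < 1" and \<eta>: "0 < \<eta>" and c: "0 < c"
      and c_le: "c + (3 * \<eta> + t) * (2 * 1024 * (2 * real j + 2)\<^sup>2) \<le> p * (ka * (\<delta> / 4)) / 4"
      and growth: "(1 + p / (8 * 1024 * ln (1 / t))) ^ j * (ka * (\<delta> / 4)) > (2 * real j + 1)\<^sup>2 + ka * (\<delta> / 4)"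
    by (rule growth_constants_exist[OF p _ kd, of 1024]) (simp, rule that)
  define \<theta> where "\<theta> = min (1/6) (\<eta> / 6)"
  have \<theta>: "0 < \<theta>" "\<theta> \<le> 1/6" "6 * \<theta> \<le> \<eta>" using \<eta> by (auto simp: \<theta>_def)
  have c_le': "c + (3 * (6 * \<theta>) + t) * (2 * 1024 * (2 * real j + 2)\<^sup>2) \<le> p * (ka * (\<delta> / 4)) / 4"
  proof -
    have "(3 * (6 * \<theta>) + t) * (2 * 1024 * (2 * real j + 2)\<^sup>2) \<le> (3 * \<eta> + t) * (2 * 1024 * (2 * real j + 2)\<^sup>2)"
      using \<theta> by (intro mult_right_mono) auto
    then show ?thesis using c_le by linarith
  qed
  have "eventually (\<lambda>\<rho>. annulus_bound \<rho> 1 \<le> (\<theta> / 16) * \<rho>\<^sup>2) at_top"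
    using \<theta> by (intro annulus_bound_1_negligible) auto
  then obtain L0 where L0: "\<And>\<rho>. \<rho> \<ge> L0 \<Longrightarrow> annulus_bound \<rho> 1 \<le> (\<theta> / 16) * \<rho>\<^sup>2"
    by (auto simp: eventually_at_top_linorder)
  \<comment> \<open>Least radius in cell sides: \<open>L0\<close> makes the annulus negligible, 4
    gives the bound on inner cells, and \<open>1 / v\<^sup>2\<close> makes the shift at least one
    cell.\<close>
  define L where "L = max L0 (max 4 (1 / v\<^sup>2))"
  have L: "4 \<le> L" "1 / v\<^sup>2 \<le> L" "L0 \<le> L" by (auto simp: L_def)
  define E where "E = 1024 * (2 * real j + 2)\<^sup>2 * ((L + 1)\<^sup>2 / 16)"
  \<comment> \<open>With \<open>\<nu> \<ge> \<Gamma> * ln n\<close>, the first term gives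
    \<open>exp (- c * \<nu>) \<le> n powr (- (E + 2))\<close>, which beats about
    \<open>n powr E\<close> profiles and at most \<open>n\<close> places by a factor
    \<open>n\<close>; the second gives
    \<open>exp (- \<theta>\<^sup>2 * \<nu> / 4) \<le> n powr (- 2)\<close> for the cell
    counts.\<close>
  define \<Gamma> where "\<Gamma> = max ((E + 2) / c) (8 / \<theta>\<^sup>2)"
  have \<Gamma>: "0 < \<Gamma>" "E + 2 \<le> c * \<Gamma>" "8 \<le> \<theta>\<^sup>2 * \<Gamma>"
  proof -
    show "0 < \<Gamma>" using \<theta> by (simp add: \<Gamma>_def less_max_iff_disj)
    have "(E + 2) / c \<le> \<Gamma>" "8 / \<theta>\<^sup>2 \<le> \<Gamma>" by (auto simp: \<Gamma>_def)
    then show "E + 2 \<le> c * \<Gamma>" "8 \<le> \<theta>\<^sup>2 * \<Gamma>" using c \<theta> by (simp_all add: divide_le_eq mult.commute)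
  qed
  \<comment> \<open>A cell has side at least \<open>s / (L + 1)\<close>, so
    \<open>\<nu> \<ge> n * s\<^sup>2 / (L + 1)\<^sup>2\<close>, and this is at least
    \<open>\<Gamma> * ln n\<close>.\<close>
  define \<gamma> where "\<gamma> = (L + 1) * sqrt \<Gamma>"
  have \<gamma>: "0 < \<gamma>" "\<gamma>\<^sup>2 = (L + 1)\<^sup>2 * \<Gamma>" using \<Gamma> L by (auto simp: \<gamma>_def power_mult_distrib)
  show "\<exists>\<gamma>>0. \<forall>r :: nat \<Rightarrow> real. (\<forall>n. r n > 0 \<and> r n \<ge> \<gamma> * sqrt (ln (real n) / real n)) \<longrightarrow>
      (\<lambda>n. prob_giant xi n (r n) eps) \<longlonglongrightarrow> 1"
  proof (intro exI[of _ \<gamma>] conjI \<gamma>(1) allI impI)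
    fix r :: "nat \<Rightarrow> real" assume r: "\<forall>n. r n > 0 \<and> r n \<ge> \<gamma> * sqrt (ln (real n) / real n)"
    \<comment> \<open>\<open>b n\<close> bounds the conditional probability given good points and
      \<open>a n\<close> the probability of good points; \<open>2 powr E\<close> comes from
      \<open>n + 1 \<le> 2 * n\<close>.\<close>
    define b where "b n = 1 - 2 * real j * 2 powr E / real n" for n :: nat
    define a where "a n = 1 - 2 / real n" for n :: nat
    have lower: "ennreal (b n * a n) \<le> prob_giant xi n (r n) eps"
      if n: "3 \<le> n" "\<gamma>\<^sup>2 * ln (real n) \<le> real n" "4 \<le> \<Gamma> * ln (real n)" "0 \<le> b n" for n
    proof -
      define s where "s = min (r n) 1"
      have s: "0 < s" "s \<le> 1" using r by (auto simp: s_def)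
      \<comment> \<open>The radius then measures between \<open>L\<close> and \<open>L + 1\<close>
        cell sides, so the number of cells per window is bounded uniformly in
        \<open>n\<close>.\<close>
      define g where "g = nat \<lceil>L / s\<rceil>"
      have "L / s \<le> real g" "real g \<le> L / s + 1" using L s by (auto simp: g_def)
      then have "s * (L / s) \<le> s * g" "s * g \<le> s * (L / s + 1)" using s by (intro mult_left_mono; simp)+
      then have \<rho>: "L \<le> s * g" "s * g \<le> L + 1" using s by (auto simp: distrib_left)
      have g: "0 < g" using \<rho>(1) L by (cases "g = 0") auto
      define \<nu> where "\<nu> = real n / (real g)\<^sup>2"
      have s2: "\<gamma>\<^sup>2 * ln (real n) \<le> real n * s\<^sup>2"
      proof (cases "r n \<le> 1")
        case True
        have "ln (real n) \<ge> 0" using n by simp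
        then have "(\<gamma> * sqrt (ln (real n) / real n))\<^sup>2 \<le> (r n)\<^sup>2"
          using r \<gamma> by (intro power_mono) auto
        then show ?thesis using True n \<open>ln (real n) \<ge> 0\<close> by (simp add: s_def power_mult_distrib field_simps)
      next
        case False
        then show ?thesis using n by (simp add: s_def)
      qed
      have \<nu>_ge: "\<Gamma> * ln (real n) \<le> \<nu>"
      proof -
        have "(L + 1)\<^sup>2 * (\<Gamma> * ln (real n)) \<le> real n * s\<^sup>2" using s2 by (simp add: \<gamma> mult.assoc)
        also have "\<dots> = \<nu> * (s * g)\<^sup>2" using g by (simp add: \<nu>_def power_mult_distrib)
        also have "\<dots> \<le> \<nu> * (L + 1)\<^sup>2"
          using \<rho> s by (intro mult_left_mono power_mono) (auto simp: \<nu>_def)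
        finally have "(L + 1)\<^sup>2 * (\<Gamma> * ln (real n)) \<le> (L + 1)\<^sup>2 * \<nu>" by (simp add: mult.commute)
        moreover have "0 < (L + 1)\<^sup>2" using L by (intro zero_less_power) auto
        ultimately show ?thesis by (simp only: mult_le_cancel_left_pos)
      qed
      have \<nu>4: "4 \<le> \<nu>" using \<nu>_ge n(3) by linarith
      have g2: "(real g)\<^sup>2 \<le> real n"
      proof -
        have "1 * (real g)\<^sup>2 \<le> \<nu> * (real g)\<^sup>2" using \<nu>4 by (intro mult_right_mono) auto
        then show ?thesis using g by (simp add: \<nu>_def)
      qed
      have exp_le: "exp (- k * \<nu>) \<le> real n powr (- m)" if "m \<le> k * \<Gamma>" "0 \<le> k" for k m :: real
      proof -
        have "m * ln (real n) \<le> k * \<Gamma> * ln (real n)" using that n by (intro mult_right_mono) auto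
        also have "\<dots> \<le> k * \<nu>" using \<nu>_ge that by (simp add: mult.assoc mult_left_mono)
        finally show ?thesis using n by (simp add: powr_def)
      qed
      have a_le: "a n \<le> 1 - (real g)\<^sup>2 * (2 * exp (- \<theta>\<^sup>2 * \<nu> / 4))"
      proof -
        have "exp (- (\<theta>\<^sup>2 / 4) * \<nu>) \<le> real n powr (- 2)" using \<Gamma> by (intro exp_le) auto
        then have "(real g)\<^sup>2 * (2 * exp (- \<theta>\<^sup>2 * \<nu> / 4)) \<le> real n * (2 * real n powr (- 2))"
          using g2 by (intro mult_mono) auto
        also have "\<dots> = 2 / real n" using n by (simp add: powr_minus powr_numeral power2_eq_square field_simps)
        finally show ?thesis by (simp add: a_def)
      qed
      have G_large: "ennreal (a n) \<le> emeasure (points_measure n) (good_points n g \<theta>)"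
        by (rule order_trans[OF ennreal_leI[OF a_le] emeasure_good_points[OF g, of \<theta> n, folded \<nu>_def]])
          (use \<theta> in auto)
      define w where "w = nat \<lfloor>v\<^sup>2 * (s * g)\<rfloor>"
      have v\<rho>: "1 \<le> v\<^sup>2 * (s * g)"
      proof -
        have "1 \<le> v\<^sup>2 * L" using L(2) v by (simp add: divide_le_eq mult.commute)
        also have "\<dots> \<le> v\<^sup>2 * (s * g)" using \<rho> by (intro mult_left_mono) auto
        finally show ?thesis .
      qed
      have w: "1 \<le> w" "real w \<le> v\<^sup>2 * (s * g)" "v\<^sup>2 * (s * g) \<le> real w + 1"
        using v\<rho> by (auto simp: w_def le_nat_floor)
      have v2: "v\<^sup>2 \<le> 1/2"
      proof -
        have "v\<^sup>2 \<le> (1/2)\<^sup>2" using v(1,3) by (intro power_mono; linarith)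
        then show ?thesis by (simp add: power2_eq_square)
      qed
      have cond: "b n \<le> measure (irrig_pmf xi n (r n) x) {Y. (1 - eps) * real n \<le> real (largest_comp n (irrig_edges n Y))}"
        if x: "x \<in> good_points n g \<theta>" for x
      proof -
        let ?B = "2 * real j * (real n + 1) powr (1024 * (2 * real j + 2)\<^sup>2 * ((s * g)\<^sup>2 / 16)) * exp (- c * \<nu>)"
        have "(real g)\<^sup>2 * ?B \<le> real n * (2 * real j * (2 powr E * real n powr E) * real n powr (- (E + 2)))"
        proof (intro mult_mono)
          have "(real n + 1) powr (1024 * (2 * real j + 2)\<^sup>2 * ((s * g)\<^sup>2 / 16)) \<le> (real n + 1) powr E"
            unfolding E_def using \<rho> s L by (intro powr_mono mult_left_mono divide_right_mono power_mono) auto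
          also have "\<dots> \<le> (2 * real n) powr E" using n by (intro powr_mono2) (auto simp: E_def)
          also have "\<dots> = 2 powr E * real n powr E" by (simp add: powr_mult)
          finally show "(real n + 1) powr (1024 * (2 * real j + 2)\<^sup>2 * ((s * g)\<^sup>2 / 16)) \<le> 2 powr E * real n powr E" .
          show "exp (- c * \<nu>) \<le> real n powr (- (E + 2))" using \<Gamma> c by (intro exp_le) auto
        qed (use g2 in auto)
        also have "\<dots> = 2 * real j * 2 powr E * (real n powr 1 * real n powr E * real n powr (- (E + 2)))"
          using n by simp
        also have "real n powr 1 * real n powr E * real n powr (- (E + 2)) = 1 / real n"
          using n by (simp only: powr_add[symmetric]) (simp add: powr_minus_divide)
        finally have "b n \<le> 1 - (real g)\<^sup>2 * ?B" by (simp add: b_def)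
        also have "\<dots> \<le> measure (irrig_pmf xi n s x) {Y. (1 - e) * real n \<le> real (largest_comp n (irrig_edges n Y))}"
        proof (rule prob_giant_given_good_points[OF xi p_def p g s refl _ \<theta>(1,2) x \<nu>_def \<nu>4 _ w(1) _ _ ka _ e(1,2) \<delta>_def t c c_le' growth])
          show "4 \<le> s * real g" using \<rho> L by linarith
          show "annulus_bound (s * real g) 1 \<le> \<theta> * ((s * real g)\<^sup>2 / 16)" using L0[of "s * g"] \<rho> L by simp
          have "v\<^sup>2 * (s * g) \<le> 1/2 * (s * g)" using v2 s by (intro mult_right_mono) auto
          then show "real w \<le> s * real g / 2" using w by linarith
          have "(v\<^sup>2 * (s * g))\<^sup>2 \<le> (real w + 1)\<^sup>2" using w v\<rho> by (intro power_mono) auto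
          moreover have "ka * ((s * real g)\<^sup>2 / 16) = (v\<^sup>2 * (s * g))\<^sup>2"
            by (simp add: ka_def power_mult_distrib flip: power_mult)
          ultimately show "ka * ((s * real g)\<^sup>2 / 16) \<le> (real w + 1)\<^sup>2" by simp
          have "annulus_bound (s * real g) (real w) \<le> annulus_bound (s * real g) (v\<^sup>2 * (s * g))"
            using w s by (intro annulus_bound_mono) auto
          also have "\<dots> \<le> 192 * v * (s * g)\<^sup>2" using v \<rho> L v\<rho> by (intro annulus_bound_le) auto
          also have "\<dots> = \<delta> / 16 * ((s * real g)\<^sup>2 / 16)" by (simp add: v_def)
          finally show "annulus_bound (s * real g) (real w) \<le> \<delta> / 16 * ((s * real g)\<^sup>2 / 16)" .
        qed
        also have "\<dots> \<le> measure (irrig_pmf xi n s x) {Y. (1 - eps) * real n \<le> real (largest_comp n (irrig_edges n Y))}"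
        proof (rule measure_pmf.finite_measure_mono)
          have "(1 - eps) * real n \<le> (1 - e) * real n" using e by (intro mult_right_mono) auto
          then show "{Y. (1 - e) * real n \<le> real (largest_comp n (irrig_edges n Y))}
              \<subseteq> {Y. (1 - eps) * real n \<le> real (largest_comp n (irrig_edges n Y))}" by auto
        qed simp
        also have "irrig_pmf xi n s x = irrig_pmf xi n (r n) x"
          unfolding s_def by (rule irrig_pmf_min_1[symmetric]) (use x in \<open>auto simp: good_points_def\<close>)
        finally show ?thesis .
      qed
      show ?thesis
        by (rule prob_giant_ge[OF good_points_sets[OF g] G_large n(4) cond]) (use \<theta> in auto)
    qed
    have ev: "eventually (\<lambda>n. ennreal (b n * a n) \<le> prob_giant xi n (r n) eps) sequentially"
    proof -
      have "(\<lambda>n::nat. \<gamma>\<^sup>2 * ln (real n) / real n) \<longlonglongrightarrow> 0" by real_asymp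
      then have "eventually (\<lambda>n::nat. \<gamma>\<^sup>2 * ln (real n) / real n < 1) sequentially"
        by (rule order_tendstoD) simp
      moreover have "filterlim (\<lambda>n::nat. \<Gamma> * ln (real n)) at_top sequentially" using \<Gamma>(1) by real_asymp
      then have "eventually (\<lambda>n::nat. 4 \<le> \<Gamma> * ln (real n)) sequentially" by (simp add: filterlim_at_top)
      moreover have "b \<longlonglongrightarrow> 1" unfolding b_def by real_asymp
      then have "eventually (\<lambda>n. 0 < b n) sequentially" by (rule order_tendstoD) simp
      ultimately show ?thesis using eventually_ge_at_top[of 3]
      proof eventually_elim
        case (elim n)
        then show ?case by (intro lower) (auto simp: divide_less_eq)
      qed
    qed
    have "(\<lambda>n. b n * a n) \<longlonglongrightarrow> 1" unfolding a_def b_def by real_asymp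
    then have "(\<lambda>n. ennreal (b n * a n)) \<longlonglongrightarrow> ennreal 1" by (rule tendsto_ennrealI)
    then have lim: "(\<lambda>n. ennreal (b n * a n)) \<longlonglongrightarrow> 1" by simp
    show "(\<lambda>n. prob_giant xi n (r n) eps) \<longlonglongrightarrow> 1"
      by (rule tendsto_sandwich[OF ev _ lim tendsto_const]) (simp add: prob_giant_le_1)
  qed
qed

end
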